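(* Let $\alpha\in\mathopen]0,1[$, $q\in\mathbb{D}^+_n(\mathbb{R})$, $\eta\in\mathbb{R}^n$. Let $k\in\mathbb{C}$ be such that $k^2\notin\sigma_{q,\eta}(-\Delta)$. Let $\Omega$ be a bounded open connected subset of $\mathbb{R}^n$ of class $C^{1,\alpha}$ such that $\mathbb{R}^n\setminus\overline{\Omega}$ is connected. Let $p\in Q$. Let $\epsilon^\#_0$ be an admissible threshold (see context). Let $\mathcal{B}$ be a real analytic map from $C^{0,\alpha}(\partial\Omega)$ to $C^{0,\alpha}(\partial\Omega)$. Let $\tilde\theta$ be the unique solution in $C^{0,\alpha}(\partial\Omega)$ of $\frac12\tilde\theta+\mathcal{K}^*[\partial\Omega,\tilde\theta]=\mathcal{B}[0]$ on $\partial\Omega$. Let $\epsilon'\in\mathopen]0,\epsilon^\#_0[$, $r'\in\mathopen]0,+\infty[$, $\Theta$, and the family of solutions $\{u(\epsilon,\cdot)\}_{\epsilon\in\mathopen]0,\epsilon'[}$ of the problem $$\begin{cases}\Delta u+k^2u=0&\text{in }\mathbb{S}^-_q[\Omega_{p,\epsilon}],\\ u\text{ is }(Q,\eta)\text{-quasi-periodic},\\ \partial_{\nu_{\Omega_{p,\epsilon}}}u(x)=\mathcal{B}[u(p+\epsilon\,\cdot)]((x-p)/\epsilon)&\forall x\in\partial\Omega_{p,\epsilon}\end{cases}$$ be as in the context. Let $V$ be a bounded open subset of $\mathbb{R}^n$ such that $\overline{V}\cap(p+q\mathbb{Z}^n)=\emptyset$. Then there exist $\epsilon''\in\mathopen]0,\epsilon']$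 such that $$\overline{V}\subseteq\mathbb{S}_q^-[\Omega_{p,\epsilon}]\qquad\forall\epsilon\in\mathopen]-\epsilon'',\epsilon''[$$ and a real analytic map $U$ from $\mathopen]-\epsilon'',\epsilon''\mathclose[\times\mathopen]-r',r'[$ to $C^2(\overline{V})$ such that $$u(\epsilon,x)=\epsilon^{n-1}U[\epsilon,\tau_n\epsilon(\log\epsilon)](x)\qquad\forall x\in\overline{V}$$ for all $\epsilon\in\mathopen]0,\epsilon''[$, and that $$U[0,0](x)=G^{k}_{q,\eta}(x-p)\int_{\partial\Omega}\tilde\theta\,d\sigma\qquad\forall x\in\overline{V}.$$
   Context: Let $n\in\mathbb{N}$, $n\ge 2$. $\mathbb{D}^+_n(\mathbb{R})$ is the set of $n\times n$ real diagonal matrices with positive diagonal entries. For $q\in\mathbb{D}^+_n(\mathbb{R})$ with diagonal entries $q_{11},\dots,q_{nn}$, let $Q:=\prod_{j=1}^n\mathopen]0,q_{jj}[$ and $|Q|_n$ its $n$-dimensional measure. Functions are complex-valued; $C^{m,\alpha}$ are the usual Schauder spaces (real analyticity is meant between real Banach spaces); $C^2(\overline V)$ is the Banach space of $C^2$ functions in $V$ whose derivatives up to order two extend continuously to $\overline V$; $\mathcal{L}(X,Y)$ is the Banach space of bounded linear operators. $\Omega_{p,\epsilon}:=p+\epsilon\Omega$ for $\epsilon\in\mathbb{R}$; $\nu_D$ is the outward unit normal to $\partial D$; $0^0=1$; $\nabla F(\epsilon(t-s))$ is the gradient of $F$ evaluated at $\epsilon(t-s)$; in $\mathcal{B}[u(p+\epsilon\,\cdot)]$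 the function $u(p+\epsilon\,\cdot)$ is restricted to $\partial\Omega$. $\tau_n:=1$ if $n$ is even, $\tau_n:=0$ if $n$ is odd. For $D\subseteq\mathbb{R}^n$: $\mathbb{S}_q[D]:=\bigcup_{z\in\mathbb{Z}^n}(qz+D)$, $\mathbb{S}^-_q[D]:=\mathbb{R}^n\setminus\overline{\mathbb{S}_q[D]}$. A function $f$ is $(Q,\eta)$-quasi-periodic if $f(x+qe_h)e^{-i\eta\cdot(x+qe_h)}=f(x)e^{-i\eta\cdot x}$ for all $x$ in its (translation invariant) domain and all $h\in\{1,\dots,n\}$. Fundamental solutions. $S_n(x)$ is the classical fundamental solution of $\Delta$: $\frac{1}{2\pi}\log|x|$ if $n=2$, $\frac{1}{(2-n)s_n}|x|^{2-n}$ if $n\ge3$ ($s_n$ the measure of the unit sphere). With $J_\nu,N_\nu$ the Bessel and Neumann (second kind) functions, $\gamma$ the Euler constant, $\tilde J_\nu$ the entire extension of $t^{-\nu}J_\nu(t)$, and, for $n$ even, $\tilde N_{\frac{n-2}{2}}$ the entire extension of $t^{\frac{n-2}{2}}\{N_{\frac{n-2}{2}}(t)-\frac2\pi(\log(t/2)+\gamma)J_{\frac{n-2}{2}}(t)\}$ ($t>0$): if $n$ is even, $\mathcal{J}_n:=(2\pi)^{-n/2}\tilde J_{\frac{n-2}{2}}$, $\mathcal{N}_n:=2^{-(n/2)-1}\pi^{-(n/2)+1}\tilde N_{\frac{n-2}{2}}$; if $n$ is odd, $\mathcal{J}_n:=0$, $\mathcal{N}_n:=(-1)^{\frac{n-1}{2}}2^{-(n/2)-1}\pi^{-(n/2)+1}\tilde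 J_{-\frac{n-2}{2}}$. $S_n(x,k):=k^{n-2}\mathcal{J}_n(|x|k)\log|x|+\mathcal{N}_n(|x|k)|x|^{2-n}$ is a fundamental solution of $\Delta+k^2$; $T^k_n(x):=\mathcal{J}_n(k|x|)$. $Z_{q,\eta}(k):=\{z\in\mathbb{Z}^n:k^2=|2\pi q^{-1}z+\eta|^2\}$ and $G^{k}_{q,\eta}:=\sum_{z\in\mathbb{Z}^n\setminus Z_{q,\eta}(k)}\frac{1}{|Q|_n(k^2-|2\pi q^{-1}z+\eta|^2)}e^{ix\cdot(2\pi q^{-1}z+\eta)}$ (in $\mathcal{S}'(\mathbb{R}^n)$), a locally integrable function, real analytic on $\mathbb{R}^n\setminus q\mathbb{Z}^n$. $R_{S_n(\cdot,k)}:=G^k_{q,\eta}-S_n(\cdot,k)$ is real analytic on $(\mathbb{R}^n\setminus q\mathbb{Z}^n)\cup\{0\}$. For a density $\mu$ on $\partial D$ ($\overline D\subseteq Q$): $\mathcal{S}^{k}_{q,\eta}[\partial D,\mu](x):=\int_{\partial D}G^{k}_{q,\eta}(x-y)\mu(y)\,d\sigma_y$ ($x\in\mathbb{R}^n$), $\mathcal{S}^{k,-}_{q,\eta}[\partial D,\mu]$ is its restriction to $\overline{\mathbb{S}^-_q[D]}$, and $(\mathcal{K}^{k}_{q,\eta})^*[\partial D,\mu](x):=\int_{\partial D}\nu_D(x)\cdot\nabla G^{k}_{q,\eta}(x-y)\mu(y)\,d\sigma_y$ ($x\in\partial D$). Operators on $\partial\Omega$ ($\theta\in C^{0,\alpha}(\partial\Omega)$,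 $t\in\partial\Omega$): $\mathcal{V}[\partial\Omega,\theta](t):=\int_{\partial\Omega}S_n(t-s)\theta(s)d\sigma_s$, $\mathcal{K}^*[\partial\Omega,\theta](t):=\int_{\partial\Omega}\nu_\Omega(t)\cdot\nabla S_n(t-s)\theta(s)d\sigma_s$, $M_2[\epsilon](\theta)(t):=\int_{\partial\Omega}R_{S_n(\cdot,k)}(\epsilon(t-s))\theta(s)d\sigma_s$, $M_3[\epsilon](\theta)(t):=\int_{\partial\Omega}T^k_n(\epsilon(t-s))\theta(s)d\sigma_s$, $N_2[\epsilon](\theta)(t):=\int_{\partial\Omega}\nu_\Omega(t)\cdot\nabla R_{S_n(\cdot,k)}(\epsilon(t-s))\theta(s)d\sigma_s$, $N_3[\epsilon](\theta)(t):=\int_{\partial\Omega}\nu_\Omega(t)\cdot\nabla T^k_n(\epsilon(t-s))\theta(s)d\sigma_s$. Let $\epsilon_0>0$ be such that $p+\epsilon\overline\Omega\subseteq Q$ for all $\epsilon\in\mathopen]-\epsilon_0,\epsilon_0[$. Fix $\tilde\epsilon'_0,\tilde\epsilon''_0\in\mathopen]0,\epsilon_0[$ and real analytic maps $\tilde M_1:\mathopen]-\tilde\epsilon'_0,\tilde\epsilon'_0[\to\mathcal{L}(C^{0,\alpha}(\partial\Omega),C^{1,\alpha}(\partial\Omega))$, $\tilde N_1:\mathopen]-\tilde\epsilon''_0,\tilde\epsilon''_0[\to\mathcal{L}(C^{0,\alpha}(\partial\Omega),C^{0,\alpha}(\partial\Omega))$ (which exist) such that for all $\theta$, as functions of $t\in\partial\Omega$,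 $$\mathcal{S}^{k}_{q,\eta}[\partial\Omega_{p,\epsilon},\theta((\cdot-p)/\epsilon)](p+\epsilon t)=\epsilon\mathcal{V}[\partial\Omega,\theta]+\epsilon^2\tilde M_1[\epsilon](\theta)+\epsilon^{n-1}M_2[\epsilon](\theta)+\epsilon^{n-1}(\log\epsilon)k^{n-2}M_3[\epsilon](\theta)\quad(0<\epsilon<\tilde\epsilon'_0),$$ $$(\mathcal{K}^{k}_{q,\eta})^*[\partial\Omega_{p,\epsilon},\theta((\cdot-p)/\epsilon)](p+\epsilon t)=\mathcal{K}^*[\partial\Omega,\theta]+\epsilon\tilde N_1[\epsilon](\theta)+\epsilon^{n-1}N_2[\epsilon](\theta)+\epsilon^{n-1}(\log\epsilon)k^{n-2}N_3[\epsilon](\theta)\quad(0<\epsilon<\tilde\epsilon''_0).$$ Spectra: $\sigma_{q,\eta}(-\Delta):=\{|2\pi q^{-1}z+\eta|^2:z\in\mathbb{Z}^n\}$; $\sigma^N_{q,\eta}(-\Delta,\mathbb{S}^-_q[D])$ is the set of $\lambda\in\mathbb{C}$ for which there is a non-zero $(Q,\eta)$-quasi-periodic $u\in C^{1,\alpha}(\overline{\mathbb{S}^-_q[D]})$ with $-\Delta u=\lambda u$ in $\mathbb{S}^-_q[D]$, $\partial_{\nu_D}u=0$ on $\partial D$; $\sigma^D(-\Delta,D)$ is the set of Dirichlet eigenvalues of $-\Delta$ on $D$. Admissible threshold: $\epsilon^\#_0\in\mathopen]0,\epsilon_0[$ with $\epsilon^\#_0<\min\{\tilde\epsilon'_0,\tilde\epsilon''_0\}$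 and, for all $\epsilon\in\mathopen]0,\epsilon^\#_0[$, $k^2\notin\sigma^N_{q,\eta}(-\Delta,\mathbb{S}^-_q[\Omega_{p,\epsilon}])$ and $k^2\notin\sigma^D(-\Delta,\Omega_{p,\epsilon})$. For $(\epsilon,r,\theta)\in\mathopen]-\epsilon^\#_0,\epsilon^\#_0\mathclose[\times\mathbb{R}\times C^{0,\alpha}(\partial\Omega)$, $$\begin{aligned}\Lambda[\epsilon,r,\theta]:=\ &\tfrac12\theta+\mathcal{K}^*[\partial\Omega,\theta]+\epsilon\tilde N_1[\epsilon](\theta)+\epsilon^{n-1}N_2[\epsilon](\theta)+\epsilon^{n-2}r\,k^{n-2}N_3[\epsilon](\theta)\\&-\mathcal{B}\Big[\epsilon\mathcal{V}[\partial\Omega,\theta]+\epsilon^2\tilde M_1[\epsilon](\theta)+\epsilon^{n-1}M_2[\epsilon](\theta)+\epsilon^{n-2}r\,k^{n-2}M_3[\epsilon](\theta)\Big].\end{aligned}$$ $\epsilon'\in\mathopen]0,\epsilon^\#_0[$, $r'\in\mathopen]0,+\infty[$, an open neighborhood $\mathcal{O}_{\tilde\theta}$ of $\tilde\theta$ in $C^{0,\alpha}(\partial\Omega)$ and a real analytic map $\Theta:\mathopen]-\epsilon',\epsilon'\mathclose[\times\mathopen]-r',r'[\to\mathcal{O}_{\tilde\theta}$ are fixed such that $\epsilon\log\epsilon\in\mathopen]-r',r'[$ for all $\epsilon\in\mathopen]0,\epsilon'[$ and the set of zeros of $\Lambda$ in $\mathopen]-\epsilon',\epsilon'\mathclose[\times\mathopen]-r',r'\mathclose[\times\mathcal{O}_{\tilde\theta}$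 coincides with the graph of $\Theta$ (such objects exist; in particular $\Theta[0,0]=\tilde\theta$). The family of solutions is, for $\epsilon\in\mathopen]0,\epsilon'[$, $$u(\epsilon,x):=\mathcal{S}^{k,-}_{q,\eta}\big[\partial\Omega_{p,\epsilon},\Theta[\epsilon,\tau_n\epsilon(\log\epsilon)]((\cdot-p)/\epsilon)\big](x)\qquad\forall x\in\overline{\mathbb{S}_q^-[\Omega_{p,\epsilon}]}.$$ *)

theory Defs
  imports "HOL-Analysis.Analysis" "HOL-Library.Function_Algebras"
begin

instantiation "fun" :: (type, real_vector) real_vector
begin

definition scaleR_fun_def: "r *\<^sub>R f = (\<lambda>x. r *\<^sub>R f x)"

instance
  by standard (auto simp: scaleR_fun_def fun_eq_iff scaleR_add_right scaleR_add_left)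

end

text \<open>
  The function spaces depend on a set (and on an exponent), hence they cannot be types. A normed
  space is given by a subspace of an ambient real vector space together with a norm on it.
  A function on a set \<open>S\<close> is represented by its extension by zero outside \<open>S\<close>, so that equality
  in the ambient function type is equality on \<open>S\<close>.
\<close>

record 'a nspace =
  nset :: "'a set"
  nnorm :: "'a \<Rightarrow> real"

definition nspace_UNIV :: "'a::real_normed_vector nspace" where
  "nspace_UNIV = \<lparr>nset = UNIV, nnorm = norm\<rparr>"

definition nopen :: "'a::real_vector nspace \<Rightarrow> 'a set \<Rightarrow> bool" where
  "nopen X D \<longleftrightarrow> D \<subseteq> nset X \<and>
     (\<forall>x\<in>D. \<exists>r>0. \<forall>y\<in>nset X. nnorm X (y - x) < r \<longrightarrow> y \<in> D)"

text \<open>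
  A family of multilinear maps, one of each degree \<open>j\<close>, is a single function on lists; its value
  on lists of length \<open>j\<close> is the \<open>j\<close>-linear map. Symmetry is not imposed: symmetrization does
  not change the associated polynomial and does not increase the norm.
\<close>

definition multilinear_family :: "'a::real_vector nspace \<Rightarrow> 'b::real_vector nspace \<Rightarrow> ('a list \<Rightarrow> 'b) \<Rightarrow> bool" where
  "multilinear_family X Y A \<longleftrightarrow>
     (\<forall>hs. set hs \<subseteq> nset X \<longrightarrow> A hs \<in> nset Y) \<and>
     (\<forall>us vs x y. set us \<union> set vs \<union> {x, y} \<subseteq> nset X \<longrightarrow>
        A (us @ (x + y) # vs) = A (us @ x # vs) + A (us @ y # vs)) \<and>
     (\<forall>us vs x r. set us \<union> set vs \<union> {x} \<subseteq> nset X \<longrightarrow>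
        A (us @ (r *\<^sub>R x) # vs) = r *\<^sub>R A (us @ x # vs))"

definition real_analytic_map ::
  "'a::real_vector nspace \<Rightarrow> 'b::real_vector nspace \<Rightarrow> 'a set \<Rightarrow> ('a \<Rightarrow> 'b) \<Rightarrow> bool" where
  "real_analytic_map X Y D f \<longleftrightarrow> nopen X D \<and> f ` D \<subseteq> nset Y \<and>
     (\<forall>x0\<in>D. \<exists>A c r. 0 < r \<and> multilinear_family X Y A \<and>
        (\<forall>j. 0 \<le> c j) \<and> summable (\<lambda>j. c j * r ^ j) \<and>
        (\<forall>hs. set hs \<subseteq> nset X \<longrightarrow>
           nnorm Y (A hs) \<le> c (length hs) * prod_list (map (nnorm X) hs)) \<and>
        (\<forall>x\<in>nset X. nnorm X (x - x0) < r \<longrightarrow> x \<in> D \<and>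
           (\<lambda>N. nnorm Y (f x - (\<Sum>j<N. A (replicate j (x - x0))))) \<longlonglongrightarrow> 0))"

definition bounded_linear_ops ::
  "('a \<Rightarrow> complex) nspace \<Rightarrow> ('b \<Rightarrow> complex) nspace \<Rightarrow> (('a \<Rightarrow> complex) \<Rightarrow> ('b \<Rightarrow> complex)) nspace" where
  "bounded_linear_ops X Y =
     \<lparr>nset = {T. (\<forall>f. f \<notin> nset X \<longrightarrow> T f = 0) \<and> T ` nset X \<subseteq> nset Y \<and>
               (\<forall>f\<in>nset X. \<forall>g\<in>nset X. T (f + g) = T f + T g) \<and>
               (\<forall>f\<in>nset X. \<forall>c. T (\<lambda>t. c * f t) = (\<lambda>t. c * T f t)) \<and>
               (\<exists>C. \<forall>f\<in>nset X. nnorm Y (T f) \<le> C * nnorm X f)},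
      nnorm = (\<lambda>T. Inf {C. 0 \<le> C \<and> (\<forall>f\<in>nset X. nnorm Y (T f) \<le> C * nnorm X f)})\<rparr>"

definition restr :: "'a set \<Rightarrow> ('a \<Rightarrow> 'b::zero) \<Rightarrow> 'a \<Rightarrow> 'b" where
  "restr S f = (\<lambda>x. if x \<in> S then f x else 0)"

definition pderiv_at :: "'n::finite \<Rightarrow> (real^'n \<Rightarrow> 'b::real_normed_vector) \<Rightarrow> real^'n \<Rightarrow> 'b" where
  "pderiv_at i f x = vector_derivative (\<lambda>t. f (x + t *\<^sub>R axis i 1)) (at 0)"

primrec pderivs :: "'n::finite list \<Rightarrow> (real^'n \<Rightarrow> 'b::real_normed_vector) \<Rightarrow> real^'n \<Rightarrow> 'b" where
  "pderivs [] f = f"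
| "pderivs (i # is) f = pderiv_at i (pderivs is f)"

definition Ck_on :: "nat \<Rightarrow> (real^'n::finite) set \<Rightarrow> (real^'n \<Rightarrow> 'b::real_normed_vector) \<Rightarrow> bool" where
  "Ck_on m W f \<longleftrightarrow>
     (\<forall>is. length is \<le> m \<longrightarrow> continuous_on W (pderivs is f)) \<and>
     (\<forall>is i. length is < m \<longrightarrow>
        (\<forall>x\<in>W. (\<lambda>t. pderivs is f (x + t *\<^sub>R axis i 1)) differentiable (at 0)))"

definition sup_norm :: "'a set \<Rightarrow> ('a \<Rightarrow> 'b::real_normed_vector) \<Rightarrow> real" where
  "sup_norm S g = Sup (insert 0 ((\<lambda>x. norm (g x)) ` S))"

definition hoelder_on :: "real \<Rightarrow> 'a::metric_space set \<Rightarrow> ('a \<Rightarrow> 'b::real_normed_vector) \<Rightarrow> bool" where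
  "hoelder_on \<alpha> S g \<longleftrightarrow> (\<exists>C. \<forall>x\<in>S. \<forall>y\<in>S. norm (g x - g y) \<le> C * dist x y powr \<alpha>)"

definition hoelder_seminorm :: "real \<Rightarrow> 'a::metric_space set \<Rightarrow> ('a \<Rightarrow> 'b::real_normed_vector) \<Rightarrow> real" where
  "hoelder_seminorm \<alpha> S g =
     Sup (insert 0 {norm (g x - g y) / dist x y powr \<alpha> | x y. x \<in> S \<and> y \<in> S \<and> x \<noteq> y})"

text \<open>
  The functions of class \<open>C\<^sup>m\<close> in the open set \<open>W\<close> whose derivatives up to order \<open>m\<close> extend
  continuously to \<open>closure W\<close>. Derivatives are indexed by lists of directions, so that a mixed
  derivative is counted more than once in the norms below; this only changes them to equivalent ones.
\<close>

definition Ck_closure_set :: "nat \<Rightarrow> (real^'n::finite) set \<Rightarrow> (real^'n \<Rightarrow> 'b::real_normed_vector) set" where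
  "Ck_closure_set m W =
     {f. (\<forall>x. x \<notin> closure W \<longrightarrow> f x = 0) \<and> continuous_on (closure W) f \<and> Ck_on m W f \<and>
         (\<forall>is. length is \<le> m \<longrightarrow>
            (\<exists>g. continuous_on (closure W) g \<and> (\<forall>x\<in>W. g x = pderivs is f x)))}"

definition Ck_closure :: "nat \<Rightarrow> (real^'n::finite) set \<Rightarrow> (real^'n \<Rightarrow> complex) nspace" where
  "Ck_closure m W =
     \<lparr>nset = Ck_closure_set m W,
      nnorm = (\<lambda>f. \<Sum>is\<in>{is. length is \<le> m}. sup_norm W (pderivs is f))\<rparr>"

definition schauder_closure ::
  "nat \<Rightarrow> real \<Rightarrow> (real^'n::finite) set \<Rightarrow> (real^'n \<Rightarrow> 'b::real_normed_vector) nspace" where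
  "schauder_closure m \<alpha> W =
     \<lparr>nset = {f \<in> Ck_closure_set m W.
               (\<forall>is. length is \<le> m \<longrightarrow> bounded (pderivs is f ` W)) \<and>
               (\<forall>is. length is = m \<longrightarrow> hoelder_on \<alpha> W (pderivs is f))},
      nnorm = (\<lambda>f. (\<Sum>is\<in>{is. length is \<le> m}. sup_norm W (pderivs is f)) +
                   (\<Sum>is\<in>{is. length is = m}. hoelder_seminorm \<alpha> W (pderivs is f)))\<rparr>"

definition C0_boundary :: "real \<Rightarrow> (real^'n::finite) set \<Rightarrow> (real^'n \<Rightarrow> complex) nspace" where
  "C0_boundary \<alpha> \<Omega> =
     \<lparr>nset = {f. (\<forall>x. x \<notin> frontier \<Omega> \<longrightarrow> f x = 0) \<and> bounded (f ` frontier \<Omega>) \<and>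
                 hoelder_on \<alpha> (frontier \<Omega>) f},
      nnorm = (\<lambda>f. sup_norm (frontier \<Omega>) f + hoelder_seminorm \<alpha> (frontier \<Omega>) f)\<rparr>"

text \<open>
  \<open>C\<^sup>1\<^sup>,\<^sup>\<alpha>(\<partial>\<Omega>)\<close> consists of the boundary values of the functions of class \<open>C\<^sup>1\<^sup>,\<^sup>\<alpha>\<close> on the
  closure, with the quotient norm.
\<close>

definition C1_boundary :: "real \<Rightarrow> (real^'n::finite) set \<Rightarrow> (real^'n \<Rightarrow> complex) nspace" where
  "C1_boundary \<alpha> \<Omega> =
     \<lparr>nset = restr (frontier \<Omega>) ` nset (schauder_closure 1 \<alpha> \<Omega>),
      nnorm = (\<lambda>f. Inf {nnorm (schauder_closure 1 \<alpha> \<Omega>) F | F.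
                        F \<in> nset (schauder_closure 1 \<alpha> \<Omega>) \<and> restr (frontier \<Omega>) F = f})\<rparr>"

text \<open>
  Near each boundary point the set is the strict hypograph, in a direction \<open>v\<close>, of a function
  \<open>\<gamma>\<close> of class \<open>C\<^sup>1\<^sup>,\<^sup>\<alpha>\<close> of the variables orthogonal to \<open>v\<close>.
\<close>

definition of_class_C1 :: "real \<Rightarrow> (real^'n::finite) set \<Rightarrow> bool" where
  "of_class_C1 \<alpha> \<Omega> \<longleftrightarrow> open \<Omega> \<and>
     (\<forall>x0\<in>frontier \<Omega>. \<exists>N v (\<gamma> :: real^'n \<Rightarrow> real).
        open N \<and> x0 \<in> N \<and> norm v = 1 \<and> \<gamma> \<in> nset (schauder_closure 1 \<alpha> UNIV) \<and>
        (\<forall>x t. \<gamma> (x + t *\<^sub>R v) = \<gamma> x) \<and>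
        N \<inter> \<Omega> = {x \<in> N. x \<bullet> v < \<gamma> x})"

text \<open>
  The outward unit normal at a boundary point \<open>x\<close>: the unit vector \<open>\<nu>\<close> such that, near \<open>x\<close>, every
  cone strictly inside \<open>{w. w \<bullet> \<nu> < 0}\<close> lies in \<open>D\<close> and every cone strictly inside
  \<open>{w. w \<bullet> \<nu> > 0}\<close> lies outside \<open>D\<close>.
\<close>

definition outward_normal :: "(real^'n::finite) set \<Rightarrow> real^'n \<Rightarrow> real^'n" where
  "outward_normal D x = (THE \<nu>. norm \<nu> = 1 \<and>
     (\<forall>e>0. \<exists>d>0. \<forall>w. 0 < norm w \<and> norm w < d \<longrightarrow>
        (w \<bullet> \<nu> < - (e * norm w) \<longrightarrow> x + w \<in> D) \<and>
        (w \<bullet> \<nu> > e * norm w \<longrightarrow> x + w \<notin> D)))"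

text \<open>
  The (normalized) Hausdorff measure of dimension \<open>m \<ge> 1\<close> on the Borel sets. Boundedness of the
  covering sets is required because the library assigns an arbitrary diameter to unbounded sets.
\<close>

definition hausdorff_outer :: "nat \<Rightarrow> 'a::metric_space set \<Rightarrow> ennreal" where
  "hausdorff_outer m A =
     (SUP \<delta>\<in>{0<..}. INF E\<in>{E :: nat \<Rightarrow> 'a set. A \<subseteq> (\<Union>i. E i) \<and> (\<forall>i. bounded (E i) \<and> diameter (E i) \<le> \<delta>)}.
        (\<Sum>i. ennreal (unit_ball_vol (real m) * (diameter (E i) / 2) ^ m)))"

definition hausdorff_measure :: "nat \<Rightarrow> 'a::metric_space measure" where
  "hausdorff_measure m = measure_of UNIV (sets borel) (hausdorff_outer m)"

definition surface_measure :: "(real^'n::finite) measure" where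
  "surface_measure = hausdorff_measure (CARD('n) - 1)"

definition boundary_integral :: "(real^'n::finite) set \<Rightarrow> (real^'n \<Rightarrow> complex) \<Rightarrow> complex" where
  "boundary_integral D f = set_lebesgue_integral surface_measure (frontier D) f"

definition normal_dot_grad :: "real^'n::finite \<Rightarrow> (real^'n \<Rightarrow> complex) \<Rightarrow> real^'n \<Rightarrow> complex" where
  "normal_dot_grad \<nu> F x = (\<Sum>i\<in>UNIV. complex_of_real (\<nu> $ i) * pderiv_at i F x)"

text \<open>
  The outward (with respect to \<open>D\<close>) normal derivative at \<open>x \<in> \<partial>D\<close> of a function which is of class
  \<open>C\<^sup>1\<close> up to the boundary in \<open>W\<close>, where \<open>W\<close> may lie on the other side of \<open>\<partial>D\<close>; the gradient at
  \<open>x\<close> is its continuous extension from \<open>W\<close>.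
\<close>

definition normal_deriv ::
  "(real^'n::finite) set \<Rightarrow> (real^'n) set \<Rightarrow> (real^'n \<Rightarrow> complex) \<Rightarrow> real^'n \<Rightarrow> complex" where
  "normal_deriv D W u x =
     (\<Sum>i\<in>UNIV. complex_of_real (outward_normal D x $ i) * Lim (at x within W) (pderiv_at i u))"

definition laplacian :: "(real^'n::finite \<Rightarrow> complex) \<Rightarrow> real^'n \<Rightarrow> complex" where
  "laplacian u x = (\<Sum>i\<in>UNIV. pderiv_at i (pderiv_at i u) x)"

definition pos_diagonal :: "real^'n^'n::finite \<Rightarrow> bool" where
  "pos_diagonal q \<longleftrightarrow> (\<forall>i j. i \<noteq> j \<longrightarrow> q $ i $ j = 0) \<and> (\<forall>i. 0 < q $ i $ i)"

definition cell :: "real^'n^'n::finite \<Rightarrow> (real^'n) set" where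
  "cell q = {x. \<forall>j. 0 < x $ j \<and> x $ j < q $ j $ j}"

definition int_lattice :: "(real^'n::finite) set" where
  "int_lattice = {z. \<forall>i. z $ i \<in> \<int>}"

definition dual_freq :: "real^'n^'n::finite \<Rightarrow> real^'n \<Rightarrow> real^'n \<Rightarrow> real^'n" where
  "dual_freq q \<eta> z = (2 * pi) *\<^sub>R (matrix_inv q *v z) + \<eta>"

definition periodic_union :: "real^'n^'n::finite \<Rightarrow> (real^'n) set \<Rightarrow> (real^'n) set" where
  "periodic_union q D = (\<Union>z\<in>int_lattice. (\<lambda>x. q *v z + x) ` D)"

definition periodic_exterior :: "real^'n^'n::finite \<Rightarrow> (real^'n) set \<Rightarrow> (real^'n) set" where
  "periodic_exterior q D = - closure (periodic_union q D)"

definition inclusion :: "(real^'n::finite) set \<Rightarrow> real^'n \<Rightarrow> real \<Rightarrow> (real^'n) set" where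
  "inclusion \<Omega> p \<epsilon> = (\<lambda>x. p + \<epsilon> *\<^sub>R x) ` \<Omega>"

definition quasi_periodic_on ::
  "real^'n^'n::finite \<Rightarrow> real^'n \<Rightarrow> (real^'n) set \<Rightarrow> (real^'n \<Rightarrow> complex) \<Rightarrow> bool" where
  "quasi_periodic_on q \<eta> S f \<longleftrightarrow>
     (\<forall>x\<in>S. \<forall>h. f (x + q *v axis h 1) * exp (- \<i> * complex_of_real (\<eta> \<bullet> (x + q *v axis h 1)))
              = f x * exp (- \<i> * complex_of_real (\<eta> \<bullet> x)))"

definition spectrum_qp :: "real^'n^'n::finite \<Rightarrow> real^'n \<Rightarrow> complex set" where
  "spectrum_qp q \<eta> = {complex_of_real ((norm (dual_freq q \<eta> z))\<^sup>2) | z. z \<in> int_lattice}"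

definition spectrum_neumann ::
  "real \<Rightarrow> real^'n^'n::finite \<Rightarrow> real^'n \<Rightarrow> (real^'n) set \<Rightarrow> complex set" where
  "spectrum_neumann \<alpha> q \<eta> D =
     {lam. \<exists>u \<in> nset (schauder_closure 1 \<alpha> (periodic_exterior q D)).
        u \<noteq> 0 \<and> quasi_periodic_on q \<eta> (closure (periodic_exterior q D)) u \<and>
        Ck_on 2 (periodic_exterior q D) u \<and>
        (\<forall>x\<in>periodic_exterior q D. - laplacian u x = lam * u x) \<and>
        (\<forall>x\<in>frontier D. normal_deriv D (periodic_exterior q D) u x = 0)}"

definition spectrum_dirichlet :: "real \<Rightarrow> (real^'n::finite) set \<Rightarrow> complex set" where
  "spectrum_dirichlet \<alpha> D =
     {lam. \<exists>u \<in> nset (schauder_closure 1 \<alpha> D).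
        u \<noteq> 0 \<and> Ck_on 2 D u \<and>
        (\<forall>x\<in>D. - laplacian u x = lam * u x) \<and>
        (\<forall>x\<in>frontier D. u x = 0)}"

definition fund_sol :: "real^'n::finite \<Rightarrow> complex" where
  "fund_sol x =
     (if CARD('n) = 2 then complex_of_real (ln (norm x) / (2 * pi))
      else complex_of_real
        (norm x powi (2 - int CARD('n)) /
         ((2 - real CARD('n)) * measure (surface_measure :: (real^'n) measure) (sphere 0 1))))"

text \<open>Only meaningful for \<open>t > 0\<close>. At integer order the second kind function is obtained as a limit in the order.\<close>

definition bessel_J :: "real \<Rightarrow> real \<Rightarrow> real" where
  "bessel_J \<nu> t = (\<Sum>j. (- 1) ^ j / fact j * rGamma (\<nu> + real j + 1) * (t / 2) powr (2 * real j + \<nu>))"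

definition neumann_N :: "real \<Rightarrow> real \<Rightarrow> real" where
  "neumann_N \<nu> t = Lim (at \<nu>) (\<lambda>\<mu>. (cos (\<mu> * pi) * bessel_J \<mu> t - bessel_J (- \<mu>) t) / sin (\<mu> * pi))"

definition entire_extension :: "(real \<Rightarrow> real) \<Rightarrow> complex \<Rightarrow> complex" where
  "entire_extension f =
     (THE F. F holomorphic_on UNIV \<and> (\<forall>t>0. F (complex_of_real t) = complex_of_real (f t)))"

definition J_tilde :: "real \<Rightarrow> complex \<Rightarrow> complex" where
  "J_tilde \<nu> = entire_extension (\<lambda>t. t powr (- \<nu>) * bessel_J \<nu> t)"

text \<open>The order is \<open>(n - 2)/2\<close>, for \<open>n\<close> even.\<close>

definition N_tilde :: "nat \<Rightarrow> complex \<Rightarrow> complex" where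
  "N_tilde n =
     (let \<nu> = (real n - 2) / 2 in
      entire_extension
        (\<lambda>t. t powr \<nu> * (neumann_N \<nu> t - 2 / pi * (ln (t / 2) + euler_mascheroni) * bessel_J \<nu> t)))"

definition J_fun :: "nat \<Rightarrow> complex \<Rightarrow> complex" where
  "J_fun n z =
     (if even n
      then complex_of_real ((2 * pi) powr (- (real n / 2))) * J_tilde ((real n - 2) / 2) z
      else 0)"

definition N_fun :: "nat \<Rightarrow> complex \<Rightarrow> complex" where
  "N_fun n z =
     (if even n
      then complex_of_real (2 powr (- (real n / 2) - 1) * pi powr (- (real n / 2) + 1)) * N_tilde n z
      else complex_of_real ((- 1) ^ ((n - 1) div 2) *
             2 powr (- (real n / 2) - 1) * pi powr (- (real n / 2) + 1)) *
           J_tilde (- ((real n - 2) / 2)) z)"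

definition helmholtz_sol :: "complex \<Rightarrow> real^'n::finite \<Rightarrow> complex" where
  "helmholtz_sol k x =
     k ^ (CARD('n) - 2) * J_fun CARD('n) (complex_of_real (norm x) * k) * complex_of_real (ln (norm x)) +
     N_fun CARD('n) (complex_of_real (norm x) * k) * complex_of_real (norm x powi (2 - int CARD('n)))"

definition T_fun :: "complex \<Rightarrow> real^'n::finite \<Rightarrow> complex" where
  "T_fun k x = J_fun CARD('n) (k * complex_of_real (norm x))"

definition schwartz_function :: "(real^'n::finite \<Rightarrow> complex) \<Rightarrow> bool" where
  "schwartz_function \<phi> \<longleftrightarrow> (\<forall>m. Ck_on m UNIV \<phi>) \<and>
     (\<forall>m is. bounded (range (\<lambda>x. norm x ^ m *\<^sub>R pderivs is \<phi> x)))"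

definition resonant_set :: "real^'n^'n::finite \<Rightarrow> real^'n \<Rightarrow> complex \<Rightarrow> (real^'n) set" where
  "resonant_set q \<eta> k =
     {z \<in> int_lattice. k\<^sup>2 = complex_of_real ((norm (dual_freq q \<eta> z))\<^sup>2)}"

text \<open>
  \<open>is_qp_green q \<eta> k G\<close>: the function \<open>G\<close> is the tempered distribution
  \<open>\<Sum>z. exp(\<i> x\<bullet>(2\<pi>q\<^sup>-\<^sup>1z + \<eta>)) / (|Q| (k\<^sup>2 - |2\<pi>q\<^sup>-\<^sup>1z + \<eta>|\<^sup>2))\<close>, the series over the
  non-resonant \<open>z\<close> being convergent in the sense of tempered distributions. A locally integrable
  function is determined by the distribution only almost everywhere; \<open>G\<close> is the representative
  which is real analytic off \<open>q\<int>\<^sup>n\<close>, which makes its values there unique. The values on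
  \<open>q\<int>\<^sup>n\<close> are irrelevant.
\<close>

definition is_qp_green ::
  "real^'n^'n::finite \<Rightarrow> real^'n \<Rightarrow> complex \<Rightarrow> (real^'n \<Rightarrow> complex) \<Rightarrow> bool" where
  "is_qp_green q \<eta> k G \<longleftrightarrow>
     (\<forall>K. compact K \<longrightarrow> set_integrable lborel K G) \<and>
     real_analytic_map nspace_UNIV nspace_UNIV (- ((*v) q ` int_lattice)) G \<and>
     (\<forall>\<phi>. schwartz_function \<phi> \<longrightarrow>
        integrable lborel (\<lambda>x. G x * \<phi> x) \<and>
        ((\<lambda>z. 1 / (complex_of_real (measure lborel (cell q)) *
                   (k\<^sup>2 - complex_of_real ((norm (dual_freq q \<eta> z))\<^sup>2))) *
              (LINT x|lborel. exp (\<i> * complex_of_real (x \<bullet> dual_freq q \<eta> z)) * \<phi> x))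
          has_sum (LINT x|lborel. G x * \<phi> x)) (int_lattice - resonant_set q \<eta> k))"

text \<open>The regular part \<open>G - S\<^sub>n(\<cdot>,k)\<close>, with its removable singularity at the origin removed.\<close>

definition regular_part :: "(real^'n::finite \<Rightarrow> complex) \<Rightarrow> complex \<Rightarrow> real^'n \<Rightarrow> complex" where
  "regular_part G k x =
     (if x = 0 then Lim (at 0) (\<lambda>y. G y - helmholtz_sol k y) else G x - helmholtz_sol k x)"

definition qp_single_layer ::
  "(real^'n::finite \<Rightarrow> complex) \<Rightarrow> (real^'n) set \<Rightarrow> (real^'n \<Rightarrow> complex) \<Rightarrow> real^'n \<Rightarrow> complex" where
  "qp_single_layer G D \<mu> x = boundary_integral D (\<lambda>y. G (x - y) * \<mu> y)"

definition qp_single_layer_ext ::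
  "real^'n^'n::finite \<Rightarrow> (real^'n \<Rightarrow> complex) \<Rightarrow> (real^'n) set \<Rightarrow> (real^'n \<Rightarrow> complex) \<Rightarrow> real^'n \<Rightarrow> complex" where
  "qp_single_layer_ext q G D \<mu> =
     restr (closure (periodic_exterior q D)) (qp_single_layer G D \<mu>)"

definition qp_K_star ::
  "(real^'n::finite \<Rightarrow> complex) \<Rightarrow> (real^'n) set \<Rightarrow> (real^'n \<Rightarrow> complex) \<Rightarrow> real^'n \<Rightarrow> complex" where
  "qp_K_star G D \<mu> x =
     boundary_integral D (\<lambda>y. normal_dot_grad (outward_normal D x) G (x - y) * \<mu> y)"

definition op_V :: "(real^'n::finite) set \<Rightarrow> (real^'n \<Rightarrow> complex) \<Rightarrow> real^'n \<Rightarrow> complex" where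
  "op_V \<Omega> \<theta> = restr (frontier \<Omega>) (\<lambda>t. boundary_integral \<Omega> (\<lambda>s. fund_sol (t - s) * \<theta> s))"

definition op_K_star :: "(real^'n::finite) set \<Rightarrow> (real^'n \<Rightarrow> complex) \<Rightarrow> real^'n \<Rightarrow> complex" where
  "op_K_star \<Omega> \<theta> = restr (frontier \<Omega>)
     (\<lambda>t. boundary_integral \<Omega> (\<lambda>s. normal_dot_grad (outward_normal \<Omega> t) fund_sol (t - s) * \<theta> s))"

definition op_M2 :: "(real^'n::finite \<Rightarrow> complex) \<Rightarrow> complex \<Rightarrow> (real^'n) set \<Rightarrow> real \<Rightarrow>
    (real^'n \<Rightarrow> complex) \<Rightarrow> real^'n \<Rightarrow> complex" where
  "op_M2 G k \<Omega> \<epsilon> \<theta> = restr (frontier \<Omega>)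
     (\<lambda>t. boundary_integral \<Omega> (\<lambda>s. regular_part G k (\<epsilon> *\<^sub>R (t - s)) * \<theta> s))"

definition op_M3 :: "complex \<Rightarrow> (real^'n::finite) set \<Rightarrow> real \<Rightarrow>
    (real^'n \<Rightarrow> complex) \<Rightarrow> real^'n \<Rightarrow> complex" where
  "op_M3 k \<Omega> \<epsilon> \<theta> = restr (frontier \<Omega>)
     (\<lambda>t. boundary_integral \<Omega> (\<lambda>s. T_fun k (\<epsilon> *\<^sub>R (t - s)) * \<theta> s))"

definition op_N2 :: "(real^'n::finite \<Rightarrow> complex) \<Rightarrow> complex \<Rightarrow> (real^'n) set \<Rightarrow> real \<Rightarrow>
    (real^'n \<Rightarrow> complex) \<Rightarrow> real^'n \<Rightarrow> complex" where
  "op_N2 G k \<Omega> \<epsilon> \<theta> = restr (frontier \<Omega>)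
     (\<lambda>t. boundary_integral \<Omega>
        (\<lambda>s. normal_dot_grad (outward_normal \<Omega> t) (regular_part G k) (\<epsilon> *\<^sub>R (t - s)) * \<theta> s))"

definition op_N3 :: "complex \<Rightarrow> (real^'n::finite) set \<Rightarrow> real \<Rightarrow>
    (real^'n \<Rightarrow> complex) \<Rightarrow> real^'n \<Rightarrow> complex" where
  "op_N3 k \<Omega> \<epsilon> \<theta> = restr (frontier \<Omega>)
     (\<lambda>t. boundary_integral \<Omega>
        (\<lambda>s. normal_dot_grad (outward_normal \<Omega> t) (T_fun k) (\<epsilon> *\<^sub>R (t - s)) * \<theta> s))"

definition Lambda_op ::
  "(real^'n::finite \<Rightarrow> complex) \<Rightarrow> complex \<Rightarrow> (real^'n) set \<Rightarrow>
   (real \<Rightarrow> (real^'n \<Rightarrow> complex) \<Rightarrow> real^'n \<Rightarrow> complex) \<Rightarrow>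
   (real \<Rightarrow> (real^'n \<Rightarrow> complex) \<Rightarrow> real^'n \<Rightarrow> complex) \<Rightarrow>
   ((real^'n \<Rightarrow> complex) \<Rightarrow> real^'n \<Rightarrow> complex) \<Rightarrow>
   real \<Rightarrow> real \<Rightarrow> (real^'n \<Rightarrow> complex) \<Rightarrow> real^'n \<Rightarrow> complex" where
  "Lambda_op G k \<Omega> M1 N1 B \<epsilon> r \<theta> =
     (let n = CARD('n); e = complex_of_real \<epsilon>; rc = complex_of_real r in
      (\<lambda>t. \<theta> t / 2 + op_K_star \<Omega> \<theta> t + e * N1 \<epsilon> \<theta> t + e ^ (n - 1) * op_N2 G k \<Omega> \<epsilon> \<theta> t
           + e ^ (n - 2) * rc * k ^ (n - 2) * op_N3 k \<Omega> \<epsilon> \<theta> t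
           - B (\<lambda>s. e * op_V \<Omega> \<theta> s + e\<^sup>2 * M1 \<epsilon> \<theta> s + e ^ (n - 1) * op_M2 G k \<Omega> \<epsilon> \<theta> s
                    + e ^ (n - 2) * rc * k ^ (n - 2) * op_M3 k \<Omega> \<epsilon> \<theta> s) t))"

definition tau :: "nat \<Rightarrow> real" where
  "tau n = (if even n then 1 else 0)"

definition solution_family ::
  "real^'n^'n::finite \<Rightarrow> (real^'n \<Rightarrow> complex) \<Rightarrow> (real^'n) set \<Rightarrow> real^'n \<Rightarrow>
   (real \<times> real \<Rightarrow> real^'n \<Rightarrow> complex) \<Rightarrow> real \<Rightarrow> real^'n \<Rightarrow> complex" where
  "solution_family q G \<Omega> p \<Theta> \<epsilon> =
     qp_single_layer_ext q G (inclusion \<Omega> p \<epsilon>)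
       (\<lambda>y. \<Theta> (\<epsilon>, tau CARD('n) * (\<epsilon> * ln \<epsilon>)) ((y - p) /\<^sub>R \<epsilon>))"

end

theory Submission
  imports Defs
begin

text \<open>
  Rescaling the single layer potential by \<open>y = p + \<epsilon> s\<close> turns the solution into \<open>\<epsilon>\<^sup>n\<^sup>-\<^sup>1\<close> times
  \<open>U(\<epsilon>, r)(x) = \<integral> G(x - p - \<epsilon> s) \<Theta>(\<epsilon>, r)(s) d\<sigma>\<close> over \<open>\<partial>\<Omega>\<close>, and this formula makes sense for
  negative \<open>\<epsilon>\<close> as well. For \<open>x\<close> in the closure of \<open>V\<close> and small \<open>\<epsilon>\<close> the argument of \<open>G\<close> stays in
  a compact subset of the domain of analyticity of \<open>G\<close>, where the partial derivatives of \<open>G\<close> of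
  order \<open>j\<close> are bounded by \<open>C M\<^sup>j j!\<close>. Hence the Taylor series of the kernel in \<open>\<epsilon>\<close> converges
  geometrically together with its \<open>x\<close>-derivatives up to order two, and its Cauchy product with the
  expansion of \<open>\<Theta>\<close> is an expansion of \<open>U\<close> in \<open>C\<^sup>2\<close>. Its sum need only be identified pointwise, since
  an absolutely convergent series in \<open>C\<^sup>2\<close> may be differentiated term by term. Finally
  \<open>\<Theta>(0, 0)\<close> is the given \<open>\<theta>\<close> because \<open>\<Lambda>[0, 0, \<cdot>]\<close> is the limiting boundary equation.
\<close>

section \<open>Power series in finite dimension\<close>

text \<open>Analyticity asks for bounded multilinear forms at every point of the parameter
  rectangle, so the Cauchy product has to be realized by forms on lists. As symmetry is not imposed,
  the first \<open>j\<close> increments can contribute only their \<epsilon>-components, the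
  remaining ones being passed to the form of \<Theta>. The expansions of \<open>G\<close> are local;
  a finite cover of a compact set of arguments \<open>x - p - \<epsilon> s\<close> turns them into
  the single bound on all partial derivatives, in which two further \<open>x\<close>-derivatives
  only change \<open>C\<close> and \<open>M\<close>. The ratio of the Taylor series in \<epsilon> is
  then governed by \<open>n R M\<close>, with \<open>R\<close> a bound for the points of the
  boundary. Since the surface measure is a Hausdorff measure, two facts about it have to be
  supplied: its scaling under homotheties, which produces the exponent \<open>n - 1\<close>, and its
  finiteness on the boundary, which locally is a Lipschitz graph. The constant
  \<open>\<epsilon>2\<close> is geometric: if \<open>d\<close> separates the closure of
  \<open>V\<close> from the points \<open>p + q z\<close>, then
  \<open>\<bar>\<epsilon>\<bar> R < d / 2\<close> keeps the inclusions away from \<open>V\<close>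
  and the arguments of \<open>G\<close> off the lattice.\<close>

definition insertions :: "('a list \<Rightarrow> 'b::comm_monoid_add) \<Rightarrow> 'a \<Rightarrow> 'a list \<Rightarrow> 'b" where
  "insertions A e hs = (\<Sum>k\<le>length hs. A (take k hs @ e # drop k hs))"

abbreviation multilinear :: "('a::real_normed_vector list \<Rightarrow> 'b::real_normed_vector) \<Rightarrow> bool" where
  "multilinear \<equiv> multilinear_family nspace_UNIV nspace_UNIV"

lemma multilinear_add: "multilinear A \<Longrightarrow> A (us @ (x + y) # vs) = A (us @ x # vs) + A (us @ y # vs)"
  and multilinear_scaleR: "multilinear A \<Longrightarrow> A (us @ (r *\<^sub>R x) # vs) = r *\<^sub>R A (us @ x # vs)"
  unfolding multilinear_family_def nspace_UNIV_def by simp_all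

lemma multilinearI:
  assumes "\<And>us vs x y. A (us @ (x + y) # vs) = A (us @ x # vs) + A (us @ y # vs)"
    and "\<And>us vs x r. A (us @ (r *\<^sub>R x) # vs) = r *\<^sub>R A (us @ x # vs)"
  shows "multilinear A"
  unfolding multilinear_family_def nspace_UNIV_def using assms by simp

text \<open>The inserted vector lands before or after \<open>x\<close>. In both sums
  \<open>x\<close> still fills one slot of \<open>A\<close>, which is the form in which linearity in
  that slot carries over to \<open>insertions A e\<close>.\<close>

lemma insertions_append_Cons:
  "insertions A e (us @ x # vs) =
     (\<Sum>k\<le>length us. A (take k us @ e # drop k us @ x # vs)) +
     (\<Sum>k\<le>length vs. A (us @ x # take k vs @ e # drop k vs))"
proof -
  have eq: "{..length (us @ x # vs)} = {..length us} \<union> (\<lambda>k. Suc (length us + k)) ` {..length vs}"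
    (is "?L = ?R")
  proof (intro set_eqI iffI)
    fix m assume m: "m \<in> ?L"
    show "m \<in> ?R"
    proof (cases "m \<le> length us")
      case False
      then show ?thesis
        using m by (intro UnI2 image_eqI[where x = "m - Suc (length us)"]) auto
    qed auto
  qed auto
  have "insertions A e (us @ x # vs) =
      (\<Sum>k\<le>length us. A (take k (us @ x # vs) @ e # drop k (us @ x # vs))) +
      (\<Sum>k\<in>(\<lambda>k. Suc (length us + k)) ` {..length vs}. A (take k (us @ x # vs) @ e # drop k (us @ x # vs)))"
    unfolding insertions_def eq by (subst sum.union_disjoint) auto
  also have "\<dots> = (\<Sum>k\<le>length us. A (take k us @ e # drop k us @ x # vs)) +
     (\<Sum>k\<le>length vs. A (us @ x # take k vs @ e # drop k vs))"
    by (subst sum.reindex) (auto simp: inj_on_def)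
  finally show ?thesis .
qed

lemma multilinear_insertions:
  assumes "multilinear A"
  shows "multilinear (insertions A e)"
proof (rule multilinearI)
  note add = multilinear_add[OF assms] and scale = multilinear_scaleR[OF assms]
  fix us vs x y r
  have l: "A (take k us @ e # drop k us @ z # vs) = A ((take k us @ e # drop k us) @ z # vs)"
    and r: "A (us @ z # take k vs @ e # drop k vs) = A (us @ z # (take k vs @ e # drop k vs))" for k z
    by simp_all
  show "insertions A e (us @ (x + y) # vs) = insertions A e (us @ x # vs) + insertions A e (us @ y # vs)"
    unfolding insertions_append_Cons l by (simp only: add sum.distrib) (simp add: algebra_simps)
  show "insertions A e (us @ (r *\<^sub>R x) # vs) = r *\<^sub>R insertions A e (us @ x # vs)"
    unfolding insertions_append_Cons l by (simp only: scale scaleR_add_right scaleR_sum_right)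
qed

lemma insertions_bound:
  assumes "\<And>hs. norm (A hs) \<le> c (length hs) * prod_list (map norm hs)"
  shows "norm (insertions A e hs) \<le>
    real (Suc (length hs)) * c (Suc (length hs)) * norm e * prod_list (map norm hs)"
proof -
  have "norm (A (take k hs @ e # drop k hs)) \<le> c (Suc (length hs)) * norm e * prod_list (map norm hs)"
    if "k \<le> length hs" for k
  proof -
    have "prod_list (map norm hs) = prod_list (map norm (take k hs)) * prod_list (map norm (drop k hs))"
      by (metis append_take_drop_id map_append prod_list.append)
    then show ?thesis
      using assms[of "take k hs @ e # drop k hs"] that by (simp add: algebra_simps)
  qed
  then have "(\<Sum>k\<le>length hs. norm (A (take k hs @ e # drop k hs)))
      \<le> of_nat (card {..length hs}) * (c (Suc (length hs)) * norm e * prod_list (map norm hs))"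
    by (intro sum_bounded_above) auto
  then show ?thesis
    unfolding insertions_def by (intro order_trans[OF norm_sum]) (simp add: algebra_simps)
qed

text \<open>As \<open>A\<close> need not be symmetric, the derivative of
  \<open>A (replicate (Suc m) v)\<close> in the direction \<open>e\<close> is the sum over all
  positions at which one \<open>v\<close> is replaced by \<open>e\<close>; this identifies that sum
  with \<open>insertions\<close>.\<close>

lemma insertions_replicate:
  "insertions A e (replicate m v) = (\<Sum>k<Suc m. A (replicate k v @ e # replicate (m - k) v))"
  unfolding insertions_def lessThan_Suc_atMost
  by (intro sum.cong) (auto simp: min_def)

text \<open>Linearity of the derivative in its direction, read off from the coefficients; it later
  expresses a directional derivative through partial derivatives without a detour through total
  differentiability.\<close>

lemma insertions_sum_direction:
  assumes "multilinear A" "finite I"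
  shows "insertions A (\<Sum>i\<in>I. a i *\<^sub>R b i) hs = (\<Sum>i\<in>I. a i *\<^sub>R insertions A (b i) hs)"
  using assms(2)
proof (induction I rule: finite_induct)
  case empty
  have "A (take k hs @ 0 # drop k hs) = 0" for k
    using multilinear_scaleR[OF assms(1), of "take k hs" 0 0 "drop k hs"] by simp
  then show ?case by (simp add: insertions_def)
next
  case (insert i I)
  have "insertions A (x + y) hs = insertions A x hs + insertions A y hs"
    "insertions A (r *\<^sub>R x) hs = r *\<^sub>R insertions A x hs" for x y r
    unfolding insertions_def
    by (simp_all add: multilinear_add[OF assms(1)] multilinear_scaleR[OF assms(1)] sum.distrib scaleR_sum_right)
  with insert show ?case by simp
qed

text \<open>Induction on \<open>m\<close> with an arbitrary prefix: the first copy of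
  \<open>w + t e\<close> splits by linearity into \<open>w\<close> and \<open>t e\<close>, the
  chosen vector joins the prefix, and the product rule in \<open>t\<close> supplies the term with
  \<open>e\<close> in first place.\<close>

lemma has_vector_derivative_multilinear:
  fixes A :: "'a::real_normed_vector list \<Rightarrow> 'b::real_normed_vector"
  assumes "multilinear A"
  shows "((\<lambda>t. A (us @ replicate m (w + t *\<^sub>R e))) has_vector_derivative
    (\<Sum>k<m. A (us @ replicate k (w + t *\<^sub>R e) @ e # replicate (m - Suc k) (w + t *\<^sub>R e)))) (at t)"
proof (induction m arbitrary: us)
  case 0
  show ?case by simp
next
  case (Suc m)
  note lin = multilinear_add[OF assms] multilinear_scaleR[OF assms]
  define v where "v = w + t *\<^sub>R e"
  have eq: "A (us @ replicate (Suc m) (w + t *\<^sub>R e)) =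
    A ((us @ [w]) @ replicate m (w + t *\<^sub>R e)) + t *\<^sub>R A ((us @ [e]) @ replicate m (w + t *\<^sub>R e))" for t
    by (simp add: lin)
  have split: "A (us @ v # l) = A (us @ w # l) + t *\<^sub>R A (us @ e # l)" for l
    unfolding v_def by (simp add: lin)
  have "((\<lambda>t. A ((us @ [w]) @ replicate m (w + t *\<^sub>R e)) + t *\<^sub>R A ((us @ [e]) @ replicate m (w + t *\<^sub>R e)))
    has_vector_derivative
      ((\<Sum>k<m. A ((us @ [w]) @ replicate k v @ e # replicate (m - Suc k) v))
      + (t *\<^sub>R (\<Sum>k<m. A ((us @ [e]) @ replicate k v @ e # replicate (m - Suc k) v))
         + 1 *\<^sub>R A ((us @ [e]) @ replicate m v)))) (at t)"
    unfolding v_def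
    by (rule has_vector_derivative_add[OF Suc has_vector_derivative_scaleR[OF DERIV_ident Suc]])
  also have "((\<Sum>k<m. A ((us @ [w]) @ replicate k v @ e # replicate (m - Suc k) v))
      + (t *\<^sub>R (\<Sum>k<m. A ((us @ [e]) @ replicate k v @ e # replicate (m - Suc k) v))
         + 1 *\<^sub>R A ((us @ [e]) @ replicate m v)))
    = (\<Sum>k<Suc m. A (us @ replicate k v @ e # replicate (Suc m - Suc k) v))"
    by (subst sum.lessThan_Suc_shift) (simp add: split sum.distrib scaleR_sum_right algebra_simps)
  finally show ?case unfolding eq v_def .
qed

text \<open>
  Only summability below the radius is required, so that the notion is stable under differentiation
  without shrinking the ball.
\<close>

definition expands ::
  "('a::real_normed_vector list \<Rightarrow> 'b::real_normed_vector) \<Rightarrow> (nat \<Rightarrow> real) \<Rightarrow> real \<Rightarrow> 'a \<Rightarrow> ('a \<Rightarrow> 'b) \<Rightarrow> bool" where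
  "expands A c r y0 F \<longleftrightarrow> 0 < r \<and> multilinear A \<and> (\<forall>j. 0 \<le> c j) \<and>
     (\<forall>r'. 0 \<le> r' \<longrightarrow> r' < r \<longrightarrow> summable (\<lambda>j. c j * r' ^ j)) \<and>
     (\<forall>hs. norm (A hs) \<le> c (length hs) * prod_list (map norm hs)) \<and>
     (\<forall>w. norm w < r \<longrightarrow> (\<lambda>j. A (replicate j w)) sums F (y0 + w))"

text \<open>The M-test makes the differentiated series converge uniformly on \<open>S\<close>.
  Termwise differentiation yields some sum \<open>g\<close>, and uniqueness of limits identifies it
  with the prescribed \<open>F\<close>.\<close>

lemma has_vector_derivative_series':
  fixes f :: "nat \<Rightarrow> real \<Rightarrow> 'b::banach"
  assumes S: "convex S" "open S" "x \<in> S"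
    and d: "\<And>n t. t \<in> S \<Longrightarrow> (f n has_vector_derivative f' n t) (at t)"
    and b: "\<And>n t. t \<in> S \<Longrightarrow> norm (f' n t) \<le> B n" "summable B"
    and f: "\<And>t. t \<in> S \<Longrightarrow> (\<lambda>n. f n t) sums F t"
  shows "(F has_vector_derivative (\<Sum>n. f' n x)) (at x)"
proof -
  have ul: "uniform_limit S (\<lambda>n t. \<Sum>i<n. f' i t) (\<lambda>t. \<Sum>i. f' i t) sequentially"
    by (rule Weierstrass_m_test) (use b in auto)
  have "\<exists>g. \<forall>t\<in>S. (\<lambda>n. f n t) sums g t \<and> (g has_derivative (\<lambda>h. h *\<^sub>R (\<Sum>i. f' i t))) (at t within S)"
  proof (rule has_derivative_series[OF S(1)])
    show "(f n has_derivative (\<lambda>h. h *\<^sub>R f' n t)) (at t within S)" if "t \<in> S" for n t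
      using d[OF that] by (simp add: has_vector_derivative_def has_derivative_at_withinI)
    show "\<forall>\<^sub>F n in sequentially. \<forall>t\<in>S. \<forall>h. norm ((\<Sum>i<n. h *\<^sub>R f' i t) - h *\<^sub>R (\<Sum>i. f' i t)) \<le> e * norm h"
      if "e > 0" for e
      using uniform_limitD[OF ul that]
    proof (eventually_elim, safe)
      fix n t h assume *: "\<forall>t\<in>S. dist (\<Sum>i<n. f' i t) (\<Sum>i. f' i t) < e" "t \<in> S"
      have "norm ((\<Sum>i<n. f' i t) - (\<Sum>i. f' i t)) \<le> e"
        using * by (auto simp: dist_norm intro: less_imp_le)
      then have "norm (h *\<^sub>R ((\<Sum>i<n. f' i t) - (\<Sum>i. f' i t))) \<le> \<bar>h\<bar> * e"
        by (simp add: mult_left_mono)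
      then show "norm ((\<Sum>i<n. h *\<^sub>R f' i t) - h *\<^sub>R (\<Sum>i. f' i t)) \<le> e * norm h"
        by (simp add: scaleR_sum_right[symmetric] scaleR_diff_right mult.commute)
    qed
    show "x \<in> S" by fact
    show "(\<lambda>n. f n x) sums F x" using f S by auto
  qed
  then obtain g where g: "\<And>t. t \<in> S \<Longrightarrow> (\<lambda>n. f n t) sums g t"
    "(g has_derivative (\<lambda>h. h *\<^sub>R (\<Sum>i. f' i x))) (at x within S)"
    using S by blast
  have "g t = F t" if "t \<in> S" for t
    using g(1) f that sums_unique2 by blast
  then have "(F has_derivative (\<lambda>h. h *\<^sub>R (\<Sum>i. f' i x))) (at x within S)"
    using g(2) has_derivative_transform[OF S(3), of F g] by simp
  then show ?thesis
    unfolding has_vector_derivative_def at_within_open[OF S(3,2)] .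
qed

lemma summable_diffs_below:
  fixes c :: "nat \<Rightarrow> real"
  assumes c: "\<And>r'. 0 \<le> r' \<Longrightarrow> r' < r \<Longrightarrow> summable (\<lambda>j. c j * r' ^ j)"
    and nn: "\<And>j. 0 \<le> c j" and r: "0 \<le> r'" "r' < r"
  shows "summable (\<lambda>j. (real (Suc j) * c (Suc j)) * r' ^ j)"
proof -
  have "summable (\<lambda>j. diffs c j * r' ^ j)"
  proof (rule termdiff_converges)
    show "norm r' < r" using r by simp
    show "summable (\<lambda>n. c n * x ^ n)" if "norm x < r" for x
    proof (rule summable_norm_cancel)
      show "summable (\<lambda>n. norm (c n * x ^ n))"
        using c[of "\<bar>x\<bar>"] that nn by (simp add: abs_mult power_abs)
    qed
  qed
  then show ?thesis by (simp add: diffs_def)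
qed

lemma expands_has_vector_derivative:
  fixes F :: "'a::real_normed_vector \<Rightarrow> 'b::banach"
  assumes E: "expands A c r y0 F" and w: "norm w < r"
  shows "summable (\<lambda>j. insertions A e (replicate j w))"
    and "((\<lambda>t. F (y0 + w + t *\<^sub>R e)) has_vector_derivative (\<Sum>j. insertions A e (replicate j w))) (at 0)"
proof -
  have ml: "multilinear A" and nn: "\<And>j. 0 \<le> c j"
    and c: "\<And>r'. 0 \<le> r' \<Longrightarrow> r' < r \<Longrightarrow> summable (\<lambda>j. c j * r' ^ j)"
    and bd: "\<And>hs. norm (A hs) \<le> c (length hs) * prod_list (map norm hs)"
    and F: "\<And>w. norm w < r \<Longrightarrow> (\<lambda>j. A (replicate j w)) sums F (y0 + w)"
    using E by (auto simp: expands_def)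
  \<comment> \<open>Halfway between \<open>norm w\<close> and \<open>r\<close>: there is room to
    move along \<open>e\<close> while \<open>c\<close> is still summable with weight
    \<open>r'\<close>.\<close>
  define r' where "r' = (norm w + r) / 2"
  have r': "norm w < r'" "r' < r" "0 \<le> r'"
    using w norm_ge_zero[of w] by (auto simp: r'_def field_simps simp del: norm_ge_zero)
  \<comment> \<open>For \<open>\<bar>t\<bar> < d\<close> the point \<open>w + t e\<close> stays
    within \<open>r'\<close>; adding 1 covers \<open>e = 0\<close>.\<close>
  define d where "d = (r' - norm w) / (norm e + 1)"
  have ne: "0 < norm e + 1" by (simp add: add_nonneg_pos)
  have d: "0 < d" using r' ne by (simp add: d_def)
  have small: "norm (w + t *\<^sub>R e) \<le> r'" if "t \<in> ball 0 d" for t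
  proof -
    have "norm (t *\<^sub>R e) \<le> d * (norm e + 1)"
      using that by (auto intro!: mult_mono)
    also have "\<dots> = r' - norm w" using ne by (simp add: d_def)
    finally show ?thesis using norm_triangle_ineq[of w "t *\<^sub>R e"] by linarith
  qed
  define B where "B j = real j * c j * norm e * r' ^ (j - 1)" for j
  have bound: "norm (insertions A e (replicate j v)) \<le> B (Suc j)" if "norm v \<le> r'" for v j
  proof -
    have "norm (insertions A e (replicate j v)) \<le> real (Suc j) * c (Suc j) * norm e * norm v ^ j"
      using insertions_bound[OF bd, of e "replicate j v"] by (simp add: prod_list_replicate)
    also have "\<dots> \<le> real (Suc j) * c (Suc j) * norm e * r' ^ j"
      using that nn by (intro mult_left_mono power_mono) auto
    finally show ?thesis by (simp add: B_def)
  qed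
  have sB': "summable (\<lambda>j. B (Suc j))"
    using summable_mult[OF summable_diffs_below[OF c nn r'(3,2)], of "norm e"]
    by (simp add: B_def algebra_simps)
  then have sB: "summable B" by (rule summable_Suc_iff[THEN iffD1])
  show sm: "summable (\<lambda>j. insertions A e (replicate j w))"
    by (rule summable_comparison_test'[OF sB']) (use bound[of w] r' in auto)
  define f' where "f' j t = (\<Sum>k<j. A ([] @ replicate k (w + t *\<^sub>R e) @ e # replicate (j - Suc k) (w + t *\<^sub>R e)))"
    for j t
  have f'Suc: "f' (Suc j) t = insertions A e (replicate j (w + t *\<^sub>R e))" for j t
    by (simp add: f'_def insertions_replicate)
  have "((\<lambda>t. F (y0 + (w + t *\<^sub>R e))) has_vector_derivative (\<Sum>j. f' j 0)) (at 0)"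
  proof (rule has_vector_derivative_series'[where S = "ball 0 d" and B = B and f = "\<lambda>j t. A ([] @ replicate j (w + t *\<^sub>R e))"])
    show "norm (f' n t) \<le> B n" if "t \<in> ball 0 d" for n t
      using bound[OF small[OF that]] f'Suc by (cases n) (auto simp: f'_def B_def)
    show "(\<lambda>n. A ([] @ replicate n (w + t *\<^sub>R e))) sums F (y0 + (w + t *\<^sub>R e))" if "t \<in> ball 0 d" for t
      using F[of "w + t *\<^sub>R e"] small[OF that] r' by auto
    show "((\<lambda>t. A ([] @ replicate n (w + t *\<^sub>R e))) has_vector_derivative f' n t) (at t)" for n t
      unfolding f'_def by (rule has_vector_derivative_multilinear[OF ml])
  qed (use d sB in auto)
  \<comment> \<open>The term of degree 0 is constant in \<open>t\<close>, so the series of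
    derivatives starts at degree 1, and \<open>insertions\<close> lowers the degree by one.\<close>
  also have "(\<Sum>j. f' j 0) = (\<Sum>j. insertions A e (replicate j w))"
  proof -
    have "summable (\<lambda>j. f' j 0)"
      by (rule summable_Suc_iff[THEN iffD1]) (simp add: f'Suc sm)
    from suminf_split_head[OF this] show ?thesis by (simp add: f'Suc) (simp add: f'_def)
  qed
  finally show "((\<lambda>t. F (y0 + w + t *\<^sub>R e)) has_vector_derivative (\<Sum>j. insertions A e (replicate j w))) (at 0)"
    by (simp add: add.assoc)
qed

lemma expands_pderiv_at:
  fixes F :: "real^'n::finite \<Rightarrow> 'b::banach"
  assumes E: "expands A c r y0 F"
  shows "expands (insertions A (axis i 1)) (\<lambda>j. real (Suc j) * c (Suc j)) r y0 (pderiv_at i F)"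
proof -
  have "(\<lambda>j. insertions A (axis i 1) (replicate j w)) sums pderiv_at i F (y0 + w)" if "norm w < r" for w
    using expands_has_vector_derivative[OF E that, of "axis i 1"]
    by (simp add: pderiv_at_def vector_derivative_at summable_sums)
  moreover have "norm (insertions A (axis i 1) hs) \<le> real (Suc (length hs)) * c (Suc (length hs)) * prod_list (map norm hs)" for hs
    using insertions_bound[of A c "axis i 1" hs] E by (simp add: expands_def)
  moreover have "summable (\<lambda>j. real (Suc j) * c (Suc j) * r' ^ j)" if "0 \<le> r'" "r' < r" for r'
    using E that by (intro summable_diffs_below[of r]) (auto simp: expands_def)
  ultimately show ?thesis
    using E by (auto simp: expands_def multilinear_insertions)
qed

text \<open>The quotient of factorials is the product of the factors \<open>j + 1\<close>, ...,
  \<open>j + N\<close> collected in \<open>N\<close> differentiations, with \<open>N\<close> the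
  length of the list; the radius is unchanged.\<close>

lemma expands_pderivs:
  fixes F :: "real^'n::finite \<Rightarrow> 'b::banach"
  assumes E: "expands A c r y0 F"
  shows "\<exists>A'. expands A' (\<lambda>j. fact (j + length is) / fact j * c (j + length is)) r y0 (pderivs is F)"
proof (induction "is")
  case Nil
  show ?case using E by auto
next
  case (Cons i "is")
  then obtain A' where "expands A' (\<lambda>j. fact (j + length is) / fact j * c (j + length is)) r y0 (pderivs is F)"
    by blast
  have eq: "real (Suc j) * (fact (Suc j + length is) / fact (Suc j) * c (Suc j + length is)) =
    fact (j + length (i # is)) / fact j * c (j + length (i # is))" for j
    unfolding fact_Suc[of j] by (simp del: fact_Suc of_nat_Suc)
  from expands_pderiv_at[OF \<open>expands A' _ _ _ _\<close>, of i]
  have "expands (insertions A' (axis i 1)) (\<lambda>j. fact (j + length (i # is)) / fact j * c (j + length (i # is))) r y0 (pderivs (i # is) F)"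
    unfolding eq by simp
  then show ?case by blast
qed

text \<open>All forms of positive degree vanish at 0, so the value at \<open>y0\<close> is the
  constant term; the rest of the series contains a factor \<open>norm w\<close>, times a sum that
  stays bounded on half the radius.\<close>

lemma expands_isCont:
  fixes F :: "'a::real_normed_vector \<Rightarrow> 'b::banach"
  assumes E: "expands A c r y0 F"
  shows "isCont F y0"
proof -
  have r: "0 < r" and nn: "\<And>j. 0 \<le> c j"
    and c: "\<And>r'. 0 \<le> r' \<Longrightarrow> r' < r \<Longrightarrow> summable (\<lambda>j. c j * r' ^ j)"
    and bd: "\<And>hs. norm (A hs) \<le> c (length hs) * prod_list (map norm hs)"
    and F: "\<And>w. norm w < r \<Longrightarrow> (\<lambda>j. A (replicate j w)) sums F (y0 + w)"
    using E by (auto simp: expands_def)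
  have ml: "multilinear A" using E by (auto simp: expands_def)
  have zero: "A (replicate (Suc j) 0) = 0" for j
    using multilinear_scaleR[OF ml, of "[]" 0 0 "replicate j 0"] by simp
  have F0: "F y0 = A []"
  proof -
    have "A (replicate j 0) = 0" if "j \<notin> {0}" for j
      using zero[of "j - 1"] that by (cases j) auto
    then have "(\<lambda>j. A (replicate j 0)) sums (\<Sum>j\<in>{0}. A (replicate j 0))"
      by (intro sums_finite) auto
    with F[of 0] r show ?thesis by (simp add: sums_unique2)
  qed
  define S where "S = (\<Sum>j. c (Suc j) * (r/2) ^ j)"
  have "summable (\<lambda>j. c (Suc j) * (r/2) ^ Suc j * (2/r))"
    using c[of "r/2"] r by (intro summable_mult2) (subst summable_Suc_iff, auto)
  then have sS: "summable (\<lambda>j. c (Suc j) * (r/2) ^ j)" using r by (simp add: field_simps)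
  have bound: "norm (F (y0 + w) - F y0) \<le> norm w * S" if "norm w < r/2" for w
  proof -
    have "(\<lambda>j. A (replicate (Suc j) w)) sums (F (y0 + w) - A (replicate 0 w))"
      using F[of w] that r by (subst sums_Suc_iff) auto
    then have s: "(\<lambda>j. A (replicate (Suc j) w)) sums (F (y0 + w) - F y0)" by (simp add: F0)
    have "norm (A (replicate (Suc j) w)) \<le> norm w * (c (Suc j) * (r/2) ^ j)" for j
    proof -
      have "norm (A (replicate (Suc j) w)) \<le> norm w * (c (Suc j) * norm w ^ j)"
        using bd[of "replicate (Suc j) w"] by (simp add: prod_list_replicate mult_ac)
      also have "\<dots> \<le> norm w * (c (Suc j) * (r/2) ^ j)"
        using that nn by (intro mult_left_mono power_mono) auto
      finally show ?thesis .
    qed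
    then have "norm (\<Sum>j. A (replicate (Suc j) w)) \<le> (\<Sum>j. norm w * (c (Suc j) * (r/2) ^ j))"
      by (rule norm_suminf_le) (rule summable_mult[OF sS])
    then show ?thesis
      unfolding S_def using sums_unique[OF s] suminf_mult[OF sS] by simp
  qed
  have "(\<lambda>w. F (y0 + w) - F y0) \<midarrow>0\<rightarrow> 0"
  proof (rule Lim_null_comparison)
    show "\<forall>\<^sub>F w in at 0. norm (F (y0 + w) - F y0) \<le> norm w * S"
      unfolding eventually_at using bound r by (intro exI[of _ "r/2"]) auto
    show "(\<lambda>w. norm w * S) \<midarrow>(0::'a)\<rightarrow> 0"
      by (rule tendsto_eq_intros refl | simp)+
  qed
  then have "(\<lambda>w. F (y0 + w)) \<midarrow>0\<rightarrow> F y0"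
    by (rule LIM_zero_cancel)
  then show ?thesis by (simp add: isCont_iff)
qed

section \<open>Functions with an expansion at each point, and Cauchy estimates\<close>

definition expandable_on :: "(real^'n::finite) set \<Rightarrow> (real^'n \<Rightarrow> 'b::banach) \<Rightarrow> bool" where
  "expandable_on S F \<longleftrightarrow> (\<forall>y0\<in>S. \<exists>A c r. expands A c r y0 F)"

lemma expandable_onI:
  assumes "real_analytic_map nspace_UNIV nspace_UNIV S F"
  shows "expandable_on S F"
  unfolding expandable_on_def
proof
  fix y0 assume "y0 \<in> S"
  then obtain A c r where r: "0 < r" and A: "multilinear_family nspace_UNIV nspace_UNIV A"
    and c: "\<And>j. 0 \<le> c j" "summable (\<lambda>j. c j * r ^ j)"
    and bd: "\<And>hs. norm (A hs) \<le> c (length hs) * prod_list (map norm hs)"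
    and F: "\<And>x. norm (x - y0) < r \<Longrightarrow> (\<lambda>N. norm (F x - (\<Sum>j<N. A (replicate j (x - y0))))) \<longlonglongrightarrow> 0"
    using assms unfolding real_analytic_map_def by (simp add: nspace_UNIV_def) blast
  have "expands A c r y0 F"
    unfolding expands_def
  proof (intro conjI allI impI)
    fix r' assume r': "0 \<le> r'" "r' < r"
    show "summable (\<lambda>j. c j * r' ^ j)"
      by (rule summable_comparison_test'[OF c(2)]) (use r' c in \<open>auto intro!: mult_left_mono power_mono\<close>)
  next
    fix w :: "real^'a" assume w: "norm w < r"
    have "(\<lambda>N. F (y0 + w) - (\<Sum>j<N. A (replicate j w))) \<longlonglongrightarrow> 0"
      using F[of "y0 + w"] w by (simp add: tendsto_norm_zero_iff)
    from tendsto_diff[OF tendsto_const[of "F (y0 + w)"] this]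
    show "(\<lambda>j. A (replicate j w)) sums F (y0 + w)"
      by (simp add: sums_def)
  qed (use r A c bd in auto)
  then show "\<exists>A c r. expands A c r y0 F" by blast
qed

lemma expandable_on_pderivs: "expandable_on S F \<Longrightarrow> expandable_on S (pderivs is F)"
  unfolding expandable_on_def using expands_pderivs by blast

lemma expandable_on_isCont: "expandable_on S F \<Longrightarrow> y \<in> S \<Longrightarrow> isCont F y"
  unfolding expandable_on_def using expands_isCont by blast

lemma expandable_on_continuous_on: "expandable_on S F \<Longrightarrow> continuous_on S F"
  by (simp add: continuous_at_imp_continuous_on expandable_on_isCont)

text \<open>The expansion at the point \<open>y + t e\<close> itself gives the derivative in the
  direction \<open>e\<close> as well as all partial derivatives; linearity of
  \<open>insertions\<close> in the direction makes the former a combination of the latter. The shift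
  at the end moves the derivative from parameter 0 to \<open>t\<close>.\<close>

lemma expandable_on_has_vector_derivative:
  fixes F :: "real^'n::finite \<Rightarrow> 'b::banach"
  assumes "expandable_on S F" "y + t *\<^sub>R e \<in> S"
  shows "((\<lambda>t. F (y + t *\<^sub>R e)) has_vector_derivative (\<Sum>i\<in>UNIV. (e $ i) *\<^sub>R pderiv_at i F (y + t *\<^sub>R e))) (at t)"
proof -
  define y0 where "y0 = y + t *\<^sub>R e"
  obtain A c r where E: "expands A c r y0 F"
    using assms by (auto simp: expandable_on_def y0_def)
  then have r: "0 < r" and ml: "multilinear A" by (auto simp: expands_def)
  note D = expands_has_vector_derivative[OF E, of 0, simplified, OF r]
  have p: "pderiv_at i F y0 = (\<Sum>j. insertions A (axis i 1) (replicate j 0))" for i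
    unfolding pderiv_at_def by (rule vector_derivative_at) (rule D(2))
  have e: "e = (\<Sum>i\<in>UNIV. (e $ i) *\<^sub>R axis i 1)"
    using basis_expansion[of e] by (simp add: scalar_mult_eq_scaleR)
  have "(\<Sum>j. insertions A e (replicate j 0)) =
    (\<Sum>j. \<Sum>i\<in>UNIV. (e $ i) *\<^sub>R insertions A (axis i 1) (replicate j 0))"
    by (subst (1) e, subst insertions_sum_direction[OF ml]) auto
  also have "\<dots> = (\<Sum>i\<in>UNIV. (e $ i) *\<^sub>R pderiv_at i F y0)"
    unfolding p using D(1) by (subst suminf_sum) (auto intro!: sum.cong suminf_scaleR_right[symmetric] summable_scaleR_right)
  finally have "((\<lambda>u. F (y0 + u *\<^sub>R e)) has_vector_derivative (\<Sum>i\<in>UNIV. (e $ i) *\<^sub>R pderiv_at i F y0)) (at (t - t))"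
    using D(2)[of e] by simp
  then have "((\<lambda>u. F (y0 + u *\<^sub>R e)) \<circ> (\<lambda>u. u - t) has_vector_derivative 1 *\<^sub>R (\<Sum>i\<in>UNIV. (e $ i) *\<^sub>R pderiv_at i F y0)) (at t)"
    by (intro vector_diff_chain_at) (auto intro!: derivative_eq_intros)
  moreover have "(\<lambda>u. F (y0 + u *\<^sub>R e)) \<circ> (\<lambda>u. u - t) = (\<lambda>u. F (y + u *\<^sub>R e))"
    by (auto simp: y0_def algebra_simps)
  ultimately show ?thesis by (simp add: y0_def)
qed

lemma expandable_on_has_pderiv:
  fixes F :: "real^'n::finite \<Rightarrow> 'b::banach"
  assumes "expandable_on S F" "y + t *\<^sub>R axis i 1 \<in> S"
  shows "((\<lambda>t. F (y + t *\<^sub>R axis i 1)) has_vector_derivative pderiv_at i F (y + t *\<^sub>R axis i 1)) (at t)"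
proof -
  have "(\<Sum>j\<in>UNIV. (axis i 1 $ j) *\<^sub>R pderiv_at j F (y + t *\<^sub>R axis i 1)) = 
    (\<Sum>j\<in>UNIV. if j = i then pderiv_at j F (y + t *\<^sub>R axis i 1) else 0)"
    by (intro sum.cong) (auto simp: axis_def)
  also have "\<dots> = pderiv_at i F (y + t *\<^sub>R axis i 1)" by simp
  finally show ?thesis using expandable_on_has_vector_derivative[OF assms] by simp
qed

lemma binomial_le_pow2_real: "real (n choose k) \<le> 2 ^ n"
  using of_nat_mono[OF binomial_le_pow2[of n k], where 'a = real] by simp

text \<open>A Cauchy estimate with the factorial isolated. The coefficient
  \<open>(j + N)! / j!\<close> is at most \<open>N! 2^(j + N)\<close>; for
  \<open>norm w \<le> r / 4\<close> the factor \<open>2^j\<close> turns \<open>(r/4)^j\<close> into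
  \<open>(r/2)^j\<close>, and \<open>2^N\<close> equals \<open>(r/2)^N (4/r)^N\<close>. What is left
  is a tail of the series at radius \<open>r / 2\<close>.\<close>

lemma expands_pderivs_bound:
  fixes F :: "real^'n::finite \<Rightarrow> 'b::banach"
  assumes E: "expands A c r y0 F" and w: "norm w \<le> r / 4"
  shows "norm (pderivs is F (y0 + w)) \<le> (\<Sum>j. c j * (r/2) ^ j) * (4/r) ^ length is * fact (length is)"
proof -
  define N where "N = length is"
  have r: "0 < r" and nn: "\<And>j. 0 \<le> c j" and c: "summable (\<lambda>j. c j * (r/2) ^ j)"
    using E by (auto simp: expands_def)
  obtain A' where E': "expands A' (\<lambda>j. fact (j + N) / fact j * c (j + N)) r y0 (pderivs is F)"
    using expands_pderivs[OF E, of "is"] by (auto simp: N_def)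
  have s: "(\<lambda>j. A' (replicate j w)) sums pderivs is F (y0 + w)"
    using E' w r by (auto simp: expands_def)
  define d where "d j = (fact N * (4/r) ^ N) * (c (j + N) * (r/2) ^ (j + N))" for j
  have sc: "summable (\<lambda>j. c (j + N) * (r/2) ^ (j + N))"
    using summable_ignore_initial_segment[OF c] .
  have "norm (A' (replicate j w)) \<le> d j" for j
  proof -
    have "norm (A' hs) \<le> fact (length hs + N) / fact (length hs) * c (length hs + N) * prod_list (map norm hs)" for hs
      using E' unfolding expands_def by blast
    from this[of "replicate j w"]
    have "norm (A' (replicate j w)) \<le> fact (j + N) / fact j * c (j + N) * norm w ^ j"
      by (simp add: prod_list_replicate)
    also have "\<dots> \<le> fact (j + N) / fact j * c (j + N) * (r/4) ^ j"
      using w nn by (intro mult_left_mono power_mono) auto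
    also have "fact (j + N) / fact j = fact N * real ((j + N) choose N)"
      using binomial_fact[of N "j + N", where 'a = real] by simp
    also have "fact N * real ((j + N) choose N) * c (j + N) * (r/4) ^ j \<le> fact N * 2 ^ (j + N) * c (j + N) * (r/4) ^ j"
      using nn r by (intro mult_right_mono mult_left_mono binomial_le_pow2_real) auto
    also have "\<dots> = d j"
    proof -
      have 1: "(r/4) ^ j * 2 ^ j = (r/2) ^ j"
        using power_mult_distrib[of "r/4" 2 j] by simp
      have 2: "(r/2) ^ N * (4/r) ^ N = 2 ^ N"
        using power_mult_distrib[of "r/2" "4/r" N] r by simp
      have "fact N * 2 ^ (j + N) * c (j + N) * (r/4) ^ j = fact N * c (j + N) * ((r/4) ^ j * 2 ^ j) * 2 ^ N"
        by (simp only: power_add mult_ac)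
      also have "\<dots> = d j"
        unfolding 1 2[symmetric] d_def by (simp only: power_add mult_ac)
      finally show ?thesis .
    qed
    finally show ?thesis .
  qed
  then have "norm (\<Sum>j. A' (replicate j w)) \<le> (\<Sum>j. d j)"
    unfolding d_def by (rule norm_suminf_le) (rule summable_mult[OF sc])
  also have "(\<Sum>j. d j) = (fact N * (4/r) ^ N) * (\<Sum>j. c (j + N) * (r/2) ^ (j + N))"
    unfolding d_def by (rule suminf_mult[OF sc])
  also have "\<dots> \<le> (fact N * (4/r) ^ N) * (\<Sum>j. c j * (r/2) ^ j)"
    using suminf_split_initial_segment[OF c, of N] nn r
    by (intro mult_left_mono) (auto intro!: sum_nonneg)
  finally show ?thesis using sums_unique[OF s] by (simp add: N_def mult_ac)
qed

text \<open>Every point of \<open>K\<close> has its own constants on a quarter of its radius;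
  finitely many such balls cover \<open>K\<close>, and sums over the centres dominate all of these
  constants at once.\<close>

lemma expandable_on_pderivs_bound:
  fixes F :: "real^'n::finite \<Rightarrow> 'b::banach"
  assumes F: "expandable_on S F" and K: "compact K" "K \<subseteq> S"
  shows "\<exists>C M. 0 \<le> C \<and> 1 \<le> M \<and> (\<forall>is. \<forall>y\<in>K. norm (pderivs is F y) \<le> C * M ^ length is * fact (length is))"
proof -
  have "\<exists>A c r. expands A c r y F" if "y \<in> K" for y
    using F that K by (auto simp: expandable_on_def)
  then obtain A c r where E: "\<And>y. y \<in> K \<Longrightarrow> expands (A y) (c y) (r y) y F" by metis
  then have r: "0 < r y" if "y \<in> K" for y using that by (auto simp: expands_def)
  have "K \<subseteq> (\<Union>y\<in>K. ball y (r y / 4))" "\<And>y. open (ball y (r y / 4))" using r by auto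
  then obtain T where T: "T \<subseteq> K" "finite T" "K \<subseteq> (\<Union>y\<in>T. ball y (r y / 4))"
    using compactE_image[OF K(1), of K "\<lambda>y. ball y (r y / 4)"] by blast
  define C0 where "C0 y = (\<Sum>j. c y j * (r y/2) ^ j)" for y
  have C0: "0 \<le> C0 y" if "y \<in> T" for y
  proof -
    have "expands (A y) (c y) (r y) y F" using that T E by auto
    then show ?thesis unfolding C0_def expands_def by (intro suminf_nonneg) auto
  qed
  define C where "C = (\<Sum>y\<in>T. C0 y)"
  \<comment> \<open>The added 1 gives \<open>1 \<le> M\<close>, so that powers of \<open>M\<close>
    grow with the exponent.\<close>
  define M where "M = 1 + (\<Sum>y\<in>T. 4 / r y)"
  have rT: "0 < r y" if "y \<in> T" for y using r T that by auto
  have "norm (pderivs is F z) \<le> C * M ^ length is * fact (length is)" if z: "z \<in> K" for "is" z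
  proof -
    obtain y where y: "y \<in> T" "z \<in> ball y (r y / 4)" using z T(3) by blast
    have "norm (pderivs is F (y + (z - y))) \<le> C0 y * (4 / r y) ^ length is * fact (length is)"
      unfolding C0_def
      by (rule expands_pderivs_bound[OF E]) (use y T in \<open>auto simp: dist_norm norm_minus_commute\<close>)
    also have "\<dots> \<le> C * M ^ length is * fact (length is)"
    proof (intro mult_right_mono mult_mono power_mono)
      show "C0 y \<le> C" unfolding C_def using y T C0 by (intro member_le_sum) auto
      have "4 / r y \<le> (\<Sum>y\<in>T. 4 / r y)" using y T rT by (intro member_le_sum) (auto simp: less_imp_le)
      then show "4 / r y \<le> M" by (simp add: M_def)
      show "0 \<le> C" unfolding C_def using C0 by (intro sum_nonneg) auto
    qed (use rT y in \<open>auto simp: less_imp_le\<close>)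
    finally show ?thesis by simp
  qed
  moreover have "0 \<le> C" unfolding C_def using C0 by (intro sum_nonneg) auto
  moreover have "1 \<le> M" unfolding M_def using rT by (simp add: sum_nonneg less_imp_le)
  ultimately show ?thesis by blast
qed

text \<open>At most \<open>m\<close> derivatives in front cost only constants:
  \<open>(l + j)!\<close> is at most \<open>l! j! 2^(l + j)\<close>, so what depends on
  \<open>l \<le> m\<close> goes into \<open>C\<close>, and \<open>M\<close> is doubled. This is what
  lets a Taylor series converge together with its derivatives.\<close>

lemma expandable_on_pderivs_append_bound:
  fixes F :: "real^'n::finite \<Rightarrow> 'b::banach"
  assumes F: "expandable_on S F" and K: "compact K" "K \<subseteq> S"
  shows "\<exists>C M. 0 \<le> C \<and> 1 \<le> M \<and> (\<forall>js is. length js \<le> m \<longrightarrow>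
    (\<forall>y\<in>K. norm (pderivs (js @ is) F y) \<le> C * M ^ length is * fact (length is)))"
proof -
  obtain C M where C: "0 \<le> C" and M: "1 \<le> M"
    and bd: "\<And>is y. y \<in> K \<Longrightarrow> norm (pderivs is F y) \<le> C * M ^ length is * fact (length is)"
    using expandable_on_pderivs_bound[OF F K] by blast
  have "norm (pderivs (js @ is) F y) \<le> (C * (2 * M) ^ m * fact m) * (2 * M) ^ length is * fact (length is)"
    if l: "length js \<le> m" and y: "y \<in> K" for js "is" y
  proof -
    define l where "l = length js"
    define j where "j = length is"
    have "fact (l + j) = (fact l * fact j * real ((l + j) choose j))"
      using binomial_fact[of j "l + j", where 'a = real] by simp
    also have "\<dots> \<le> fact l * fact j * 2 ^ (l + j)"
      by (intro mult_left_mono binomial_le_pow2_real) auto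
    finally have f: "fact (l + j) \<le> fact l * fact j * (2::real) ^ (l + j)" .
    have "norm (pderivs (js @ is) F y) \<le> C * M ^ (l + j) * fact (l + j)"
      using bd[OF y, of "js @ is"] by (simp add: l_def j_def)
    also have "\<dots> \<le> C * M ^ (l + j) * (fact l * fact j * 2 ^ (l + j))"
      using f C M by (intro mult_left_mono) auto
    also have "\<dots> = (C * (2 * M) ^ l * fact l) * (2 * M) ^ j * fact j"
      by (simp add: power_add power_mult_distrib)
    also have "\<dots> \<le> (C * (2 * M) ^ m * fact m) * (2 * M) ^ j * fact j"
      using C M l by (intro mult_right_mono mult_mono power_increasing fact_mono) (auto simp: l_def)
    finally show ?thesis by (simp add: j_def)
  qed
  then show ?thesis
    using C M by (intro exI[of _ "C * (2 * M) ^ m * fact m"] exI[of _ "2 * M"]) auto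
qed

text \<open>The \<open>j\<close>-th derivative of \<open>F\<close> at \<open>y\<close> along
  \<open>e\<close>, divided by \<open>j!\<close>. Summing over lists of directions instead of
  multi-indices replaces the multinomial coefficients by repetition.\<close>

definition taylor_term :: "(real^'n::finite \<Rightarrow> 'b::real_normed_vector) \<Rightarrow> nat \<Rightarrow> real^'n \<Rightarrow> real^'n \<Rightarrow> 'b" where
  "taylor_term F j y e =
     (1 / fact j) *\<^sub>R (\<Sum>is\<in>{is. length is = j}. prod_list (map (($) e) is) *\<^sub>R pderivs is F y)"

lemma card_lists_length: "card {is :: 'n::finite list. length is = j} = CARD('n) ^ j"
  using card_lists_length_eq[of "UNIV :: 'n set" j] by simp

lemma sum_lists_Suc:
  fixes g :: "'n::finite list \<Rightarrow> 'b::comm_monoid_add"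
  shows "(\<Sum>is\<in>{is. length is = Suc j}. g is) = (\<Sum>is\<in>{is. length is = j}. \<Sum>i\<in>UNIV. g (i # is))"
proof -
  have "(\<Sum>is\<in>{is. length is = j}. \<Sum>i\<in>UNIV. g (i # is)) = (\<Sum>(is, i)\<in>{is. length is = j} \<times> UNIV. g (i # is))"
    by (simp add: sum.cartesian_product)
  also have "\<dots> = (\<Sum>is\<in>{is. length is = Suc j}. g is)"
    by (rule sum.reindex_bij_witness[where i = "\<lambda>is. (tl is, hd is)" and j = "\<lambda>(is, i). i # is"])
      (auto simp: length_Suc_conv)
  finally show ?thesis by simp
qed

lemma abs_prod_list_le:
  fixes e :: "real^'n::finite"
  assumes "norm e \<le> R"
  shows "\<bar>prod_list (map (($) e) is)\<bar> \<le> R ^ length is"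
proof (induction "is")
  case (Cons i "is")
  have "\<bar>e $ i\<bar> \<le> R" using component_le_norm_cart[of e i] assms by simp
  with Cons show ?case by (auto simp: abs_mult intro!: mult_mono)
qed simp

text \<open>There are \<open>n^j\<close> lists of length \<open>j\<close>, hence the factor
  \<open>n R\<close> in the ratio of the Taylor series.\<close>

lemma norm_sum_lists_le:
  fixes e :: "real^'n::finite"
  assumes "norm e \<le> R" "0 \<le> R"
    and bd: "\<And>is. length is = j \<Longrightarrow> norm (g is) \<le> B"
  shows "norm (\<Sum>is\<in>{is. length is = j}. prod_list (map (($) e) is) *\<^sub>R g is) \<le> (real CARD('n) * R) ^ j * B"
proof -
  have "norm (\<Sum>is\<in>{is. length is = j}. prod_list (map (($) e) is) *\<^sub>R g is)
    \<le> (\<Sum>is\<in>{is :: 'n list. length is = j}. R ^ j * B)"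
    using abs_prod_list_le[OF assms(1)] bd assms(2)
    by (intro sum_norm_le) (auto intro!: mult_mono)
  also have "\<dots> = (real CARD('n) * R) ^ j * B"
    by (simp add: card_lists_length power_mult_distrib)
  finally show ?thesis .
qed

text \<open>\<open>f i\<close> is the \<open>i\<close>-th derivative of \<open>f 0\<close>. The
  remainder of order \<open>N\<close> is at most \<open>C (N + 1) x^(N + 1)\<close> with
  \<open>x = \<bar>h\<bar> Q < 1\<close>: the factor \<open>N + 1\<close> comes from dividing by
  \<open>N!\<close> a bound that contains \<open>(N + 1)!\<close>, and geometric decay absorbs
  it.\<close>

lemma real_taylor_sums:
  fixes f :: "nat \<Rightarrow> real \<Rightarrow> real"
  assumes d: "\<And>i t. \<bar>t\<bar> \<le> \<delta> \<Longrightarrow> (f i has_real_derivative f (Suc i) t) (at t)"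
    and bd: "\<And>i t. \<bar>t\<bar> \<le> \<delta> \<Longrightarrow> \<bar>f i t\<bar> \<le> C * Q ^ i * fact i"
    and h: "\<bar>h\<bar> \<le> \<delta>" "\<bar>h\<bar> * Q < 1" and Q: "0 \<le> Q"
  shows "(\<lambda>i. f i 0 * h ^ i / fact i) sums f 0 h"
proof -
  define x where "x = \<bar>h\<bar> * Q"
  have x: "0 \<le> x" "x < 1" using h Q by (auto simp: x_def)
  have T: "norm (f 0 h - (\<Sum>i\<le>N. f i 0 * (h - 0) ^ i / fact i)) \<le>
    (C * Q ^ Suc N * fact (Suc N)) * norm (h - 0) ^ Suc N / fact N" for N
  proof (rule field_Taylor[where S = "{-\<delta>..\<delta>}" and f = f and n = N and w = 0 and z = h])
    show "(f i has_real_derivative f (Suc i) t) (at t within {-\<delta>..\<delta>})" if "t \<in> {-\<delta>..\<delta>}" for i t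
      by (rule has_field_derivative_at_within, rule d) (use that in auto)
    show "norm (f (Suc N) t) \<le> C * Q ^ Suc N * fact (Suc N)" if "t \<in> {-\<delta>..\<delta>}" for t
      using bd[of t "Suc N"] that by (simp del: power_Suc fact_Suc add: abs_le_iff)
  qed (use h in auto)
  have le: "norm ((\<Sum>i\<le>N. f i 0 * h ^ i / fact i) - f 0 h) \<le> C * (real (Suc N) * x ^ Suc N)" for N
  proof -
    have "(C * Q ^ Suc N * fact (Suc N)) * norm (h - 0) ^ Suc N / fact N = C * (real (Suc N) * x ^ Suc N)"
      by (simp add: x_def power_mult_distrib del: power_Suc of_nat_Suc)
    with T[of N] show ?thesis by (simp only: norm_minus_commute diff_zero)
  qed
  have "(\<lambda>N. real N * x ^ N) \<longlonglongrightarrow> 0"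
    using powser_times_n_limit_0[of x] x by simp
  then have "(\<lambda>N. C * (real (Suc N) * x ^ Suc N)) \<longlonglongrightarrow> C * 0"
    by (intro tendsto_mult_left) (rule LIMSEQ_Suc)
  then have "(\<lambda>N. C * (real (Suc N) * x ^ Suc N)) \<longlonglongrightarrow> 0" by (simp only: mult_zero_right)
  with le have "(\<lambda>N. (\<Sum>i\<le>N. f i 0 * h ^ i / fact i) - f 0 h) \<longlonglongrightarrow> 0"
    by (rule Lim_null_comparison[OF always_eventually, OF allI])
  then show ?thesis unfolding sums_def_le by (rule LIM_zero_cancel)
qed

text \<open>Restriction to the line through \<open>y\<close> reduces this to one variable:
  \<open>\<phi> j\<close> below is the \<open>j\<close>-th derivative of the restriction, and the
  bounds on \<open>K\<close> give the ratio \<open>n R M\<close>. Real and imaginary parts are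
  expanded separately, each as a real function of a real variable.\<close>

lemma taylor_sums:
  fixes F :: "real^'n::finite \<Rightarrow> complex"
  assumes F: "expandable_on S F"
    and line: "\<And>t. \<bar>t\<bar> \<le> \<delta> \<Longrightarrow> y + t *\<^sub>R e \<in> K" and KS: "K \<subseteq> S"
    and bd: "\<And>is z. z \<in> K \<Longrightarrow> norm (pderivs is F z) \<le> C * M ^ length is * fact (length is)"
    and e: "norm e \<le> R" "0 \<le> R" "0 \<le> M"
    and h: "\<bar>h\<bar> \<le> \<delta>" "\<bar>h\<bar> * (real CARD('n) * R * M) < 1"
  shows "(\<lambda>j. h ^ j *\<^sub>R taylor_term F j y e) sums F (y + h *\<^sub>R e)"
proof -
  define \<phi> where "\<phi> j t = (\<Sum>is\<in>{is. length is = j}. prod_list (map (($) e) is) *\<^sub>R pderivs is F (y + t *\<^sub>R e))"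
    for j t
  have d: "(\<phi> j has_vector_derivative \<phi> (Suc j) t) (at t)" if t: "\<bar>t\<bar> \<le> \<delta>" for j t
  proof -
    have yt: "y + t *\<^sub>R e \<in> S" using line[OF t] KS by auto
    have "(\<phi> j has_vector_derivative (\<Sum>is\<in>{is. length is = j}. prod_list (map (($) e) is) *\<^sub>R
       (\<Sum>i\<in>UNIV. (e $ i) *\<^sub>R pderiv_at i (pderivs is F) (y + t *\<^sub>R e)))) (at t)"
      unfolding \<phi>_def
      by (intro has_vector_derivative_sum bounded_linear.has_vector_derivative[OF bounded_linear_scaleR_right]
          expandable_on_has_vector_derivative[OF expandable_on_pderivs[OF F] yt])
    moreover have "(\<Sum>is\<in>{is. length is = j}. prod_list (map (($) e) is) *\<^sub>R
       (\<Sum>i\<in>UNIV. (e $ i) *\<^sub>R pderiv_at i (pderivs is F) (y + t *\<^sub>R e))) = \<phi> (Suc j) t"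
      unfolding \<phi>_def sum_lists_Suc by (simp add: scaleR_sum_right mult.commute)
    ultimately show ?thesis by simp
  qed
  have b: "norm (\<phi> j t) \<le> C * (real CARD('n) * R * M) ^ j * fact j" if "\<bar>t\<bar> \<le> \<delta>" for j t
  proof -
    have "norm (\<phi> j t) \<le> (real CARD('n) * R) ^ j * (C * M ^ j * fact j)"
      unfolding \<phi>_def by (rule norm_sum_lists_le[OF e(1,2)]) (use bd[OF line[OF that]] in auto)
    then show ?thesis by (simp add: power_mult_distrib mult_ac)
  qed
  have Q: "0 \<le> real CARD('n) * R * M" using e by simp
  have "(\<lambda>j. Re (\<phi> j 0) * h ^ j / fact j) sums Re (\<phi> 0 h)"
  proof (rule real_taylor_sums[where f = "\<lambda>j t. Re (\<phi> j t)" and \<delta> = \<delta>, OF _ _ h Q])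
    show "((\<lambda>t. Re (\<phi> i t)) has_real_derivative Re (\<phi> (Suc i) t)) (at t)" if "\<bar>t\<bar> \<le> \<delta>" for i t
      using bounded_linear.has_vector_derivative[OF bounded_linear_Re d[OF that]]
      by (simp add: has_real_derivative_iff_has_vector_derivative)
    show "\<bar>Re (\<phi> i t)\<bar> \<le> C * (real CARD('n) * R * M) ^ i * fact i" if "\<bar>t\<bar> \<le> \<delta>" for i t
      using b[OF that, of i] abs_Re_le_cmod order_trans by blast
  qed
  moreover have "(\<lambda>j. Im (\<phi> j 0) * h ^ j / fact j) sums Im (\<phi> 0 h)"
  proof (rule real_taylor_sums[where f = "\<lambda>j t. Im (\<phi> j t)" and \<delta> = \<delta>, OF _ _ h Q])
    show "((\<lambda>t. Im (\<phi> i t)) has_real_derivative Im (\<phi> (Suc i) t)) (at t)" if "\<bar>t\<bar> \<le> \<delta>" for i t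
      using bounded_linear.has_vector_derivative[OF bounded_linear_Im d[OF that]]
      by (simp add: has_real_derivative_iff_has_vector_derivative)
    show "\<bar>Im (\<phi> i t)\<bar> \<le> C * (real CARD('n) * R * M) ^ i * fact i" if "\<bar>t\<bar> \<le> \<delta>" for i t
      using b[OF that, of i] abs_Im_le_cmod order_trans by blast
  qed
  moreover have "\<phi> 0 h = F (y + h *\<^sub>R e)"
    by (simp add: \<phi>_def)
  moreover have "h ^ j *\<^sub>R taylor_term F j y e = (h ^ j / fact j) *\<^sub>R \<phi> j 0" for j
    by (simp add: \<phi>_def taylor_term_def)
  ultimately show ?thesis
    by (simp add: sums_complex_iff mult_ac)
qed

section \<open>Functions of class \<open>C\<^sup>m\<close> up to the boundary and parametric integrals\<close>

lemma has_vector_derivative_shift: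
  fixes y e :: "'a::real_vector"
  assumes "((\<lambda>u. f (y + t *\<^sub>R e + u *\<^sub>R e)) has_vector_derivative D) (at 0)"
  shows "((\<lambda>u. f (y + u *\<^sub>R e)) has_vector_derivative D) (at t)"
proof -
  have "((\<lambda>u. f (y + t *\<^sub>R e + u *\<^sub>R e)) has_vector_derivative D) (at (t - t))"
    using assms by simp
  then have "((\<lambda>u. f (y + t *\<^sub>R e + u *\<^sub>R e)) \<circ> (\<lambda>u. u - t) has_vector_derivative 1 *\<^sub>R D) (at t)"
    by (intro vector_diff_chain_at) (auto intro!: derivative_eq_intros)
  then show ?thesis by (simp add: o_def algebra_simps)
qed

lemma Ck_on_has_vector_derivative:
  assumes "Ck_on m W f" "length is < m" "x + t *\<^sub>R axis i 1 \<in> W"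
  shows "((\<lambda>t. pderivs is f (x + t *\<^sub>R axis i 1)) has_vector_derivative
    pderivs (i # is) f (x + t *\<^sub>R axis i 1)) (at t)"
proof (rule has_vector_derivative_shift)
  have "(\<lambda>u. pderivs is f (x + t *\<^sub>R axis i 1 + u *\<^sub>R axis i 1)) differentiable (at 0)"
    using assms by (auto simp: Ck_on_def)
  then show "((\<lambda>u. pderivs is f (x + t *\<^sub>R axis i 1 + u *\<^sub>R axis i 1)) has_vector_derivative
    pderivs (i # is) f (x + t *\<^sub>R axis i 1)) (at 0)"
    by (simp add: vector_derivative_works pderiv_at_def)
qed

lemma open_line_ball:
  fixes x e :: "'a::real_normed_vector"
  assumes "open W" "x \<in> W"
  obtains d where "0 < d" "\<And>t. t \<in> ball 0 d \<Longrightarrow> x + t *\<^sub>R e \<in> W"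
proof -
  have "open ((\<lambda>t. x + t *\<^sub>R e) -` W)"
    by (intro open_vimage assms continuous_intros)
  moreover have "0 \<in> (\<lambda>t. x + t *\<^sub>R e) -` W" using assms by simp
  ultimately obtain d where "0 < d" "ball 0 d \<subseteq> (\<lambda>t. x + t *\<^sub>R e) -` W"
    by (rule openE)
  then show ?thesis using that by blast
qed

text \<open>Induction on the list of directions: on a short segment in \<open>W\<close> the series
  obtained so far is differentiated term by term, with the same majorant \<open>b\<close> at every
  order. \<open>F\<close> is only given as a pointwise sum; that its derivatives exist comes out of
  each step.\<close>

lemma Ck_closure_series_pderivs:
  fixes f :: "nat \<Rightarrow> real^'n::finite \<Rightarrow> 'b::banach"
  assumes W: "open W"
    and mem: "\<And>j. f j \<in> Ck_closure_set m W"
    and bd: "\<And>j is x. length is \<le> m \<Longrightarrow> x \<in> W \<Longrightarrow> norm (pderivs is (f j) x) \<le> b j"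
    and b: "summable b"
    and F: "\<And>x. x \<in> W \<Longrightarrow> (\<lambda>j. f j x) sums F x"
    and l: "length is \<le> m" and x: "x \<in> W"
  shows "(\<lambda>j. pderivs is (f j) x) sums pderivs is F x"
proof -
  have Ck: "Ck_on m W (f j)" for j using mem by (auto simp: Ck_closure_set_def)
  have step: "(\<lambda>j. pderivs (i # is) (f j) x) sums pderivs (i # is) F x"
    if l: "length is < m" and x: "x \<in> W"
      and IH: "\<And>x. x \<in> W \<Longrightarrow> (\<lambda>j. pderivs is (f j) x) sums pderivs is F x"
    for i "is" x
  proof -
    obtain d where d: "0 < d" "\<And>t. t \<in> ball 0 d \<Longrightarrow> x + t *\<^sub>R axis i 1 \<in> W"
      using open_line_ball[OF W x] by blast
    have "((\<lambda>t. pderivs is F (x + t *\<^sub>R axis i 1)) has_vector_derivative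
      (\<Sum>j. pderivs (i # is) (f j) (x + 0 *\<^sub>R axis i 1))) (at 0)"
    proof (rule has_vector_derivative_series'[where S = "ball 0 d" and B = b
          and f = "\<lambda>j t. pderivs is (f j) (x + t *\<^sub>R axis i 1)"
          and f' = "\<lambda>j t. pderivs (i # is) (f j) (x + t *\<^sub>R axis i 1)"])
      show "((\<lambda>t. pderivs is (f j) (x + t *\<^sub>R axis i 1)) has_vector_derivative
        pderivs (i # is) (f j) (x + t *\<^sub>R axis i 1)) (at t)" if "t \<in> ball 0 d" for j t
        by (rule Ck_on_has_vector_derivative[OF Ck l d(2)[OF that]])
      show "norm (pderivs (i # is) (f j) (x + t *\<^sub>R axis i 1)) \<le> b j" if "t \<in> ball 0 d" for j t
        by (rule bd[OF _ d(2)[OF that]]) (use l in simp)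
      show "(\<lambda>j. pderivs is (f j) (x + t *\<^sub>R axis i 1)) sums pderivs is F (x + t *\<^sub>R axis i 1)"
        if "t \<in> ball 0 d" for t
        by (rule IH[OF d(2)[OF that]])
    qed (use d b in auto)
    then have D: "((\<lambda>t. pderivs is F (x + t *\<^sub>R axis i 1)) has_vector_derivative
      (\<Sum>j. pderivs (i # is) (f j) x)) (at 0)" by simp
    then have E: "pderivs (i # is) F x = (\<Sum>j. pderivs (i # is) (f j) x)"
      by (simp add: pderiv_at_def vector_derivative_at)
    have "summable (\<lambda>j. pderivs (i # is) (f j) x)"
      by (rule summable_comparison_test'[OF b]) (rule bd, use l x in auto)
    then show ?thesis unfolding E by (rule summable_sums)
  qed
  have main: "\<forall>x\<in>W. (\<lambda>j. pderivs is (f j) x) sums pderivs is F x" if "length is \<le> m" for "is"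
    using that
  proof (induction "is")
    case (Cons i "is")
    then have "length is < m" "\<And>x. x \<in> W \<Longrightarrow> (\<lambda>j. pderivs is (f j) x) sums pderivs is F x" by auto
    then show ?case using step by blast
  qed (use F in auto)
  with l x show ?thesis by blast
qed

lemma sup_norm_le:
  assumes "\<And>x. x \<in> S \<Longrightarrow> norm (g x) \<le> B" "0 \<le> B"
  shows "sup_norm S g \<le> B" "0 \<le> sup_norm S g"
proof -
  show "sup_norm S g \<le> B" unfolding sup_norm_def using assms by (intro cSup_least) auto
  show "0 \<le> sup_norm S g" unfolding sup_norm_def using assms by (intro cSup_upper bdd_aboveI[of _ B]) auto
qed

lemma nnorm_Ck_closure_le:
  fixes f :: "real^'n::finite \<Rightarrow> complex"
  assumes "\<And>is x. length is \<le> m \<Longrightarrow> x \<in> W \<Longrightarrow> norm (pderivs is f x) \<le> B" "0 \<le> B"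
  shows "nnorm (Ck_closure m W) f \<le> real (card {is :: 'n list. length is \<le> m}) * B"
    and "0 \<le> nnorm (Ck_closure m W) f"
proof -
  have "(\<Sum>is\<in>{is :: 'n list. length is \<le> m}. sup_norm W (pderivs is f)) \<le> of_nat (card {is :: 'n list. length is \<le> m}) * B"
    by (rule sum_bounded_above) (use assms in \<open>auto intro: sup_norm_le\<close>)
  then show "nnorm (Ck_closure m W) f \<le> real (card {is :: 'n list. length is \<le> m}) * B"
    by (simp add: Ck_closure_def)
  show "0 \<le> nnorm (Ck_closure m W) f"
    unfolding Ck_closure_def using assms by (auto intro!: sum_nonneg sup_norm_le(2)[where B = B])
qed

lemma sum_fun_apply: "(\<Sum>j\<in>A. f j) x = (\<Sum>j\<in>A. f j x)"
  by (induction A rule: infinite_finite_induct) auto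

text \<open>The remainder after \<open>N\<close> terms is the pointwise sum of the shifted series,
  so its derivatives up to order \<open>m\<close> are bounded by the tail \<open>B N\<close> of
  \<open>b\<close>; the norm adds up finitely many suprema of them.\<close>

lemma Ck_closure_series_tendsto:
  fixes f :: "nat \<Rightarrow> real^'n::finite \<Rightarrow> complex"
  assumes W: "open W"
    and mem: "\<And>j. f j \<in> Ck_closure_set m W"
    and bd: "\<And>j is x. length is \<le> m \<Longrightarrow> x \<in> W \<Longrightarrow> norm (pderivs is (f j) x) \<le> b j"
    and b: "summable b" "\<And>j. 0 \<le> b j"
    and F: "\<And>x. x \<in> W \<Longrightarrow> (\<lambda>j. f j x) sums F x"
  shows "(\<lambda>N. nnorm (Ck_closure m W) (F - (\<Sum>j<N. f j))) \<longlonglongrightarrow> 0"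
proof -
  define c where "c = real (card {is :: 'n list. length is \<le> m})"
  define B where "B N = (\<Sum>j. b (j + N))" for N
  have sb: "summable (\<lambda>j. b (j + N))" for N by (rule summable_ignore_initial_segment[OF b(1)])
  have B0: "0 \<le> B N" for N unfolding B_def by (rule suminf_nonneg[OF sb]) (rule b(2))
  have le: "norm (pderivs is (F - (\<Sum>j<N. f j)) x) \<le> B N" if "length is \<le> m" "x \<in> W" for "is" x N
  proof -
    have s: "(\<lambda>j. f (j + N) x) sums (F - (\<Sum>j<N. f j)) x" if "x \<in> W" for x
      using sums_split_initial_segment[OF F[OF that], of N] by (simp add: sum_fun_apply)
    have "(\<lambda>j. pderivs is (f (j + N)) x) sums pderivs is (F - (\<Sum>j<N. f j)) x"
      by (rule Ck_closure_series_pderivs[OF W mem bd sb s that])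
    then have "pderivs is (F - (\<Sum>j<N. f j)) x = (\<Sum>j. pderivs is (f (j + N)) x)" by (simp only: sums_iff)
    moreover have "norm (\<Sum>j. pderivs is (f (j + N)) x) \<le> B N"
      unfolding B_def by (rule norm_suminf_le[OF bd[OF that] sb])
    ultimately show ?thesis by simp
  qed
  have "(\<lambda>N. c * B N) \<longlonglongrightarrow> c * 0"
    unfolding B_def by (intro tendsto_mult_left suminf_exist_split2 b)
  then have lim: "(\<lambda>N. c * B N) \<longlonglongrightarrow> 0" by simp
  show ?thesis
  proof (rule tendsto_sandwich[OF _ _ tendsto_const lim])
    show "\<forall>\<^sub>F N in sequentially. 0 \<le> nnorm (Ck_closure m W) (F - (\<Sum>j<N. f j))"
      using nnorm_Ck_closure_le(2)[OF le B0] by (intro always_eventually allI)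
    show "\<forall>\<^sub>F N in sequentially. nnorm (Ck_closure m W) (F - (\<Sum>j<N. f j)) \<le> c * B N"
      unfolding c_def using nnorm_Ck_closure_le(1)[OF le B0] by (intro always_eventually allI)
  qed
qed


section \<open>Integrals over a compact set that depend on a parameter\<close>

lemma has_vector_derivative_at_0_iff:
  fixes f :: "real \<Rightarrow> 'b::real_normed_vector"
  shows "(f has_vector_derivative D) (at 0) \<longleftrightarrow> ((\<lambda>t. (f t - f 0) /\<^sub>R t) \<longlongrightarrow> D) (at 0)"
proof -
  have eq: "norm ((f t - f 0) - (t - 0) *\<^sub>R D) / norm (t - 0) = norm ((f t - f 0) /\<^sub>R t - D)" if "t \<noteq> 0" for t
  proof -
    have "(f t - f 0) /\<^sub>R t - D = ((f t - f 0) - t *\<^sub>R D) /\<^sub>R t"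
      using that by (simp add: scaleR_diff_right)
    then show ?thesis by (simp add: divide_inverse_commute)
  qed
  have "(f has_vector_derivative D) (at 0) \<longleftrightarrow>
    ((\<lambda>t. norm ((f t - f 0) - (t - 0) *\<^sub>R D) / norm (t - 0)) \<longlongrightarrow> 0) (at 0)"
    unfolding has_vector_derivative_def has_derivative_iff_norm by (simp add: bounded_linear_scaleR_left)
  also have "\<dots> \<longleftrightarrow> ((\<lambda>t. norm ((f t - f 0) /\<^sub>R t - D)) \<longlongrightarrow> 0) (at 0)"
    by (rule filterlim_cong[OF refl refl], unfold eventually_at_filter, intro always_eventually allI impI) (rule eq)
  also have "\<dots> \<longleftrightarrow> ((\<lambda>t. (f t - f 0) /\<^sub>R t) \<longlongrightarrow> D) (at 0)"
    by (simp only: tendsto_norm_zero_iff LIM_zero_iff)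
  finally show ?thesis .
qed

text \<open>Meant for the surface measure and the boundary. Compactness bounds every continuous
  integrand, and finiteness of the measure on \<open>K\<close> makes constants on \<open>K\<close>
  admissible majorants for dominated convergence.\<close>

locale compact_finite_measure =
  fixes M :: "'a::euclidean_space measure" and K :: "'a set"
  assumes sets_M: "sets M = sets borel" and compact_K: "compact K" and finite_K: "emeasure M K < \<infinity>"
begin

lemma K_sets: "K \<in> sets M" "K \<in> sets borel"
  using compact_K by (simp_all add: sets_M compact_imp_closed borel_closed)

lemma measurable_indicator_continuous:
  fixes f :: "'a \<Rightarrow> 'b::{second_countable_topology, banach}"
  assumes "continuous_on K f"
  shows "(\<lambda>s. indicator K s *\<^sub>R f s) \<in> borel_measurable M"
  using borel_measurable_continuous_on_indicator[OF K_sets(2) assms]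
  by (simp add: measurable_cong_sets[OF sets_M refl])

lemma set_integrable_continuous:
  fixes f :: "'a \<Rightarrow> 'b::{second_countable_topology, banach}"
  assumes "continuous_on K f"
  shows "set_integrable M K f"
proof -
  have "bounded (f ` K)"
    by (rule compact_imp_bounded[OF compact_continuous_image[OF assms compact_K]])
  then obtain B where "\<And>s. s \<in> K \<Longrightarrow> norm (f s) \<le> B" by (auto simp: bounded_iff)
  then show ?thesis
    unfolding set_integrable_def
    by (intro integrableI_bounded_set[where A = K and B = B] measurable_indicator_continuous assms K_sets finite_K) auto
qed

lemma norm_set_integral_le:
  fixes f :: "'a \<Rightarrow> 'b::{second_countable_topology, banach}"
  assumes "continuous_on K f" "\<And>s. s \<in> K \<Longrightarrow> norm (f s) \<le> B"
  shows "norm (LINT s:K|M. f s) \<le> measure M K * B"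
proof -
  have i: "integrable M (\<lambda>s. indicator K s *\<^sub>R B)"
    using set_integrable_continuous[OF continuous_on_const, of B] by (simp add: set_integrable_def)
  have "norm (LINT s:K|M. f s) \<le> (LINT s|M. norm (indicator K s *\<^sub>R f s))"
    unfolding set_lebesgue_integral_def by (rule integral_norm_bound)
  also have "\<dots> \<le> (LINT s|M. indicator K s *\<^sub>R B)"
  proof (rule integral_mono)
    show "integrable M (\<lambda>s. norm (indicator K s *\<^sub>R f s))"
      using set_integrable_continuous[OF assms(1)] unfolding set_integrable_def by (rule integrable_norm)
    show "norm (indicator K s *\<^sub>R f s) \<le> indicator K s *\<^sub>R B" for s
      using assms(2) by (auto simp: indicator_def)
  qed (rule i)
  also have "\<dots> = measure M K * B"
    using K_sets sets.Int_space_eq2[OF K_sets(1)] by simp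
  finally show ?thesis .
qed

lemma set_integral_tendsto:
  fixes g :: "nat \<Rightarrow> 'a \<Rightarrow> 'b::{second_countable_topology, banach}"
  assumes "\<And>n. continuous_on K (g n)" "continuous_on K f"
    and "\<And>s. s \<in> K \<Longrightarrow> (\<lambda>n. g n s) \<longlonglongrightarrow> f s"
    and "\<And>n s. s \<in> K \<Longrightarrow> norm (g n s) \<le> B"
  shows "(\<lambda>n. LINT s:K|M. g n s) \<longlonglongrightarrow> (LINT s:K|M. f s)"
  unfolding set_lebesgue_integral_def
proof (rule integral_dominated_convergence)
  show "integrable M (\<lambda>s. indicator K s *\<^sub>R B)"
    using set_integrable_continuous[OF continuous_on_const, of B] by (simp add: set_integrable_def)
  show "AE s in M. (\<lambda>n. indicator K s *\<^sub>R g n s) \<longlonglongrightarrow> indicator K s *\<^sub>R f s"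
    using assms(3) by (intro AE_I2) (auto simp: indicator_def)
  show "AE s in M. norm (indicator K s *\<^sub>R g n s) \<le> indicator K s *\<^sub>R B" for n
    using assms(4) by (intro AE_I2) (auto simp: indicator_def)
qed (use measurable_indicator_continuous assms in auto)

lemma continuous_on_section:
  assumes "continuous_on (D \<times> K) (\<lambda>(x, s). g x s)" "x \<in> D"
  shows "continuous_on K (g x)"
proof -
  have "continuous_on K ((\<lambda>(x, s). g x s) \<circ> Pair x)"
    by (rule continuous_on_compose[OF _ continuous_on_subset[OF assms(1)]])
      (use assms(2) in \<open>auto intro!: continuous_intros\<close>)
  then show ?thesis by (simp add: o_def)
qed

text \<open>Continuity is tested on sequences, to which dominated convergence applies; the majorant
  is a bound of \<open>g\<close> on the compact product.\<close>

lemma continuous_on_parametric_integral: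
  fixes g :: "'p::euclidean_space \<Rightarrow> 'a \<Rightarrow> 'b::{second_countable_topology, banach}"
  assumes D: "compact D" and g: "continuous_on (D \<times> K) (\<lambda>(x, s). g x s)"
  shows "continuous_on D (\<lambda>x. LINT s:K|M. g x s)"
  unfolding continuous_on_sequentially
proof (intro ballI allI impI)
  fix x u assume x: "x \<in> D" and u: "(\<forall>n. u n \<in> D) \<and> u \<longlonglongrightarrow> x"
  have "bounded ((\<lambda>(x, s). g x s) ` (D \<times> K))"
    by (rule compact_imp_bounded[OF compact_continuous_image[OF g compact_Times[OF D compact_K]]])
  then obtain B where B: "\<And>x s. x \<in> D \<Longrightarrow> s \<in> K \<Longrightarrow> norm (g x s) \<le> B"
    by (auto simp: bounded_iff)
  have "(\<lambda>n. LINT s:K|M. g (u n) s) \<longlonglongrightarrow> (LINT s:K|M. g x s)"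
  proof (rule set_integral_tendsto[where B = B])
    fix s assume s: "s \<in> K"
    have "(\<lambda>n. (u n, s)) \<longlonglongrightarrow> (x, s)" using u by (intro tendsto_intros) auto
    then have "((\<lambda>(x, s). g x s) \<circ> (\<lambda>n. (u n, s))) \<longlonglongrightarrow> (\<lambda>(x, s). g x s) (x, s)"
      using g[unfolded continuous_on_sequentially, rule_format, of "(x, s)" "\<lambda>n. (u n, s)"] u x s by auto
    then show "(\<lambda>n. g (u n) s) \<longlonglongrightarrow> g x s" by (simp add: o_def)
  qed (use u x B g continuous_on_section in \<open>auto intro: continuous_on_section\<close>)
  then show "((\<lambda>x. LINT s:K|M. g x s) \<circ> u) \<longlonglongrightarrow> (LINT s:K|M. g x s)" by (simp add: o_def)
qed

text \<open>By the mean value inequality all difference quotients are bounded by \<open>B\<close>,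
  so dominated convergence gives the limit of their integrals.\<close>

lemma has_vector_derivative_integral:
  fixes g :: "real \<Rightarrow> 'a \<Rightarrow> 'b::{second_countable_topology, banach}"
  assumes d: "0 < d"
    and g: "\<And>t. t \<in> ball 0 d \<Longrightarrow> continuous_on K (g t)" and g': "continuous_on K (g' 0)"
    and D: "\<And>t s. t \<in> ball 0 d \<Longrightarrow> s \<in> K \<Longrightarrow> ((\<lambda>t. g t s) has_vector_derivative g' t s) (at t)"
    and B: "\<And>t s. t \<in> ball 0 d \<Longrightarrow> s \<in> K \<Longrightarrow> norm (g' t s) \<le> B"
  shows "((\<lambda>t. LINT s:K|M. g t s) has_vector_derivative (LINT s:K|M. g' 0 s)) (at 0)"
proof -
  have 0: "0 \<in> ball 0 d" using d by simp
  have lip: "norm (g t s - g 0 s) \<le> B * \<bar>t\<bar>" if t: "t \<in> ball 0 d" and s: "s \<in> K" for t s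
  proof -
    have "norm (g t s - g 0 s) \<le> B * norm (t - 0)"
    proof (rule differentiable_bound[where S = "ball 0 d" and f' = "\<lambda>t h. h *\<^sub>R g' t s"])
      show "((\<lambda>t. g t s) has_derivative (\<lambda>h. h *\<^sub>R g' u s)) (at u within ball 0 d)" if "u \<in> ball 0 d" for u
        using D[OF that s] by (simp add: has_vector_derivative_def has_derivative_at_withinI)
      show "onorm (\<lambda>h. h *\<^sub>R g' u s) \<le> B" if "u \<in> ball 0 d" for u
      proof (rule onorm_le)
        show "norm (h *\<^sub>R g' u s) \<le> B * norm h" for h
          using B[OF that s] mult_left_mono[of "norm (g' u s)" B "\<bar>h\<bar>"] by (simp add: mult.commute)
      qed
    qed (use t d in auto)
    then show ?thesis by simp
  qed
  define I where "I t = (LINT s:K|M. g t s)" for t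
  have quot: "((I t - I 0) /\<^sub>R t) = (LINT s:K|M. (g t s - g 0 s) /\<^sub>R t)" if "t \<in> ball 0 d" for t
    unfolding I_def using set_integrable_continuous[OF g[OF that]] set_integrable_continuous[OF g[OF 0]]
    by simp
  have "((\<lambda>t. (I t - I 0) /\<^sub>R t) \<longlongrightarrow> (LINT s:K|M. g' 0 s)) (at 0)"
    unfolding tendsto_at_iff_sequentially
  proof (intro allI impI)
    fix X :: "nat \<Rightarrow> real" assume X: "\<forall>i. X i \<in> UNIV - {0}" "X \<longlonglongrightarrow> 0"
    \<comment> \<open>Only from \<open>N\<close> on do the increments lie in the ball where the
      bounds hold; dropping finitely many terms does not change the limit.\<close>
    obtain N where N: "\<And>n. n \<ge> N \<Longrightarrow> X n \<in> ball 0 d"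
      using LIMSEQ_D[OF X(2) d] by auto
    have X': "(\<lambda>n. X (n + N)) \<longlonglongrightarrow> 0" using X(2) by (rule LIMSEQ_ignore_initial_segment)
    have *: "(\<lambda>n. LINT s:K|M. (g (X (n + N)) s - g 0 s) /\<^sub>R X (n + N)) \<longlonglongrightarrow> (LINT s:K|M. g' 0 s)"
    proof (rule set_integral_tendsto[where B = B])
      fix s assume s: "s \<in> K"
      have "((\<lambda>t. (g t s - g 0 s) /\<^sub>R t) \<longlongrightarrow> g' 0 s) (at 0)"
        using D[OF 0 s] unfolding has_vector_derivative_at_0_iff .
      then show "(\<lambda>n. (g (X (n + N)) s - g 0 s) /\<^sub>R X (n + N)) \<longlonglongrightarrow> g' 0 s"
        using X X' unfolding tendsto_at_iff_sequentially o_def by auto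
      fix n
      have "norm ((g (X (n + N)) s - g 0 s) /\<^sub>R X (n + N)) \<le> (B * \<bar>X (n + N)\<bar>) / \<bar>X (n + N)\<bar>"
        using lip[OF N s, of "n + N"] X by (simp add: divide_right_mono divide_inverse_commute)
      then show "norm ((g (X (n + N)) s - g 0 s) /\<^sub>R X (n + N)) \<le> B" using X by simp
    next
      show "continuous_on K (\<lambda>s. (g (X (n + N)) s - g 0 s) /\<^sub>R X (n + N))" for n
        by (intro continuous_intros g N 0) auto
    qed (use g' in auto)
    have "(\<lambda>n. (I (X (n + N)) - I 0) /\<^sub>R X (n + N)) \<longlonglongrightarrow> (LINT s:K|M. g' 0 s)"
    proof -
      have "(I (X (n + N)) - I 0) /\<^sub>R X (n + N) = (LINT s:K|M. (g (X (n + N)) s - g 0 s) /\<^sub>R X (n + N))" for n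
        by (rule quot, rule N) simp
      then show ?thesis using * by (simp only:)
    qed
    then have "(\<lambda>n. (I (X n) - I 0) /\<^sub>R X n) \<longlonglongrightarrow> (LINT s:K|M. g' 0 s)"
      by (rule LIMSEQ_offset)
    then show "((\<lambda>t. (I t - I 0) /\<^sub>R t) \<circ> X) \<longlonglongrightarrow> (LINT s:K|M. g' 0 s)" by (simp add: o_def)
  qed
  then show ?thesis unfolding I_def has_vector_derivative_at_0_iff .
qed

end

text \<open>\<open>H is\<close> plays the role of the derivative of \<open>H []\<close> with respect
  to \<open>x\<close> in the directions \<open>is\<close>. The family is a datum because continuity
  is wanted up to \<open>closure W\<close>, whereas derivatives are taken only in the open set
  \<open>W\<close>.\<close>

locale smooth_kernel = compact_finite_measure M K
  for M :: "(real^'n::finite) measure" and K +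
  fixes m :: nat and W :: "(real^'n) set" and H :: "'n list \<Rightarrow> real^'n \<Rightarrow> real^'n \<Rightarrow> 'b::{second_countable_topology, banach}"
  assumes W: "open W" "bounded W"
    and cont: "\<And>is. length is \<le> m \<Longrightarrow> continuous_on (closure W \<times> K) (\<lambda>(x, s). H is x s)"
    and deriv: "\<And>is i x s t. length is < m \<Longrightarrow> s \<in> K \<Longrightarrow> x + t *\<^sub>R axis i 1 \<in> W \<Longrightarrow>
      ((\<lambda>t. H is (x + t *\<^sub>R axis i 1) s) has_vector_derivative H (i # is) (x + t *\<^sub>R axis i 1) s) (at t)"
begin

definition potential :: "real^'n \<Rightarrow> 'b" where
  "potential = restr (closure W) (\<lambda>x. LINT s:K|M. H [] x s)"

lemma compact_closure_W: "compact (closure W)" using W by simp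

lemma continuous_on_integral:
  "length is \<le> m \<Longrightarrow> continuous_on (closure W) (\<lambda>x. LINT s:K|M. H is x s)"
  by (rule continuous_on_parametric_integral[OF compact_closure_W cont])

lemma cont_section: "length is \<le> m \<Longrightarrow> x \<in> W \<Longrightarrow> continuous_on K (H is x)"
  using continuous_on_section[OF cont] closure_subset by blast

lemma integral_has_vector_derivative:
  assumes l: "length is < m" and x: "x \<in> W"
  shows "((\<lambda>t. LINT s:K|M. H is (x + t *\<^sub>R axis i 1) s) has_vector_derivative (LINT s:K|M. H (i # is) x s)) (at 0)"
proof -
  have l': "length is \<le> m" "length (i # is) \<le> m" using l by auto
  obtain d where d: "0 < d" "\<And>t. t \<in> ball 0 d \<Longrightarrow> x + t *\<^sub>R axis i 1 \<in> W"
    using open_line_ball[OF W(1) x] by blast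
  have "bounded ((\<lambda>(x, s). H (i # is) x s) ` (closure W \<times> K))"
    by (rule compact_imp_bounded[OF compact_continuous_image[OF cont[OF l'(2)] compact_Times[OF compact_closure_W compact_K]]])
  then obtain B where "\<forall>z\<in>closure W \<times> K. norm (case z of (x, s) \<Rightarrow> H (i # is) x s) \<le> B"
    unfolding bounded_iff by blast
  then have B: "norm (H (i # is) y s) \<le> B" if "y \<in> W" "s \<in> K" for y s
    using that closure_subset by fastforce
  have "((\<lambda>t. LINT s:K|M. H is (x + t *\<^sub>R axis i 1) s) has_vector_derivative
    (LINT s:K|M. H (i # is) (x + 0 *\<^sub>R axis i 1) s)) (at 0)"
  proof (rule has_vector_derivative_integral[OF d(1), where g = "\<lambda>t. H is (x + t *\<^sub>R axis i 1)"
        and g' = "\<lambda>t. H (i # is) (x + t *\<^sub>R axis i 1)"])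
    show "continuous_on K (H is (x + t *\<^sub>R axis i 1))" if "t \<in> ball 0 d" for t
      by (rule cont_section[OF l'(1) d(2)[OF that]])
    show "continuous_on K (H (i # is) (x + 0 *\<^sub>R axis i 1))"
      using cont_section[OF l'(2) x] by simp
    show "((\<lambda>t. H is (x + t *\<^sub>R axis i 1) s) has_vector_derivative H (i # is) (x + t *\<^sub>R axis i 1) s) (at t)"
      if "t \<in> ball 0 d" "s \<in> K" for t s
      by (rule deriv[OF l that(2) d(2)[OF that(1)]])
    show "norm (H (i # is) (x + t *\<^sub>R axis i 1) s) \<le> B" if "t \<in> ball 0 d" "s \<in> K" for t s
      by (rule B[OF d(2)[OF that(1)] that(2)])
  qed
  then show ?thesis by simp
qed

text \<open>Inside the open set \<open>W\<close> the extension by zero is invisible. The formula for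
  one list must hold on all of \<open>W\<close> before it can be differentiated, hence the
  quantified hypothesis \<open>IH\<close> in the step.\<close>

lemma potential_derivs:
  shows "length is \<le> m \<Longrightarrow> x \<in> W \<Longrightarrow> pderivs is potential x = (LINT s:K|M. H is x s)"
    and "length is < m \<Longrightarrow> x \<in> W \<Longrightarrow>
      ((\<lambda>t. pderivs is potential (x + t *\<^sub>R axis i 1)) has_vector_derivative (LINT s:K|M. H (i # is) x s)) (at 0)"
proof -
  have step: "((\<lambda>t. pderivs is potential (x + t *\<^sub>R axis i 1)) has_vector_derivative (LINT s:K|M. H (i # is) x s)) (at 0)"
    if l: "length is < m" and x: "x \<in> W"
      and IH: "\<And>x. x \<in> W \<Longrightarrow> pderivs is potential x = (LINT s:K|M. H is x s)" for i "is" x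
  proof -
    obtain d where d: "0 < d" "\<And>t. t \<in> ball 0 d \<Longrightarrow> x + t *\<^sub>R axis i 1 \<in> W"
      using open_line_ball[OF W(1) x] by blast
    show ?thesis
    proof (rule has_vector_derivative_transform_within_open[OF integral_has_vector_derivative[OF l x]])
      show "open (ball 0 d :: real set)" "0 \<in> ball 0 d" using d by auto
      show "(LINT s:K|M. H is (x + t *\<^sub>R axis i 1) s) = pderivs is potential (x + t *\<^sub>R axis i 1)"
        if "t \<in> ball 0 d" for t
        by (rule IH[OF d(2)[OF that], symmetric])
    qed
  qed
  have main: "\<forall>x\<in>W. pderivs is potential x = (LINT s:K|M. H is x s)" if "length is \<le> m" for "is"
    using that
  proof (induction "is")
    case Nil
    then show ?case using closure_subset[of W] by (auto simp: potential_def restr_def)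
  next
    case (Cons i "is")
    then have l: "length is < m" and IH: "\<And>x. x \<in> W \<Longrightarrow> pderivs is potential x = (LINT s:K|M. H is x s)"
      by auto
    show ?case
    proof
      fix x assume "x \<in> W"
      from step[OF l this IH] show "pderivs (i # is) potential x = (LINT s:K|M. H (i # is) x s)"
        by (simp add: pderiv_at_def vector_derivative_at)
    qed
  qed
  show "length is \<le> m \<Longrightarrow> x \<in> W \<Longrightarrow> pderivs is potential x = (LINT s:K|M. H is x s)"
    using main by blast
  show "((\<lambda>t. pderivs is potential (x + t *\<^sub>R axis i 1)) has_vector_derivative (LINT s:K|M. H (i # is) x s)) (at 0)"
    if "length is < m" "x \<in> W"
    by (rule step[OF that]) (use main[of "is"] that in auto)
qed

lemma potential_in_Ck_closure_set: "potential \<in> Ck_closure_set m W"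
proof -
  have "Ck_on m W potential"
    unfolding Ck_on_def
  proof (intro conjI allI impI ballI)
    fix "is" :: "'n list" assume l: "length is \<le> m"
    show "continuous_on W (pderivs is potential)"
      using continuous_on_subset[OF continuous_on_integral[OF l] closure_subset]
      by (rule continuous_on_cong[THEN iffD1, OF refl, rotated]) (simp add: potential_derivs(1)[OF l])
  next
    fix "is" :: "'n list" and i x assume "length is < m" "x \<in> W"
    from potential_derivs(2)[OF this] show "(\<lambda>t. pderivs is potential (x + t *\<^sub>R axis i 1)) differentiable (at 0)"
      unfolding has_vector_derivative_def differentiable_def by blast
  qed
  moreover have "continuous_on (closure W) potential"
    using continuous_on_integral[of "[]"]
    by (rule continuous_on_cong[THEN iffD1, OF refl, rotated]) (auto simp: potential_def restr_def)
  moreover have "\<exists>g. continuous_on (closure W) g \<and> (\<forall>x\<in>W. g x = pderivs is potential x)" if "length is \<le> m" for "is"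
    using continuous_on_integral[OF that] potential_derivs(1)[OF that] by fastforce
  ultimately show ?thesis by (auto simp: Ck_closure_set_def potential_def restr_def)
qed

lemma pderivs_potential_bound:
  assumes "length is \<le> m" "x \<in> W" "\<And>s. s \<in> K \<Longrightarrow> norm (H is x s) \<le> B"
  shows "norm (pderivs is potential x) \<le> measure M K * B"
  unfolding potential_derivs(1)[OF assms(1,2)]
  by (rule norm_set_integral_le[OF cont_section[OF assms(1,2)] assms(3)])

end

section \<open>Hausdorff measure\<close>

lemma hausdorff_outer_le:
  assumes "\<And>\<delta>. 0 < \<delta> \<Longrightarrow> \<exists>E :: nat \<Rightarrow> 'a::metric_space set. A \<subseteq> (\<Union>i. E i) \<and>
      (\<forall>i. bounded (E i) \<and> diameter (E i) \<le> \<delta>) \<and>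
      (\<Sum>i. ennreal (unit_ball_vol (real m) * (diameter (E i) / 2) ^ m)) \<le> C"
  shows "hausdorff_outer m A \<le> C"
  unfolding hausdorff_outer_def
proof (rule SUP_least)
  fix \<delta> :: real assume "\<delta> \<in> {0<..}"
  then obtain E where "A \<subseteq> (\<Union>i. E i) \<and> (\<forall>i. bounded (E i) \<and> diameter (E i) \<le> \<delta>)"
    "(\<Sum>i. ennreal (unit_ball_vol (real m) * (diameter (E i) / 2) ^ m)) \<le> C"
    using assms[of \<delta>] by auto
  then show "(INF E\<in>{E :: nat \<Rightarrow> 'a set. A \<subseteq> (\<Union>i. E i) \<and> (\<forall>i. bounded (E i) \<and> diameter (E i) \<le> \<delta>)}.
        \<Sum>i. ennreal (unit_ball_vol (real m) * (diameter (E i) / 2) ^ m)) \<le> C"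
    by (intro INF_lower2[of E]) auto
qed

lemma ennreal_le_mult_iff:
  fixes x y :: ennreal
  assumes "0 < r"
  shows "x \<le> ennreal r * y \<longleftrightarrow> ennreal (1 / r) * x \<le> y"
proof -
  have 1: "ennreal (1 / r) * (ennreal r * z) = z" "ennreal r * (ennreal (1 / r) * z) = z" for z
    using assms by (simp_all add: mult.assoc[symmetric] ennreal_mult[symmetric])
  show ?thesis
    using mult_left_mono[of x "ennreal r * y" "ennreal (1 / r)"]
      mult_left_mono[of "ennreal (1 / r) * x" y "ennreal r"] by (auto simp: 1)
qed

lemma diameter_le_dist:
  fixes S :: "'a::metric_space set"
  assumes "0 \<le> d" "\<And>x y. x \<in> S \<Longrightarrow> y \<in> S \<Longrightarrow> dist x y \<le> d"
  shows "diameter S \<le> d"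
  using assms by (auto simp: diameter_def intro!: cSUP_least)

lemma bounded_dist:
  fixes S :: "'a::metric_space set"
  assumes "\<And>x y. x \<in> S \<Longrightarrow> y \<in> S \<Longrightarrow> dist x y \<le> d"
  shows "bounded S"
  using assms unfolding bounded_two_points by blast

text \<open>The images of a cover at scale \<open>\<delta> / L\<close> form a cover at scale
  \<delta>, with diameters enlarged at most by the factor \<open>L\<close>.\<close>

lemma hausdorff_outer_lipschitz_image:
  assumes L: "0 < L" and f: "\<And>x y. dist (f x) (f y) \<le> L * dist x y"
  shows "hausdorff_outer m (f ` A) \<le> ennreal (L ^ m) * hausdorff_outer m A"
  unfolding hausdorff_outer_def[of m "f ` A"]
proof (rule SUP_least)
  fix \<delta> :: real assume \<delta>: "\<delta> \<in> {0<..}"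
  let ?S = "\<lambda>E. \<Sum>i. ennreal (unit_ball_vol (real m) * (diameter (E i) / 2) ^ m)"
  let ?C = "\<lambda>\<delta> A. {E :: nat \<Rightarrow> _ set. A \<subseteq> (\<Union>i. E i) \<and> (\<forall>i. bounded (E i) \<and> diameter (E i) \<le> \<delta>)}"
  have le: "Inf (?S ` ?C \<delta> (f ` A)) \<le> ennreal (L ^ m) * ?S E" if E: "E \<in> ?C (\<delta> / L) A" for E
  proof -
    have d: "bounded (f ` E i) \<and> diameter (f ` E i) \<le> L * diameter (E i)" for i
    proof -
      have "dist (f x) (f y) \<le> L * diameter (E i)" if "x \<in> E i" "y \<in> E i" for x y
        using f[of x y] diameter_bounded_bound[of "E i" x y] E that L
        by (intro order_trans[OF f] mult_left_mono) auto
      moreover have "0 \<le> L * diameter (E i)" using L E by (simp add: diameter_ge_0)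
      ultimately show ?thesis
        by (auto intro!: diameter_le_dist bounded_dist)
    qed
    have "(\<lambda>i. f ` E i) \<in> ?C \<delta> (f ` A)"
    proof -
      have "diameter (f ` E i) \<le> \<delta>" for i
        using d[of i] E L by (auto simp: field_simps intro: order_trans)
      moreover have "f ` A \<subseteq> (\<Union>i. f ` E i)" using E by blast
      ultimately show ?thesis using d by blast
    qed
    then have "Inf (?S ` ?C \<delta> (f ` A)) \<le> ?S (\<lambda>i. f ` E i)" by (rule INF_lower)
    also have "\<dots> \<le> (\<Sum>i. ennreal (L ^ m) * ennreal (unit_ball_vol (real m) * (diameter (E i) / 2) ^ m))"
    proof (intro suminf_le allI summableI)
      fix i
      have "(diameter (f ` E i) / 2) ^ m \<le> (L * (diameter (E i) / 2)) ^ m"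
        using d[of i] by (intro power_mono) (auto simp: diameter_ge_0)
      then have "unit_ball_vol (real m) * (diameter (f ` E i) / 2) ^ m \<le>
        unit_ball_vol (real m) * (L * (diameter (E i) / 2)) ^ m"
        by (rule mult_left_mono) simp
      then have "unit_ball_vol (real m) * (diameter (f ` E i) / 2) ^ m \<le>
        L ^ m * (unit_ball_vol (real m) * (diameter (E i) / 2) ^ m)"
        by (simp only: power_mult_distrib mult_ac)
      then show "ennreal (unit_ball_vol (real m) * (diameter (f ` E i) / 2) ^ m) \<le>
        ennreal (L ^ m) * ennreal (unit_ball_vol (real m) * (diameter (E i) / 2) ^ m)"
        using L by (simp add: ennreal_mult'[symmetric] ennreal_leI)
    qed
    finally show ?thesis by simp
  qed
  \<comment> \<open>The factor is first moved to the left side, so that the infimum over covers is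
    taken of the unscaled sums.\<close>
  have "ennreal (1 / L ^ m) * Inf (?S ` ?C \<delta> (f ` A)) \<le> Inf (?S ` ?C (\<delta> / L) A)"
    using le L by (intro INF_greatest) (simp only: ennreal_le_mult_iff[symmetric] zero_less_power)
  also have "\<dots> \<le> hausdorff_outer m A"
    unfolding hausdorff_outer_def using \<delta> L by (intro SUP_upper) auto
  finally show "Inf (?S ` ?C \<delta> (f ` A)) \<le> ennreal (L ^ m) * hausdorff_outer m A"
    using L by (simp only: ennreal_le_mult_iff zero_less_power)
qed

text \<open>The reverse inequality is the Lipschitz bound for the inverse map, whose constant is
  \<open>1 / L\<close>.\<close>

lemma hausdorff_outer_similarity:
  assumes L: "0 < L" and f: "\<And>x y. dist (f x) (f y) = L * dist x y" and "surj f"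
  shows "hausdorff_outer m (f ` A) = ennreal (L ^ m) * hausdorff_outer m A"
proof (rule antisym)
  show "hausdorff_outer m (f ` A) \<le> ennreal (L ^ m) * hausdorff_outer m A"
    by (rule hausdorff_outer_lipschitz_image) (use L f in auto)
  have inj: "inj f"
  proof (rule injI)
    fix x y assume "f x = f y"
    then have "L * dist x y = 0" using f[of x y] by simp
    then show "x = y" using L by simp
  qed
  have "dist (inv f x) (inv f y) \<le> 1 / L * dist x y" for x y
    using f[of "inv f x" "inv f y"] L by (simp add: surj_f_inv_f[OF \<open>surj f\<close>])
  then have "hausdorff_outer m (inv f ` f ` A) \<le> ennreal ((1 / L) ^ m) * hausdorff_outer m (f ` A)"
    using L by (intro hausdorff_outer_lipschitz_image) auto
  then have "hausdorff_outer m A \<le> ennreal (1 / L ^ m) * hausdorff_outer m (f ` A)"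
    using inj by (simp add: image_inv_f_f power_one_over)
  then show "ennreal (L ^ m) * hausdorff_outer m A \<le> hausdorff_outer m (f ` A)"
    using ennreal_le_mult_iff[of "1 / L ^ m"] L by simp
qed

lemma sets_hausdorff_measure: "sets (hausdorff_measure m) = sets borel"
  and space_hausdorff_measure: "space (hausdorff_measure m) = UNIV"
  by (simp_all add: hausdorff_measure_def sets.sigma_sets_eq[of borel, simplified])

text \<open>
  Whether the Hausdorff outer measure is countably additive on the Borel sets never matters below:
  if it were not, \<open>measure_of\<close> would be the zero measure.
\<close>

lemma hausdorff_measure_cases:
  "(\<forall>A :: 'a::metric_space set\<in>sets borel. emeasure (hausdorff_measure m) A = hausdorff_outer m A) \<or>
   (\<forall>A :: 'a set. emeasure (hausdorff_measure m) A = 0)"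
  unfolding hausdorff_measure_def emeasure_measure_of_conv sets.sigma_sets_eq[of borel, simplified]
  by (cases "measure_space UNIV (sets borel) (hausdorff_outer m :: 'a set \<Rightarrow> ennreal)") simp_all

text \<open>Where \<open>measure_of\<close> falls back to the value 0, on non-measurable sets or for
  want of additivity, the inequality holds as well.\<close>

lemma emeasure_hausdorff_measure_le:
  "emeasure (hausdorff_measure m) A \<le> hausdorff_outer m A"
  unfolding hausdorff_measure_def emeasure_measure_of_conv by simp

section \<open>Change of variables under homotheties\<close>

lemma closure_affine_image:
  fixes A :: "'a::real_normed_vector set"
  shows "closure ((\<lambda>x. a + c *\<^sub>R x) ` A) = (\<lambda>x. a + c *\<^sub>R x) ` closure A"
proof -
  have "closure ((+) a ` ((*\<^sub>R) c ` A)) = (+) a ` ((*\<^sub>R) c ` closure A)"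
    by (simp only: closure_translation closure_scaleR)
  then show ?thesis by (simp add: image_image)
qed

lemma bij_affine:
  fixes a :: "'a::real_vector"
  assumes "c \<noteq> 0"
  shows "bij (\<lambda>x. a + c *\<^sub>R x)"
  by (rule bij_betw_byWitness[where f' = "\<lambda>y. (y - a) /\<^sub>R c"]) (use assms in auto)

lemma frontier_affine_image:
  fixes A :: "'a::real_normed_vector set"
  assumes "c \<noteq> 0"
  shows "frontier ((\<lambda>x. a + c *\<^sub>R x) ` A) = (\<lambda>x. a + c *\<^sub>R x) ` frontier A"
proof -
  let ?f = "\<lambda>x. a + c *\<^sub>R x"
  have b: "bij ?f" by (rule bij_affine[OF assms])
  show ?thesis
    unfolding frontier_closures closure_affine_image bij_image_Compl_eq[OF b, symmetric]
    by (rule image_Int[OF bij_is_inj[OF b], symmetric])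
qed

text \<open>As an identity of measures the scaling law can be used directly under the integral sign.
  In the degenerate case of \<open>hausdorff_measure_cases\<close> both sides vanish.\<close>

lemma hausdorff_measure_affine:
  fixes a :: "'a::euclidean_space"
  assumes c: "0 < c"
  shows "hausdorff_measure m = distr (density (hausdorff_measure m) (\<lambda>_. ennreal (c ^ m))) borel (\<lambda>x. a + c *\<^sub>R x)"
    (is "?H = distr ?D borel ?f")
proof (rule measure_eqI)
  show "sets ?H = sets (distr ?D borel ?f)" by (simp add: sets_hausdorff_measure)
  fix B :: "'a set" assume "B \<in> sets ?H"
  then have B: "B \<in> sets borel" by (simp add: sets_hausdorff_measure)
  have fm: "?f \<in> borel_measurable borel" by measurable
  then have pre: "?f -` B \<in> sets borel" using B measurable_sets_borel by blast
  have b: "bij ?f" by (rule bij_affine) (use c in auto)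
  have "?f \<in> measurable ?D borel"
    using fm by (simp add: measurable_cong_sets[OF sets_hausdorff_measure refl])
  then have "emeasure (distr ?D borel ?f) B = emeasure ?D (?f -` B)"
    using B by (simp add: emeasure_distr space_hausdorff_measure)
  also have "\<dots> = ennreal (c ^ m) * emeasure ?H (?f -` B)"
    using pre by (simp add: emeasure_density_const sets_hausdorff_measure)
  also have "\<dots> = emeasure ?H B"
    using hausdorff_measure_cases[where m = m and 'a = 'a]
  proof
    assume 1: "\<forall>A\<in>sets borel. emeasure ?H A = hausdorff_outer m A"
    have "hausdorff_outer m (?f ` (?f -` B)) = ennreal (c ^ m) * hausdorff_outer m (?f -` B)"
      using b c by (intro hausdorff_outer_similarity) (auto simp: dist_norm bij_is_surj simp flip: scaleR_diff_right)
    then show ?thesis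
      using B pre 1 by (simp only: surj_image_vimage_eq[OF bij_is_surj[OF b]])
  qed simp
  finally show "emeasure ?H B = emeasure (distr ?D borel ?f) B" by simp
qed

lemma set_integral_hausdorff_affine:
  fixes a :: "'a::euclidean_space" and h :: "'a \<Rightarrow> 'b::{second_countable_topology, banach}"
  assumes c: "0 < c" and K: "closed K" and h: "continuous_on ((\<lambda>x. a + c *\<^sub>R x) ` K) h"
  shows "set_lebesgue_integral (hausdorff_measure m) ((\<lambda>x. a + c *\<^sub>R x) ` K) h =
    c ^ m *\<^sub>R set_lebesgue_integral (hausdorff_measure m) K (\<lambda>x. h (a + c *\<^sub>R x))"
proof -
  let ?H = "hausdorff_measure m :: 'a measure" and ?f = "\<lambda>x. a + c *\<^sub>R x"
  have fm: "?f \<in> borel_measurable borel" by measurable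
  have inj: "inj ?f" using bij_affine[of c a] c by (simp add: bij_is_inj)
  have ind: "indicator (?f ` K) (?f x) = (indicator K x :: real)" for x
    using inj_image_mem_iff[OF inj, of x K] by (simp only: indicator_def)
  have "closed (?f ` K)" using closure_affine_image[of a c K] K by (metis closure_closed closed_closure)
  then have hm: "(\<lambda>x. indicator (?f ` K) x *\<^sub>R h x) \<in> borel_measurable borel"
    using h by (intro borel_measurable_continuous_on_indicator) auto
  have "set_lebesgue_integral ?H (?f ` K) h = (LINT x|distr (density ?H (\<lambda>_. ennreal (c ^ m))) borel ?f. indicator (?f ` K) x *\<^sub>R h x)"
    unfolding set_lebesgue_integral_def using hausdorff_measure_affine[OF c, of m a] by simp
  also have "\<dots> = (LINT x|density ?H (\<lambda>_. ennreal (c ^ m)). indicator (?f ` K) (?f x) *\<^sub>R h (?f x))"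
    using fm hm by (intro integral_distr) (simp_all add: measurable_cong_sets[OF sets_hausdorff_measure refl])
  also have "\<dots> = (LINT x|density ?H (\<lambda>_. ennreal (c ^ m)). indicator K x *\<^sub>R h (?f x))"
    by (simp only: ind)
  also have "\<dots> = (LINT x|?H. c ^ m *\<^sub>R (indicator K x *\<^sub>R h (?f x)))"
  proof (rule integral_density)
    have "(\<lambda>x. indicator (?f ` K) (?f x) *\<^sub>R h (?f x)) \<in> borel_measurable borel"
      using measurable_compose[OF fm hm] .
    then show "(\<lambda>x. indicator K x *\<^sub>R h (?f x)) \<in> borel_measurable ?H"
      by (simp only: ind measurable_cong_sets[OF sets_hausdorff_measure refl])
  qed (use c in auto)
  finally show ?thesis unfolding set_lebesgue_integral_def by (simp only: integral_scaleR_right)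
qed


section \<open>Finiteness of the surface measure of the boundary\<close>

lemma hausdorff_outer_finite_grid:
  fixes A :: "'a::metric_space set" and \<pi> :: "'i \<Rightarrow> 'a \<Rightarrow> real"
  assumes I: "finite I" "0 < card I" and C: "0 \<le> C"
    and R: "\<And>i x. i \<in> I \<Longrightarrow> x \<in> A \<Longrightarrow> \<bar>\<pi> i x\<bar> \<le> R" "0 < R"
    and dist: "\<And>x y d. x \<in> A \<Longrightarrow> y \<in> A \<Longrightarrow> (\<And>i. i \<in> I \<Longrightarrow> \<bar>\<pi> i x - \<pi> i y\<bar> \<le> d) \<Longrightarrow> dist x y \<le> C * d"
  shows "hausdorff_outer (card I) A < \<infinity>"
proof -
  define m where "m = card I"
  \<comment> \<open>Grid cells of side \<open>h = 2 R / N\<close> form the cover: there are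
    \<open>(N + 1)^m \<le> (2 N)^m\<close> of them, each of diameter at most \<open>C h\<close>, and
    \<open>2 N (C h / 2) = 2 C R\<close> for every \<open>N\<close>. So the bound does not depend on
    the scale \<delta>.\<close>
  define B where "B = unit_ball_vol (real m) * (2 * C * R) ^ m"
  have "hausdorff_outer m A \<le> ennreal B"
  proof (rule hausdorff_outer_le)
    fix \<delta> :: real assume \<delta>: "0 < \<delta>"
    obtain N :: nat where N: "2 * C * R / \<delta> < real N" using reals_Archimedean2 by blast
    have N0: "0 < real N" using N C R(2) \<delta> by (meson divide_nonneg_pos le_less_trans less_imp_le mult_nonneg_nonneg zero_le_numeral)
    define h where "h = 2 * R / real N"
    have h0: "0 < h" using R(2) N0 by (simp add: h_def)
    have Ch: "C * h \<le> \<delta>" using N N0 \<delta> by (simp add: h_def field_simps)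
    \<comment> \<open>The index \<open>N\<close> itself occurs, namely for
      \<open>\<pi> i x = R\<close>; hence \<open>N + 1\<close> values per coordinate.\<close>
    define T where "T = PiE I (\<lambda>_. {0..int N})"
    have finT: "finite T" unfolding T_def using I by (intro finite_PiE) auto
    have cardT: "card T = (N + 1) ^ m" unfolding T_def using I by (simp add: card_PiE m_def nat_add_distrib)
    obtain g where g: "bij_betw g {0..<card T} T" using ex_bij_betw_nat_finite[OF finT] by blast
    define cell' where "cell' c = {x \<in> A. \<forall>i\<in>I. \<lfloor>(\<pi> i x + R) / h\<rfloor> = c i}" for c
    define E where "E k = (if k < card T then cell' (g k) else {})" for k
    have near: "dist x y \<le> C * h" if "x \<in> E k" "y \<in> E k" for k x y
    proof (rule dist)
      show "x \<in> A" "y \<in> A" using that by (auto simp: E_def cell'_def split: if_splits)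
      fix i assume i: "i \<in> I"
      have "\<lfloor>(\<pi> i x + R) / h\<rfloor> = \<lfloor>(\<pi> i y + R) / h\<rfloor>"
        using that i by (auto simp: E_def cell'_def split: if_splits)
      then have "\<bar>(\<pi> i x + R) / h - (\<pi> i y + R) / h\<bar> < 1" by linarith
      then show "\<bar>\<pi> i x - \<pi> i y\<bar> \<le> h"
        using h0 by (simp add: diff_divide_distrib[symmetric] abs_divide)
    qed
    have bd: "bounded (E k)" for k using near by (rule bounded_dist)
    have diam: "diameter (E k) \<le> C * h" for k
      using near C h0 by (intro diameter_le_dist) auto
    have cover: "A \<subseteq> (\<Union>k. E k)"
    proof
      fix x assume x: "x \<in> A"
      define c where "c = restrict (\<lambda>i. \<lfloor>(\<pi> i x + R) / h\<rfloor>) I"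
      have "0 \<le> \<lfloor>(\<pi> i x + R) / h\<rfloor> \<and> \<lfloor>(\<pi> i x + R) / h\<rfloor> \<le> int N" if "i \<in> I" for i
      proof -
        have b: "0 \<le> \<pi> i x + R" "\<pi> i x + R \<le> 2 * R" using R(1)[OF that x] by auto
        have "0 \<le> (\<pi> i x + R) / h" using b h0 by simp
        moreover have "(\<pi> i x + R) / h \<le> 2 * R / h" using b h0 by (intro divide_right_mono) auto
        then have "(\<pi> i x + R) / h \<le> real N" using R(2) N0 by (simp add: h_def)
        ultimately show ?thesis by linarith
      qed
      then have "c \<in> T" by (auto simp: c_def T_def)
      then have "c \<in> g ` {0..<card T}" using g by (simp add: bij_betw_def)
      then obtain k where "k < card T" "g k = c" by auto
      moreover have "x \<in> cell' c" using x by (simp add: cell'_def c_def)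
      ultimately show "x \<in> (\<Union>k. E k)" by (auto simp: E_def)
    qed
    let ?t = "\<lambda>k. ennreal (unit_ball_vol (real m) * (diameter (E k) / 2) ^ m)"
    have "(\<Sum>k. ?t k) = (\<Sum>k<card T. ?t k)"
      by (rule suminf_finite) (use I in \<open>auto simp: E_def m_def\<close>)
    also have "\<dots> \<le> (\<Sum>k<card T. ennreal (unit_ball_vol (real m) * (C * h / 2) ^ m))"
      using diam bd by (intro sum_mono ennreal_leI mult_left_mono power_mono divide_right_mono) (auto simp: diameter_ge_0)
    also have "\<dots> = ennreal (real (card T) * (unit_ball_vol (real m) * (C * h / 2) ^ m))"
      using C h0 by (simp add: ennreal_mult'' ennreal_of_nat_eq_real_of_nat)
    also have "\<dots> \<le> ennreal B"
    proof (rule ennreal_leI)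
      have "real (card T) = (real N + 1) ^ m" by (simp add: cardT add.commute)
      also have "\<dots> \<le> (2 * real N) ^ m" using N0 by (intro power_mono) auto
      finally have "real (card T) * (unit_ball_vol (real m) * (C * h / 2) ^ m)
        \<le> (2 * real N) ^ m * (unit_ball_vol (real m) * (C * h / 2) ^ m)"
        using C h0 by (intro mult_right_mono) auto
      also have "\<dots> = unit_ball_vol (real m) * (2 * real N * (C * h / 2)) ^ m"
        by (simp only: power_mult_distrib mult_ac)
      also have "2 * real N * (C * h / 2) = 2 * C * R"
        using N0 by (simp add: h_def)
      finally show "real (card T) * (unit_ball_vol (real m) * (C * h / 2) ^ m) \<le> B"
        by (simp add: B_def)
    qed
    finally show "\<exists>E. A \<subseteq> (\<Union>i. E i) \<and> (\<forall>i. bounded (E i) \<and> diameter (E i) \<le> \<delta>) \<and>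
      (\<Sum>i. ennreal (unit_ball_vol (real m) * (diameter (E i) / 2) ^ m)) \<le> ennreal B"
      using cover bd diam Ch by (intro exI[of _ E]) (auto intro: order_trans)
  qed
  then show ?thesis unfolding m_def by (rule le_less_trans) simp
qed

text \<open>\<open>x\<close> is moved to \<open>y\<close> one coordinate at a time, with the mean
  value inequality on each segment; the induction is over the set of coordinates in which the two
  points may differ.\<close>

lemma Ck_on_lipschitz:
  fixes f :: "real^'n::finite \<Rightarrow> real"
  assumes f: "Ck_on 1 UNIV f" and B: "\<And>i x. \<bar>pderivs [i] f x\<bar> \<le> B"
  shows "\<bar>f x - f y\<bar> \<le> B * (\<Sum>i\<in>UNIV. \<bar>x $ i - y $ i\<bar>)"
proof -
  have D: "((\<lambda>t. f (x + t *\<^sub>R axis i 1)) has_vector_derivative pderiv_at i f (x + t *\<^sub>R axis i 1)) (at t)" for x t i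
    using Ck_on_has_vector_derivative[OF f, of "[]" x t i] by simp
  have line: "\<bar>f (x + t *\<^sub>R axis i 1) - f x\<bar> \<le> B * \<bar>t\<bar>" for x t i
  proof -
    have "norm (f (x + t *\<^sub>R axis i 1) - f (x + 0 *\<^sub>R axis i 1)) \<le> B * norm (t - 0)"
    proof (rule differentiable_bound[where S = UNIV and f = "\<lambda>t. f (x + t *\<^sub>R axis i 1)"
          and f' = "\<lambda>t h. h *\<^sub>R pderiv_at i f (x + t *\<^sub>R axis i 1)"])
      show "((\<lambda>t. f (x + t *\<^sub>R axis i 1)) has_derivative (\<lambda>h. h *\<^sub>R pderiv_at i f (x + u *\<^sub>R axis i 1))) (at u)" for u
        using D unfolding has_vector_derivative_def .
      show "onorm (\<lambda>h. h *\<^sub>R pderiv_at i f (x + u *\<^sub>R axis i 1)) \<le> B" for u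
      proof (rule onorm_le)
        show "norm (h *\<^sub>R pderiv_at i f (x + u *\<^sub>R axis i 1)) \<le> B * norm h" for h
          using mult_right_mono[OF B[of i "x + u *\<^sub>R axis i 1"], of "\<bar>h\<bar>"] by (simp add: abs_mult mult.commute)
      qed
    qed auto
    then show ?thesis by simp
  qed
  have "\<forall>x. (\<forall>i. i \<notin> S \<longrightarrow> x $ i = y $ i) \<longrightarrow> \<bar>f x - f y\<bar> \<le> B * (\<Sum>i\<in>S. \<bar>x $ i - y $ i\<bar>)" if "finite S" for S
    using that
  proof (induction S rule: finite_induct)
    case empty
    then show ?case by (auto simp: vec_eq_iff[symmetric])
  next
    case (insert i S)
    show ?case
    proof (intro allI impI)
      fix x :: "real^'n" assume x: "\<forall>j. j \<notin> insert i S \<longrightarrow> x $ j = y $ j"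
      define z where "z = x + (y $ i - x $ i) *\<^sub>R axis i 1"
      have z: "z $ j = (if j = i then y $ j else x $ j)" for j
        by (simp add: z_def axis_def)
      have "\<bar>f z - f y\<bar> \<le> B * (\<Sum>j\<in>S. \<bar>z $ j - y $ j\<bar>)"
        using x by (intro insert.IH[rule_format]) (auto simp: z)
      also have "(\<Sum>j\<in>S. \<bar>z $ j - y $ j\<bar>) = (\<Sum>j\<in>S. \<bar>x $ j - y $ j\<bar>)"
        using insert.hyps by (intro sum.cong) (auto simp: z)
      finally have "\<bar>f z - f y\<bar> \<le> B * (\<Sum>j\<in>S. \<bar>x $ j - y $ j\<bar>)" .
      moreover have "\<bar>f z - f x\<bar> \<le> B * \<bar>x $ i - y $ i\<bar>"
        using line[of x "y $ i - x $ i" i] by (simp add: z_def abs_minus_commute)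
      ultimately show "\<bar>f x - f y\<bar> \<le> B * (\<Sum>j\<in>insert i S. \<bar>x $ j - y $ j\<bar>)"
        using insert.hyps by (simp add: distrib_left)
    qed
  qed
  then show ?thesis by auto
qed

lemma Ck_on_lipschitz_norm:
  fixes f :: "real^'n::finite \<Rightarrow> real"
  assumes "Ck_on 1 UNIV f" "\<And>i. bounded (range (pderivs [i] f))"
  shows "\<exists>L\<ge>0. \<forall>x y. \<bar>f x - f y\<bar> \<le> L * norm (x - y)"
proof -
  have "\<forall>i. \<exists>B. \<forall>x. \<bar>pderivs [i] f x\<bar> \<le> B"
    using assms(2) by (auto simp: bounded_iff)
  then obtain B where B: "\<And>i x. \<bar>pderivs [i] f x\<bar> \<le> B i" by metis
  define C where "C = (\<Sum>i\<in>UNIV. B i)"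
  have B0: "0 \<le> B i" for i using B[of i 0] by linarith
  then have "B i \<le> C" for i unfolding C_def by (intro member_le_sum) auto
  then have C: "\<bar>pderivs [i] f x\<bar> \<le> C" for i x using B order_trans by blast
  have C0: "0 \<le> C" unfolding C_def using B0 by (intro sum_nonneg) auto
  have "\<bar>f x - f y\<bar> \<le> (C * real CARD('n)) * norm (x - y)" for x y
  proof -
    have "(\<Sum>i\<in>UNIV. \<bar>x $ i - y $ i\<bar>) \<le> (\<Sum>i\<in>(UNIV :: 'n set). norm (x - y))"
      using component_le_norm_cart[of "x - y"] by (intro sum_mono) simp
    then have "C * (\<Sum>i\<in>UNIV. \<bar>x $ i - y $ i\<bar>) \<le> C * (real CARD('n) * norm (x - y))"
      using C0 by (intro mult_left_mono) auto
    with Ck_on_lipschitz[OF assms(1) C, of x y] show ?thesis by (simp add: mult.assoc)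
  qed
  then show ?thesis using C0 by (intro exI[of _ "C * real CARD('n)"]) auto
qed

text \<open>A point of the graph is recovered from its projection along \<open>v\<close>, in a
  Lipschitz way by the bound on \<gamma>. Differences of projections are orthogonal to
  \<open>v\<close>, so if \<open>v $ j\<close> is nonzero their coordinate \<open>j\<close> is
  controlled by the others: \<open>n - 1\<close> coordinates suffice for the grid.\<close>

lemma hausdorff_outer_graph_finite:
  fixes \<gamma> :: "real^'n::finite \<Rightarrow> real"
  assumes v: "norm v = 1" and n: "2 \<le> CARD('n)"
    and \<gamma>: "\<And>x t. \<gamma> (x + t *\<^sub>R v) = \<gamma> x"
    and L: "0 \<le> L" "\<And>x y. \<bar>\<gamma> x - \<gamma> y\<bar> \<le> L * norm (x - y)"
    and A: "\<And>x. x \<in> A \<Longrightarrow> x \<bullet> v = \<gamma> x" and "bounded A"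
  shows "hausdorff_outer (CARD('n) - 1) A < \<infinity>"
proof -
  have "v \<noteq> 0" using v by auto
  then obtain j where j: "v $ j \<noteq> 0" by (auto simp: vec_eq_iff)
  define \<pi> where "\<pi> x = x - (x \<bullet> v) *\<^sub>R v" for x
  have vv: "v \<bullet> v = 1" using v by (simp add: norm_eq_1)
  have orth: "\<pi> x \<bullet> v = 0" for x by (simp add: \<pi>_def inner_diff_left vv)
  have x: "x = \<pi> x + \<gamma> (\<pi> x) *\<^sub>R v" if "x \<in> A" for x
  proof -
    have "\<gamma> (\<pi> x) = \<gamma> x" using \<gamma>[of "\<pi> x" "x \<bullet> v"] by (simp add: \<pi>_def)
    then show ?thesis using A[OF that] by (simp add: \<pi>_def)
  qed
  obtain b where b: "0 < b" "\<And>x. x \<in> A \<Longrightarrow> norm x \<le> b" using \<open>bounded A\<close> by (auto simp: bounded_pos)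
  have vi: "\<bar>v $ i\<bar> \<le> 1" for i using component_le_norm_cart[of v i] v by simp
  define n' where "n' = real CARD('n)"
  \<comment> \<open>The bracket bounds the norm of a difference of projections by its coordinates
    other than \<open>j\<close>; the factor \<open>1 + L\<close> passes from the projections to the
    points themselves.\<close>
  define C where "C = (1 + L) * (n' + n' / \<bar>v $ j\<bar>)"
  have fin: "finite (UNIV - {j})" and card: "card (UNIV - {j}) = CARD('n) - 1"
    by (auto simp: card_Diff_singleton)
  have "hausdorff_outer (card (UNIV - {j})) A < \<infinity>"
  proof (rule hausdorff_outer_finite_grid[where \<pi> = "\<lambda>i x. \<pi> x $ i" and R = "2 * b" and C = C])
    show "0 < card (UNIV - {j})" using n card by simp
    show "0 \<le> C" using L by (simp add: C_def n'_def)
    show "\<bar>\<pi> x $ i\<bar> \<le> 2 * b" if "x \<in> A" for i x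
    proof -
      have "norm (\<pi> x) \<le> norm x + \<bar>x \<bullet> v\<bar> * norm v"
        unfolding \<pi>_def using norm_triangle_ineq4[of x "(x \<bullet> v) *\<^sub>R v"] by simp
      also have "\<bar>x \<bullet> v\<bar> \<le> norm x" using Cauchy_Schwarz_ineq2[of x v] v by simp
      finally show ?thesis using v b(2)[OF that] component_le_norm_cart[of "\<pi> x" i] by simp
    qed
    fix x y d assume xy: "x \<in> A" "y \<in> A" and d: "\<And>i. i \<in> UNIV - {j} \<Longrightarrow> \<bar>\<pi> x $ i - \<pi> y $ i\<bar> \<le> d"
    define u where "u = \<pi> x - \<pi> y"
    have ui: "\<bar>u $ i\<bar> \<le> d" if "i \<noteq> j" for i using d[of i] that by (simp add: u_def)
    \<comment> \<open>As \<open>n \<ge> 2\<close> there is a coordinate other than \<open>j\<close>,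
      which forces \<open>d\<close> to be nonnegative.\<close>
    have "card (UNIV - {j}) \<noteq> 0" using n card by simp
    then obtain i0 where "i0 \<noteq> j" by (metis card.empty DiffD2 ex_in_conv insertI1)
    then have d0: "0 \<le> d" using ui[of i0] by linarith
    have "u \<bullet> v = 0" using orth by (simp add: u_def inner_diff_left)
    then have "u $ j * v $ j + (\<Sum>i\<in>UNIV - {j}. u $ i * v $ i) = 0"
      by (simp add: inner_vec_def sum.remove[of UNIV j])
    then have "\<bar>u $ j\<bar> * \<bar>v $ j\<bar> = \<bar>\<Sum>i\<in>UNIV - {j}. u $ i * v $ i\<bar>"
      by (simp add: abs_mult[symmetric] add_eq_0_iff2)
    also have "\<dots> \<le> (\<Sum>i\<in>UNIV - {j}. \<bar>u $ i * v $ i\<bar>)" by (rule sum_abs)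
    also have "\<dots> \<le> of_nat (card (UNIV - {j})) * d"
      using ui vi d0 mult_mono[of _ d _ 1] by (intro sum_bounded_above) (auto simp: abs_mult)
    also have "\<dots> \<le> n' * d" using card d0 by (intro mult_right_mono) (auto simp: n'_def)
    finally have uj: "\<bar>u $ j\<bar> \<le> n' * d / \<bar>v $ j\<bar>" using j by (simp add: pos_le_divide_eq)
    have "norm u \<le> (\<Sum>i\<in>UNIV. \<bar>u $ i\<bar>)" by (rule norm_le_l1_cart)
    also have "\<dots> = \<bar>u $ j\<bar> + (\<Sum>i\<in>UNIV - {j}. \<bar>u $ i\<bar>)" by (rule sum.remove) auto
    also have "(\<Sum>i\<in>UNIV - {j}. \<bar>u $ i\<bar>) \<le> of_nat (card (UNIV - {j})) * d"
      using ui by (intro sum_bounded_above) auto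
    also have "\<dots> \<le> n' * d" using card d0 by (intro mult_right_mono) (auto simp: n'_def)
    finally have u: "norm u \<le> (n' + n' / \<bar>v $ j\<bar>) * d" using uj by (simp add: algebra_simps)
    have "x - y = u + (\<gamma> (\<pi> x) - \<gamma> (\<pi> y)) *\<^sub>R v"
      by (subst x[OF xy(1)], subst x[OF xy(2)]) (simp add: u_def algebra_simps)
    then have "dist x y \<le> norm u + \<bar>\<gamma> (\<pi> x) - \<gamma> (\<pi> y)\<bar>"
      unfolding dist_norm using norm_triangle_ineq[of u "(\<gamma> (\<pi> x) - \<gamma> (\<pi> y)) *\<^sub>R v"] v by simp
    also have "\<dots> \<le> (1 + L) * norm u" using L(2)[of "\<pi> x" "\<pi> y"] by (simp add: u_def algebra_simps)
    also have "\<dots> \<le> (1 + L) * ((n' + n' / \<bar>v $ j\<bar>) * d)" using u L by (intro mult_left_mono) auto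
    finally show "dist x y \<le> C * d" by (simp add: C_def)
  qed (use b fin in auto)
  then show ?thesis by (simp add: card)
qed

text \<open>Near each of its points the boundary lies in the graph of a Lipschitz function; by
  compactness finitely many such pieces suffice.\<close>

lemma of_class_C1_surface_finite:
  fixes \<Omega> :: "(real^'n::finite) set"
  assumes \<Omega>: "of_class_C1 \<alpha> \<Omega>" "bounded \<Omega>" and n: "2 \<le> CARD('n)"
  shows "emeasure surface_measure (frontier \<Omega>) < \<infinity>"
proof -
  have op: "open \<Omega>" using \<Omega> by (auto simp: of_class_C1_def)
  have "\<exists>N. open N \<and> x0 \<in> N \<and> hausdorff_outer (CARD('n) - 1) (frontier \<Omega> \<inter> N) < \<infinity>"
    if "x0 \<in> frontier \<Omega>" for x0
  proof -
    obtain N v and \<gamma> :: "real^'n \<Rightarrow> real" where N: "open N" "x0 \<in> N" and v: "norm v = 1"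
      and \<gamma>: "\<gamma> \<in> nset (schauder_closure 1 \<alpha> UNIV)" and inv: "\<And>x t. \<gamma> (x + t *\<^sub>R v) = \<gamma> x"
      and eq: "N \<inter> \<Omega> = {x \<in> N. x \<bullet> v < \<gamma> x}"
      using \<Omega>(1) \<open>x0 \<in> frontier \<Omega>\<close> unfolding of_class_C1_def by blast
    have Ck: "Ck_on 1 UNIV \<gamma>" and cont: "continuous_on UNIV \<gamma>"
      and bd: "\<And>is. length is \<le> 1 \<Longrightarrow> bounded (range (pderivs is \<gamma>))"
      using \<gamma> by (simp_all add: schauder_closure_def Ck_closure_set_def)
    have "bounded (range (pderivs [i] \<gamma>))" for i by (rule bd) simp
    with Ck obtain L where L: "0 \<le> L" "\<And>x y. \<bar>\<gamma> x - \<gamma> y\<bar> \<le> L * norm (x - y)"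
      using Ck_on_lipschitz_norm by blast
    \<comment> \<open>A boundary point is not in the open set \<Omega>, so it is not strictly below
      the graph; as a limit of points of \<open>N \<inter> \<Omega>\<close> it is not strictly above
      it either.\<close>
    have "x \<bullet> v = \<gamma> x" if x: "x \<in> frontier \<Omega> \<inter> N" for x
    proof (rule antisym)
      have "x \<notin> \<Omega>" using x op by (auto simp: frontier_def interior_open)
      then show "\<gamma> x \<le> x \<bullet> v" using eq x by force
      have "closed {y. y \<bullet> v \<le> \<gamma> y}"
        using cont by (intro closed_Collect_le continuous_intros)
      moreover have "N \<inter> \<Omega> \<subseteq> {y. y \<bullet> v \<le> \<gamma> y}" using eq by auto
      ultimately have "closure (N \<inter> \<Omega>) \<subseteq> {y. y \<bullet> v \<le> \<gamma> y}" by (rule closure_minimal[rotated])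
      moreover have "x \<in> closure (N \<inter> \<Omega>)"
        using open_Int_closure_subset[OF N(1), of \<Omega>] x by (auto simp: frontier_def)
      ultimately show "x \<bullet> v \<le> \<gamma> x" by auto
    qed
    then have "hausdorff_outer (CARD('n) - 1) (frontier \<Omega> \<inter> N) < \<infinity>"
      using bounded_subset[OF compact_imp_bounded[OF compact_frontier_bounded[OF \<Omega>(2)]]]
      by (intro hausdorff_outer_graph_finite[OF v n inv L]) auto
    then show ?thesis using N by blast
  qed
  then obtain N where N: "\<And>x. x \<in> frontier \<Omega> \<Longrightarrow> open (N x) \<and> x \<in> N x \<and> hausdorff_outer (CARD('n) - 1) (frontier \<Omega> \<inter> N x) < \<infinity>"
    by metis
  have "compact (frontier \<Omega>)" using \<Omega>(2) by (rule compact_frontier_bounded)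
  moreover have "frontier \<Omega> \<subseteq> (\<Union>x\<in>frontier \<Omega>. N x)" using N by auto
  ultimately obtain T where T: "T \<subseteq> frontier \<Omega>" "finite T" "frontier \<Omega> \<subseteq> (\<Union>x\<in>T. N x)"
    using compactE_image[of "frontier \<Omega>" "frontier \<Omega>" N] N by blast
  have meas: "frontier \<Omega> \<inter> N x \<in> sets surface_measure" if "x \<in> T" for x
    using N T(1) that by (auto simp: surface_measure_def sets_hausdorff_measure)
  have "emeasure surface_measure (frontier \<Omega>) \<le> emeasure surface_measure (\<Union>x\<in>T. frontier \<Omega> \<inter> N x)"
    using T(3) by (intro emeasure_mono sets.finite_UN[OF T(2) meas]) auto
  also have "\<dots> \<le> (\<Sum>x\<in>T. emeasure surface_measure (frontier \<Omega> \<inter> N x))"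
    by (rule emeasure_subadditive_finite[OF T(2)]) (use meas in auto)
  also have "\<dots> \<le> (\<Sum>x\<in>T. hausdorff_outer (CARD('n) - 1) (frontier \<Omega> \<inter> N x))"
    unfolding surface_measure_def by (intro sum_mono emeasure_hausdorff_measure_le)
  also have "\<dots> < \<infinity>"
  proof -
    have "hausdorff_outer (CARD('n) - 1) (frontier \<Omega> \<inter> N x) < top" if "x \<in> T" for x
      using N T(1) that by auto
    with T(2) show ?thesis unfolding infinity_ennreal_def by simp
  qed
  finally show ?thesis .
qed

section \<open>Layer potentials with an analytic density\<close>

lemma continuous_on_prod_list [continuous_intros]:
  fixes f :: "'i \<Rightarrow> 'a::topological_space \<Rightarrow> 'b::real_normed_algebra_1"
  assumes "\<And>i. continuous_on A (f i)"
  shows "continuous_on A (\<lambda>x. prod_list (map (\<lambda>i. f i x) is))"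
  by (induction "is") (auto intro!: continuous_intros assms)

text \<open>\<open>Y\<close> stands for the space of densities: its norm dominates point values, so
  convergence in \<open>Y\<close> entails pointwise convergence on \<open>K\<close>. The assumption
  \<open>dom\<close> keeps every argument of \<open>G\<close> in \<open>S\<close>, for \<epsilon> of
  either sign.\<close>

locale analytic_layer = compact_finite_measure M K
  for M :: "(real^'n::finite) measure" and K +
  fixes G :: "real^'n \<Rightarrow> complex" and S W :: "(real^'n) set" and p :: "real^'n" and e R :: real
    and Y :: "(real^'n \<Rightarrow> complex) nspace"
  assumes G: "expandable_on S G" and W: "open W" "bounded W"
    and R: "\<And>s. s \<in> K \<Longrightarrow> norm s \<le> R" "0 \<le> R"
    and dom: "\<And>x s \<epsilon>. x \<in> closure W \<Longrightarrow> s \<in> K \<Longrightarrow> \<bar>\<epsilon>\<bar> < e \<Longrightarrow> x - p - \<epsilon> *\<^sub>R s \<in> S"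
    and Y_cont: "\<And>f. f \<in> nset Y \<Longrightarrow> continuous_on K f"
    and Y_norm: "\<And>f s. f \<in> nset Y \<Longrightarrow> s \<in> K \<Longrightarrow> norm (f s) \<le> nnorm Y f"
    and Y_add: "\<And>f g. f \<in> nset Y \<Longrightarrow> g \<in> nset Y \<Longrightarrow> f + g \<in> nset Y"
    and Y_scale: "\<And>f r. f \<in> nset Y \<Longrightarrow> r *\<^sub>R f \<in> nset Y"
begin

text \<open>\<open>kern [] j \<epsilon> x s\<close> is the coefficient of \<open>h^j\<close> in the
  expansion of \<open>G (x - p - (\<epsilon> + h) s)\<close> in \<open>h\<close>; the list
  \<open>js\<close> holds the directions in which it is differentiated with respect to
  \<open>x\<close>. With \<open>js\<close> in front of \<open>is\<close>, one more
  \<open>x\<close>-derivative is a mere \<open>Cons\<close>.\<close>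

definition kern :: "'n list \<Rightarrow> nat \<Rightarrow> real \<Rightarrow> real^'n \<Rightarrow> real^'n \<Rightarrow> complex" where
  "kern js j \<epsilon> x s = (1 / fact j) *\<^sub>R
    (\<Sum>is\<in>{is. length is = j}. prod_list (map (($) (- s)) is) *\<^sub>R pderivs (js @ is) G (x - p - \<epsilon> *\<^sub>R s))"

lemma kern_Nil: "kern [] j \<epsilon> x s = taylor_term G j (x - p - \<epsilon> *\<^sub>R s) (- s)"
  by (simp add: kern_def taylor_term_def)

lemma kern_Nil_0: "kern [] 0 \<epsilon> x s = G (x - p - \<epsilon> *\<^sub>R s)"
  by (simp add: kern_def)

lemma kern_continuous:
  assumes "\<bar>\<epsilon>\<bar> < e"
  shows "continuous_on (closure W \<times> K) (\<lambda>(x, s). kern js j \<epsilon> x s)"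
proof -
  have D: "continuous_on (closure W \<times> K) (\<lambda>z. pderivs is G (fst z - p - \<epsilon> *\<^sub>R snd z))" for "is"
    by (rule continuous_on_compose2[OF expandable_on_continuous_on[OF expandable_on_pderivs[OF G]]])
      (auto intro!: continuous_intros dom assms)
  have C: "continuous_on (closure W \<times> K) (\<lambda>z. (- snd z) $ i)" for i :: 'n
    by (intro continuous_intros)
  show ?thesis
    unfolding kern_def case_prod_beta
    by (intro continuous_on_scaleR continuous_on_const continuous_on_sum continuous_on_prod_list C D)
qed

lemma kern_has_vector_derivative:
  assumes "\<bar>\<epsilon>\<bar> < e" "s \<in> K" "x + t *\<^sub>R axis i 1 \<in> W"
  shows "((\<lambda>t. kern js j \<epsilon> (x + t *\<^sub>R axis i 1) s) has_vector_derivative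
    kern (i # js) j \<epsilon> (x + t *\<^sub>R axis i 1) s) (at t)"
proof -
  have eq: "x + u *\<^sub>R axis i 1 - p - \<epsilon> *\<^sub>R s = (x - p - \<epsilon> *\<^sub>R s) + u *\<^sub>R axis i 1" for u
    by (simp add: algebra_simps)
  have "x + t *\<^sub>R axis i 1 \<in> closure W" using assms(3) closure_subset by blast
  from dom[OF this assms(2,1)] have S: "(x - p - \<epsilon> *\<^sub>R s) + t *\<^sub>R axis i 1 \<in> S" by (simp only: eq)
  have "((\<lambda>t. pderivs (js @ is) G ((x - p - \<epsilon> *\<^sub>R s) + t *\<^sub>R axis i 1)) has_vector_derivative
    pderivs ((i # js) @ is) G ((x - p - \<epsilon> *\<^sub>R s) + t *\<^sub>R axis i 1)) (at t)" for "is"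
    using expandable_on_has_pderiv[OF expandable_on_pderivs[OF G] S] by simp
  then show ?thesis
    unfolding kern_def eq
    by (intro bounded_linear.has_vector_derivative[OF bounded_linear_scaleR_right] has_vector_derivative_sum)
qed

text \<open>The constants may depend on \<epsilon> and \<open>m\<close>, but not on
  \<open>x\<close>, \<open>s\<close> or \<open>j\<close>: this uniformity is what turns pointwise
  Taylor series into convergence in \<open>Ck_closure m W\<close>.\<close>

lemma kern_expansion:
  assumes "\<bar>\<epsilon>\<bar> < e"
  obtains C Q \<rho> where "0 \<le> C" "0 \<le> Q" "0 < \<rho>" "\<rho> * Q \<le> 1 / 2"
    "\<And>h. \<bar>h\<bar> < \<rho> \<Longrightarrow> \<bar>\<epsilon> + h\<bar> < e"
    "\<And>js j x s. length js \<le> m \<Longrightarrow> x \<in> closure W \<Longrightarrow> s \<in> K \<Longrightarrow> norm (kern js j \<epsilon> x s) \<le> C * Q ^ j"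
    "\<And>x s h. x \<in> closure W \<Longrightarrow> s \<in> K \<Longrightarrow> \<bar>h\<bar> < \<rho> \<Longrightarrow>
      (\<lambda>j. h ^ j *\<^sub>R kern [] j \<epsilon> x s) sums G (x - p - (\<epsilon> + h) *\<^sub>R s)"
proof -
  \<comment> \<open>Halfway between \<open>\<bar>\<epsilon>\<bar>\<close> and \<open>e\<close>, so
    that the arguments of \<open>G\<close> with parameter up to \<open>e'\<close> fill a compact
    subset of \<open>S\<close>.\<close>
  define e' where "e' = (\<bar>\<epsilon>\<bar> + e) / 2"
  have e': "\<bar>\<epsilon>\<bar> < e'" "e' < e" using assms by (auto simp: e'_def)
  define K' where "K' = (\<lambda>(x, s, t). x - p - t *\<^sub>R s) ` (closure W \<times> K \<times> {-e'..e'})"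
  have K': "compact K'"
    unfolding K'_def case_prod_beta
    by (intro compact_continuous_image compact_Times compact_K continuous_intros) (use W in auto)
  have K'S: "K' \<subseteq> S" unfolding K'_def using dom e' by (auto simp: abs_less_iff abs_le_iff)
  have mem: "x - p - t *\<^sub>R s \<in> K'" if "x \<in> closure W" "s \<in> K" "\<bar>t\<bar> \<le> e'" for x s t
    unfolding K'_def using that by (intro image_eqI[of _ _ "(x, s, t)"]) auto
  obtain C M' where C: "0 \<le> C" and M': "1 \<le> M'"
    and bd: "\<And>js is y. length js \<le> m \<Longrightarrow> y \<in> K' \<Longrightarrow> norm (pderivs (js @ is) G y) \<le> C * M' ^ length is * fact (length is)"
    using expandable_on_pderivs_append_bound[OF G K' K'S, of m] by blast
  define Q where "Q = real CARD('n) * R * M'"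
  have Q: "0 \<le> Q" using R M' by (simp add: Q_def)
  \<comment> \<open>The first bound keeps \<open>\<epsilon> + h\<close> within \<open>e'\<close>,
    the second gives a ratio of at most 1/2; adding 1 to \<open>Q\<close> avoids a zero
    denominator.\<close>
  define \<rho> where "\<rho> = min (e' - \<bar>\<epsilon>\<bar>) (1 / (2 * (Q + 1)))"
  have \<rho>: "0 < \<rho>" "\<rho> \<le> e' - \<bar>\<epsilon>\<bar>" using e' Q by (auto simp: \<rho>_def)
  have "\<rho> * Q \<le> 1 / (2 * (Q + 1)) * Q" using Q by (intro mult_right_mono) (auto simp: \<rho>_def)
  also have "\<dots> \<le> 1 / 2" using Q by (simp add: field_simps)
  finally have \<rho>Q: "\<rho> * Q \<le> 1 / 2" .
  have 1: "\<bar>\<epsilon> + h\<bar> < e" if "\<bar>h\<bar> < \<rho>" for h using that \<rho> e' by linarith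
  have 2: "norm (kern js j \<epsilon> x s) \<le> C * Q ^ j" if "length js \<le> m" "x \<in> closure W" "s \<in> K" for js j x s
  proof -
    have y: "x - p - \<epsilon> *\<^sub>R s \<in> K'" by (rule mem) (use that e' in auto)
    have "norm (\<Sum>is\<in>{is. length is = j}. prod_list (map (($) (- s)) is) *\<^sub>R pderivs (js @ is) G (x - p - \<epsilon> *\<^sub>R s))
      \<le> (real CARD('n) * R) ^ j * (C * M' ^ j * fact j)"
      by (rule norm_sum_lists_le) (use R that bd[OF that(1) y] in auto)
    then show ?thesis
      by (simp add: kern_def Q_def field_simps power_mult_distrib)
  qed
  have 3: "(\<lambda>j. h ^ j *\<^sub>R kern [] j \<epsilon> x s) sums G (x - p - (\<epsilon> + h) *\<^sub>R s)"
    if x: "x \<in> closure W" and s: "s \<in> K" and h: "\<bar>h\<bar> < \<rho>" for x s h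
  proof -
    have line: "(x - p - \<epsilon> *\<^sub>R s) + t *\<^sub>R (- s) = x - p - (\<epsilon> + t) *\<^sub>R s" for t
      by (simp add: algebra_simps)
    have "\<bar>h\<bar> * Q \<le> \<rho> * Q" using h Q by (intro mult_right_mono) auto
    then have "\<bar>h\<bar> * Q < 1" using \<rho>Q by linarith
    then have hQ: "\<bar>h\<bar> * (real CARD('n) * R * M') < 1" by (simp only: Q_def)
    have "(\<lambda>j. h ^ j *\<^sub>R taylor_term G j (x - p - \<epsilon> *\<^sub>R s) (- s)) sums G ((x - p - \<epsilon> *\<^sub>R s) + h *\<^sub>R (- s))"
    proof (rule taylor_sums[OF G _ K'S, where \<delta> = \<rho> and R = R and M = M' and C = C])
      show "(x - p - \<epsilon> *\<^sub>R s) + t *\<^sub>R (- s) \<in> K'" if "\<bar>t\<bar> \<le> \<rho>" for t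
        unfolding line by (rule mem[OF x s]) (use that \<rho> in auto)
      show "cmod (pderivs is G z) \<le> C * M' ^ length is * fact (length is)" if "z \<in> K'" for "is" z
        using bd[of "[]" z "is"] that by simp
    qed (use R s h M' hQ in auto)
    then show ?thesis by (simp only: line kern_Nil)
  qed
  show ?thesis by (rule that[OF C Q \<rho>(1) \<rho>Q 1 2 3])
qed

text \<open>\<open>x\<close> enters only through \<open>kern\<close>, so differentiation acts on the
  list index alone. With \<open>N = 0\<close> this covers the potential itself, with
  \<open>N = length hs\<close> the coefficients of its expansion.\<close>

lemma smooth_kernel_kern:
  assumes "\<bar>\<epsilon>\<bar> < e" "\<And>j. continuous_on K (\<theta> j)"
  shows "smooth_kernel M K m W (\<lambda>js x s. \<Sum>j\<le>N. kern js j \<epsilon> x s * \<theta> j s)"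
proof unfold_locales
  fix js :: "'n list"
  have "continuous_on (closure W \<times> K) (\<lambda>z. \<theta> j (snd z))" for j
    by (rule continuous_on_compose2[OF assms(2) continuous_on_snd]) auto
  then show "continuous_on (closure W \<times> K) (\<lambda>(x, s). \<Sum>j\<le>N. kern js j \<epsilon> x s * \<theta> j s)"
    using kern_continuous[OF assms(1)] unfolding case_prod_beta by (intro continuous_intros)
next
  fix js i x s t assume "s \<in> K" "x + t *\<^sub>R axis i 1 \<in> W"
  note d = kern_has_vector_derivative[OF assms(1) this]
  show "((\<lambda>t. \<Sum>j\<le>N. kern js j \<epsilon> (x + t *\<^sub>R axis i 1) s * \<theta> j s) has_vector_derivative
    (\<Sum>j\<le>N. kern (i # js) j \<epsilon> (x + t *\<^sub>R axis i 1) s * \<theta> j s)) (at t)"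
    by (intro has_vector_derivative_sum bounded_linear.has_vector_derivative[OF bounded_linear_mult_left] d)
qed (use W in auto)

text \<open>The first \<open>j\<close> increments enter through their \<epsilon>-components, the
  others as arguments of \<open>A\<close>. On \<open>replicate n \<delta>\<close> with
  \<open>j \<le> n\<close> this is \<open>(fst \<delta>)^j\<close> times
  \<open>A (replicate (n - j) \<delta>)\<close>, the factor that belongs to \<open>kern [] j\<close>
  in the Cauchy product.\<close>

definition dens :: "((real \<times> real) list \<Rightarrow> real^'n \<Rightarrow> complex) \<Rightarrow> (real \<times> real) list \<Rightarrow> nat \<Rightarrow> real^'n \<Rightarrow> complex" where
  "dens A hs j s = prod_list (map fst (take j hs)) *\<^sub>R A (drop j hs) s"

text \<open>
  The coefficients of the expansion of \<open>layer \<Theta>\<close> below: the Cauchy product of the Taylor series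
  of the kernel in \<open>\<epsilon>\<close> with the expansion \<open>A\<close> of the density.
\<close>

definition layer_form :: "real \<Rightarrow> ((real \<times> real) list \<Rightarrow> real^'n \<Rightarrow> complex) \<Rightarrow> (real \<times> real) list \<Rightarrow> real^'n \<Rightarrow> complex" where
  "layer_form \<epsilon> A hs = restr (closure W) (\<lambda>x. LINT s:K|M. (\<Sum>j\<le>length hs. kern [] j \<epsilon> x s * dens A hs j s))"

definition layer :: "(real \<times> real \<Rightarrow> real^'n \<Rightarrow> complex) \<Rightarrow> real \<times> real \<Rightarrow> real^'n \<Rightarrow> complex" where
  "layer \<Theta> z = restr (closure W) (\<lambda>x. LINT s:K|M. G (x - p - fst z *\<^sub>R s) * \<Theta> z s)"

lemma layer_in_Ck_closure:
  assumes "\<bar>fst z\<bar> < e" "\<Theta> z \<in> nset Y"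
  shows "layer \<Theta> z \<in> Ck_closure_set m W"
proof -
  interpret smooth_kernel M K m W "\<lambda>js x s. \<Sum>j\<le>0. kern js j (fst z) x s * \<Theta> z s"
    by (rule smooth_kernel_kern[OF assms(1)]) (rule Y_cont[OF assms(2)])
  have "potential = layer \<Theta> z" unfolding potential_def layer_def by (simp add: kern_Nil_0)
  then show ?thesis using potential_in_Ck_closure_set by simp
qed

lemma dens_norm_le:
  assumes A: "A (drop j hs) \<in> nset Y" "nnorm Y (A (drop j hs)) \<le> c (length (drop j hs)) * prod_list (map norm (drop j hs))"
    and "s \<in> K" "j \<le> length hs"
  shows "norm (dens A hs j s) \<le> c (length hs - j) * prod_list (map norm hs)"
proof -
  have f: "\<bar>prod_list (map fst l)\<bar> \<le> prod_list (map norm l)" for l :: "(real \<times> real) list"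
  proof (induction l)
    case (Cons a l)
    have "\<bar>fst a\<bar> \<le> norm a" using norm_fst_le[of "fst a" "snd a"] by simp
    with Cons show ?case by (auto simp: abs_mult intro!: mult_mono)
  qed simp
  have split: "prod_list (map norm hs) = prod_list (map norm (take j hs)) * prod_list (map norm (drop j hs))"
    by (metis append_take_drop_id map_append prod_list.append)
  have nn: "0 \<le> prod_list (map norm l)" for l :: "(real \<times> real) list"
    by (induction l) auto
  have "norm (A (drop j hs) s) \<le> c (length hs - j) * prod_list (map norm (drop j hs))"
    using order_trans[OF Y_norm[OF A(1) assms(3)] A(2)] by simp
  then have "norm (dens A hs j s) \<le> prod_list (map norm (take j hs)) * (c (length hs - j) * prod_list (map norm (drop j hs)))"
    unfolding dens_def norm_scaleR using f nn by (intro mult_mono) auto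
  then show ?thesis unfolding split by (simp add: mult_ac)
qed

lemma set_integral_sum_continuous:
  fixes g :: "'i \<Rightarrow> real^'n \<Rightarrow> complex"
  assumes "finite I" "\<And>i. i \<in> I \<Longrightarrow> continuous_on K (g i)"
  shows "(LINT s:K|M. (\<Sum>i\<in>I. g i s)) = (\<Sum>i\<in>I. LINT s:K|M. g i s)"
  using assms
proof (induction I rule: finite_induct)
  case (insert i I)
  have "set_integrable M K (g i)" "set_integrable M K (\<lambda>s. \<Sum>i\<in>I. g i s)"
    by (intro set_integrable_continuous continuous_on_sum; use insert in auto)+
  with insert show ?case by simp
qed (simp add: set_lebesgue_integral_def)

lemma kern_section:
  assumes "\<bar>\<epsilon>\<bar> < e" "x \<in> closure W"
  shows "continuous_on K (kern js j \<epsilon> x)"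
  by (rule continuous_on_section[OF kern_continuous[OF assms(1)] assms(2)])

section \<open>Membership, bounds and multilinearity of the coefficients\<close>

context
  fixes A :: "(real \<times> real) list \<Rightarrow> real^'n \<Rightarrow> complex" and \<epsilon> :: real
  assumes A: "multilinear_family nspace_UNIV Y A" and \<epsilon>: "\<bar>\<epsilon>\<bar> < e"
begin

lemma A_mem: "A hs \<in> nset Y"
  using A by (simp add: multilinear_family_def nspace_UNIV_def)

lemma A_add: "A (us @ (x + y) # vs) s = A (us @ x # vs) s + A (us @ y # vs) s"
  using A by (simp add: multilinear_family_def nspace_UNIV_def del: split_paired_All)

lemma A_scale: "A (us @ (r *\<^sub>R x) # vs) s = r *\<^sub>R A (us @ x # vs) s"
  using A by (simp add: multilinear_family_def nspace_UNIV_def scaleR_fun_def del: split_paired_All)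

lemma dens_continuous: "continuous_on K (dens A hs j)"
  unfolding dens_def by (intro continuous_intros Y_cont A_mem)

lemma smooth_kernel_dens: "smooth_kernel M K m W (\<lambda>js x s. \<Sum>j\<le>length hs. kern js j \<epsilon> x s * dens A hs j s)"
  by (rule smooth_kernel_kern[OF \<epsilon> dens_continuous])

lemma layer_form_in_Ck_closure: "layer_form \<epsilon> A hs \<in> Ck_closure_set m W"
proof -
  interpret smooth_kernel M K m W "\<lambda>js x s. \<Sum>j\<le>length hs. kern js j \<epsilon> x s * dens A hs j s"
    by (rule smooth_kernel_dens)
  show ?thesis using potential_in_Ck_closure_set unfolding potential_def layer_form_def .
qed

lemma layer_form_pderivs_bound:
  assumes js: "length js \<le> m" "x \<in> W"
    and c: "\<And>hs. nnorm Y (A hs) \<le> c (length hs) * prod_list (map norm hs)"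
    and bd: "\<And>js j x s. length js \<le> m \<Longrightarrow> x \<in> closure W \<Longrightarrow> s \<in> K \<Longrightarrow> norm (kern js j \<epsilon> x s) \<le> C * Q ^ j"
    and CQ: "0 \<le> C" "0 \<le> Q"
  shows "norm (pderivs js (layer_form \<epsilon> A hs) x)
    \<le> (measure M K * (\<Sum>j\<le>length hs. C * Q ^ j * c (length hs - j))) * prod_list (map norm hs)"
proof -
  interpret smooth_kernel M K m W "\<lambda>js x s. \<Sum>j\<le>length hs. kern js j \<epsilon> x s * dens A hs j s"
    by (rule smooth_kernel_dens)
  have x: "x \<in> closure W" using js closure_subset by blast
  have "norm (pderivs js potential x)
    \<le> measure M K * (\<Sum>j\<le>length hs. C * Q ^ j * (c (length hs - j) * prod_list (map norm hs)))"
  proof (rule pderivs_potential_bound[OF js])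
    fix s assume s: "s \<in> K"
    show "norm (\<Sum>j\<le>length hs. kern js j \<epsilon> x s * dens A hs j s)
      \<le> (\<Sum>j\<le>length hs. C * Q ^ j * (c (length hs - j) * prod_list (map norm hs)))"
    proof (rule sum_norm_le)
      fix j assume j: "j \<in> {..length hs}"
      have "norm (dens A hs j s) \<le> c (length hs - j) * prod_list (map norm hs)"
        by (rule dens_norm_le[where A = A and c = c, OF A_mem c s]) (use j in auto)
      then show "norm (kern js j \<epsilon> x s * dens A hs j s) \<le> C * Q ^ j * (c (length hs - j) * prod_list (map norm hs))"
        unfolding norm_mult using bd[OF js(1) x s] CQ by (intro mult_mono) auto
    qed
  qed
  also have "measure M K * (\<Sum>j\<le>length hs. C * Q ^ j * (c (length hs - j) * prod_list (map norm hs))) =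
    (measure M K * (\<Sum>j\<le>length hs. C * Q ^ j * c (length hs - j))) * prod_list (map norm hs)"
    by (simp add: sum_distrib_left sum_distrib_right mult_ac)
  finally show ?thesis unfolding potential_def layer_form_def .
qed

text \<open>For each \<open>j\<close> the slot in question lies either among the first
  \<open>j\<close> entries, where linearity is that of \<open>fst\<close>, or among the arguments of
  \<open>A\<close>. So \<open>dens\<close> is linear in it, and the sum over \<open>j\<close> and
  the integral preserve this.\<close>

lemma layer_form_add_scale:
  shows "layer_form \<epsilon> A (us @ (a + b) # vs) = layer_form \<epsilon> A (us @ a # vs) + layer_form \<epsilon> A (us @ b # vs)"
    and "layer_form \<epsilon> A (us @ (r *\<^sub>R a) # vs) = r *\<^sub>R layer_form \<epsilon> A (us @ a # vs)"
proof -
  have dens: "dens A (us @ (a + b) # vs) j s = dens A (us @ a # vs) j s + dens A (us @ b # vs) j s \<and>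
    dens A (us @ (r *\<^sub>R a) # vs) j s = r *\<^sub>R dens A (us @ a # vs) j s" for j s
  proof (cases "j \<le> length us")
    case True
    then show ?thesis by (simp add: dens_def A_add A_scale algebra_simps)
  next
    case False
    then obtain k where "j = length us + Suc k" by (metis add_Suc_right less_iff_Suc_add not_le)
    then show ?thesis by (simp add: dens_def algebra_simps)
  qed
  define g where "g z x s = (\<Sum>j\<le>length (us @ z # vs). kern [] j \<epsilon> x s * dens A (us @ z # vs) j s)" for z x s
  have form: "layer_form \<epsilon> A (us @ z # vs) = restr (closure W) (\<lambda>x. LINT s:K|M. g z x s)" for z
    by (simp add: layer_form_def g_def)
  have int: "set_integrable M K (g z x)" if "x \<in> closure W" for z x
    unfolding g_def
    by (intro set_integrable_continuous continuous_intros kern_section[OF \<epsilon> that] dens_continuous)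
  have gadd: "g (a + b) x = (\<lambda>s. g a x s + g b x s)" and gscale: "g (r *\<^sub>R a) x = (\<lambda>s. r *\<^sub>R g a x s)" for x
    unfolding g_def fun_eq_iff by (simp_all add: dens sum.distrib distrib_left scaleR_sum_right scaleR_right_distrib)
  show "layer_form \<epsilon> A (us @ (a + b) # vs) = layer_form \<epsilon> A (us @ a # vs) + layer_form \<epsilon> A (us @ b # vs)"
  proof
    fix x
    show "layer_form \<epsilon> A (us @ (a + b) # vs) x = (layer_form \<epsilon> A (us @ a # vs) + layer_form \<epsilon> A (us @ b # vs)) x"
      unfolding form using int[of x] by (simp add: restr_def gadd)
  qed
  show "layer_form \<epsilon> A (us @ (r *\<^sub>R a) # vs) = r *\<^sub>R layer_form \<epsilon> A (us @ a # vs)"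
  proof
    fix x
    show "layer_form \<epsilon> A (us @ (r *\<^sub>R a) # vs) x = (r *\<^sub>R layer_form \<epsilon> A (us @ a # vs)) x"
      unfolding form by (simp add: restr_def gscale scaleR_fun_def)
  qed
qed

lemma multilinear_layer_form: "multilinear_family nspace_UNIV (Ck_closure m W) (layer_form \<epsilon> A)"
  unfolding multilinear_family_def
  using layer_form_in_Ck_closure[of _ m] by (simp add: layer_form_add_scale Ck_closure_def)

end

text \<open>At a fixed \<open>s\<close> this is the Cauchy product of two absolutely convergent
  series. Their majorants \<open>a\<close> and \<open>d\<close> do not depend on \<open>s\<close>,
  so all partial sums are bounded by the sum of the convolution \<gamma>, and dominated convergence
  allows the exchange of sum and integral.\<close>

lemma layer_form_sums:
  fixes A :: "(real \<times> real) list \<Rightarrow> real^'n \<Rightarrow> complex"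
  assumes A: "multilinear_family nspace_UNIV Y A" and \<epsilon>: "\<bar>\<epsilon>\<bar> < e" "\<bar>\<epsilon> + fst \<delta>\<bar> < e"
    and kb: "\<And>j x s. x \<in> closure W \<Longrightarrow> s \<in> K \<Longrightarrow> norm (fst \<delta> ^ j *\<^sub>R kern [] j \<epsilon> x s) \<le> a j"
    and ks: "\<And>x s. x \<in> closure W \<Longrightarrow> s \<in> K \<Longrightarrow>
      (\<lambda>j. fst \<delta> ^ j *\<^sub>R kern [] j \<epsilon> x s) sums G (x - p - (\<epsilon> + fst \<delta>) *\<^sub>R s)"
    and Ab: "\<And>j s. s \<in> K \<Longrightarrow> norm (A (replicate j \<delta>) s) \<le> d j"
    and As: "\<And>s. s \<in> K \<Longrightarrow> (\<lambda>j. A (replicate j \<delta>) s) sums \<Theta> s"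
    and sm: "summable a" "summable d" and a0: "\<And>j. 0 \<le> a j" and d0: "\<And>j. 0 \<le> d j"
    and \<Theta>: "continuous_on K \<Theta>"
    and x: "x \<in> closure W"
  shows "(\<lambda>n. layer_form \<epsilon> A (replicate n \<delta>) x) sums (LINT s:K|M. G (x - p - (\<epsilon> + fst \<delta>) *\<^sub>R s) * \<Theta> s)"
proof -
  define g where "g n s = (\<Sum>j\<le>n. (fst \<delta> ^ j *\<^sub>R kern [] j \<epsilon> x s) * A (replicate (n - j) \<delta>) s)" for n s
  define \<gamma> where "\<gamma> n = (\<Sum>j\<le>n. a j * d (n - j))" for n
  have gcont: "continuous_on K (g n)" for n
    unfolding g_def
    by (intro continuous_intros kern_section[OF \<epsilon>(1) x] Y_cont A_mem[OF A \<epsilon>(1)])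
  have form: "layer_form \<epsilon> A (replicate n \<delta>) x = (LINT s:K|M. g n s)" for n
  proof -
    have "(\<Sum>j\<le>length (replicate n \<delta>). kern [] j \<epsilon> x s * dens A (replicate n \<delta>) j s) = g n s" for s
      unfolding g_def length_replicate
    proof (rule sum.cong)
      fix j assume "j \<in> {..n}"
      then have "dens A (replicate n \<delta>) j s = fst \<delta> ^ j *\<^sub>R A (replicate (n - j) \<delta>) s"
        by (simp add: dens_def prod_list_replicate min_def)
      then show "kern [] j \<epsilon> x s * dens A (replicate n \<delta>) j s = (fst \<delta> ^ j *\<^sub>R kern [] j \<epsilon> x s) * A (replicate (n - j) \<delta>) s"
        by simp
    qed simp
    then show ?thesis using x by (simp add: layer_form_def restr_def)
  qed
  have s\<gamma>: "summable \<gamma>"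
    unfolding \<gamma>_def using sm a0 d0 by (intro summable_Cauchy_product) simp_all
  have \<gamma>0: "0 \<le> \<gamma> n" for n unfolding \<gamma>_def using a0 d0 by (intro sum_nonneg) auto
  have gb: "norm (g n s) \<le> \<gamma> n" if "s \<in> K" for n s
    unfolding g_def \<gamma>_def
  proof (rule sum_norm_le)
    fix j
    show "norm ((fst \<delta> ^ j *\<^sub>R kern [] j \<epsilon> x s) * A (replicate (n - j) \<delta>) s) \<le> a j * d (n - j)"
      unfolding norm_mult by (rule mult_mono[OF kb[OF x that] Ab[OF that] a0]) simp
  qed
  have gs: "(\<lambda>n. g n s) sums (G (x - p - (\<epsilon> + fst \<delta>) *\<^sub>R s) * \<Theta> s)" if s: "s \<in> K" for s
  proof -
    have "summable (\<lambda>j. norm (fst \<delta> ^ j *\<^sub>R kern [] j \<epsilon> x s))"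
      by (rule summable_comparison_test'[OF sm(1)]) (use kb[OF x s] in auto)
    moreover have "summable (\<lambda>j. norm (A (replicate j \<delta>) s))"
      by (rule summable_comparison_test'[OF sm(2)]) (use Ab[OF s] in auto)
    ultimately have "(\<lambda>n. \<Sum>j\<le>n. (fst \<delta> ^ j *\<^sub>R kern [] j \<epsilon> x s) * A (replicate (n - j) \<delta>) s) sums
      ((\<Sum>j. fst \<delta> ^ j *\<^sub>R kern [] j \<epsilon> x s) * (\<Sum>j. A (replicate j \<delta>) s))"
      by (rule Cauchy_product_sums)
    then show ?thesis
      unfolding g_def sums_unique[OF ks[OF x s], symmetric] sums_unique[OF As[OF s], symmetric] .
  qed
  have limc: "continuous_on K (\<lambda>s. G (x - p - (\<epsilon> + fst \<delta>) *\<^sub>R s) * \<Theta> s)"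
    using kern_section[OF \<epsilon>(2) x, of "[]" 0] \<Theta> unfolding kern_Nil_0 by (rule continuous_on_mult)
  have "(\<lambda>N. LINT s:K|M. (\<Sum>n<N. g n s)) \<longlonglongrightarrow> (LINT s:K|M. G (x - p - (\<epsilon> + fst \<delta>) *\<^sub>R s) * \<Theta> s)"
  proof (rule set_integral_tendsto[OF _ limc, where B = "\<Sum>n. \<gamma> n"])
    show "continuous_on K (\<lambda>s. \<Sum>n<N. g n s)" for N
      by (intro continuous_on_sum gcont)
    show "(\<lambda>N. \<Sum>n<N. g n s) \<longlonglongrightarrow> G (x - p - (\<epsilon> + fst \<delta>) *\<^sub>R s) * \<Theta> s" if "s \<in> K" for s
      using gs[OF that] by (simp add: sums_def)
    show "norm (\<Sum>n<N. g n s) \<le> (\<Sum>n. \<gamma> n)" if "s \<in> K" for N s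
    proof -
      have "norm (\<Sum>n<N. g n s) \<le> (\<Sum>n<N. \<gamma> n)" by (rule sum_norm_le) (rule gb[OF that])
      also have "\<dots> \<le> (\<Sum>n. \<gamma> n)" by (rule sum_le_suminf[OF s\<gamma>]) (use \<gamma>0 in auto)
      finally show ?thesis .
    qed
  qed
  moreover have "(LINT s:K|M. (\<Sum>n<N. g n s)) = (\<Sum>n<N. layer_form \<epsilon> A (replicate n \<delta>) x)" for N
    unfolding form by (rule set_integral_sum_continuous) (auto intro: gcont)
  ultimately show ?thesis by (simp add: sums_def)
qed

lemma Y_diff_sum:
  fixes g :: "nat \<Rightarrow> real^'n \<Rightarrow> complex"
  assumes "f \<in> nset Y" "\<And>j. g j \<in> nset Y"
  shows "f - (\<Sum>j<N. g j) \<in> nset Y"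
proof -
  have zero: "0 \<in> nset Y" using Y_scale[OF assms(1), of 0] by simp
  have "(\<Sum>j<N. g j) \<in> nset Y"
  proof (induction N)
    case (Suc N)
    then show ?case unfolding sum.lessThan_Suc by (rule Y_add) (rule assms(2))
  qed (simp only: lessThan_0 sum.empty zero)
  then have "f + (- 1) *\<^sub>R (\<Sum>j<N. g j) \<in> nset Y" by (intro Y_add assms(1) Y_scale)
  then show ?thesis by (simp only: scaleR_minus1_left add_uminus_conv_diff)
qed

lemma real_analytic_layer:
  assumes \<Theta>: "real_analytic_map nspace_UNIV Y D \<Theta>" and D: "nopen nspace_UNIV D'" "D' \<subseteq> D"
    and e: "\<And>z. z \<in> D' \<Longrightarrow> \<bar>fst z\<bar> < e"
  shows "real_analytic_map nspace_UNIV (Ck_closure m W) D' (layer \<Theta>)"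
  unfolding real_analytic_map_def
proof (intro conjI ballI)
  show "nopen nspace_UNIV D'" by fact
  have \<Theta>Y: "\<Theta> z \<in> nset Y" if "z \<in> D" for z using \<Theta> that by (auto simp: real_analytic_map_def)
  show "layer \<Theta> ` D' \<subseteq> nset (Ck_closure m W)"
    using layer_in_Ck_closure e \<Theta>Y D by (fastforce simp: Ck_closure_def)
  fix z0 assume z0: "z0 \<in> D'"
  obtain r1 where r1: "0 < r1" "\<And>z. norm (z - z0) < r1 \<Longrightarrow> z \<in> D'"
    using D(1) z0 unfolding nopen_def nspace_UNIV_def by auto
  have z0D: "z0 \<in> D" using z0 D by auto
  obtain A c r where r: "0 < r" and A: "multilinear_family nspace_UNIV Y A"
    and c: "\<And>j. 0 \<le> c j" "summable (\<lambda>j. c j * r ^ j)"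
    and Ab: "\<And>hs. nnorm Y (A hs) \<le> c (length hs) * prod_list (map norm hs)"
    and As: "\<And>z. norm (z - z0) < r \<Longrightarrow>
      z \<in> D \<and> (\<lambda>N. nnorm Y (\<Theta> z - (\<Sum>j<N. A (replicate j (z - z0))))) \<longlonglongrightarrow> 0"
  proof -
    have "\<exists>A c r. 0 < r \<and> multilinear_family nspace_UNIV Y A \<and> (\<forall>j. 0 \<le> c j) \<and> summable (\<lambda>j. c j * r ^ j) \<and>
        (\<forall>hs. nnorm Y (A hs) \<le> c (length hs) * prod_list (map norm hs)) \<and>
        (\<forall>z. norm (z - z0) < r \<longrightarrow> z \<in> D \<and>
           (\<lambda>N. nnorm Y (\<Theta> z - (\<Sum>j<N. A (replicate j (z - z0))))) \<longlonglongrightarrow> 0)"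
      using \<Theta> z0D unfolding real_analytic_map_def nspace_UNIV_def by simp
    then show ?thesis using that by blast
  qed
  define \<epsilon> where "\<epsilon> = fst z0"
  have \<epsilon>: "\<bar>\<epsilon>\<bar> < e" using e[OF z0] by (simp add: \<epsilon>_def)
  obtain C Q \<rho> where C: "0 \<le> C" and Q: "0 \<le> Q" and \<rho>: "0 < \<rho>" "\<rho> * Q \<le> 1 / 2"
    and \<epsilon>h: "\<And>h. \<bar>h\<bar> < \<rho> \<Longrightarrow> \<bar>\<epsilon> + h\<bar> < e"
    and kb: "\<And>js j x s. length js \<le> m \<Longrightarrow> x \<in> closure W \<Longrightarrow> s \<in> K \<Longrightarrow> norm (kern js j \<epsilon> x s) \<le> C * Q ^ j"
    and ks: "\<And>x s h. x \<in> closure W \<Longrightarrow> s \<in> K \<Longrightarrow> \<bar>h\<bar> < \<rho> \<Longrightarrow>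
      (\<lambda>j. h ^ j *\<^sub>R kern [] j \<epsilon> x s) sums G (x - p - (\<epsilon> + h) *\<^sub>R s)"
    by (rule kern_expansion[OF \<epsilon>, of m]) blast
  \<comment> \<open>\<open>r1\<close> keeps the parameter in \<open>D'\<close>, \<open>r\<close> is
    the radius for the density and \<rho> the one for the kernel.\<close>
  define r' where "r' = min r1 (min r \<rho>)"
  have r': "0 < r'" "r' \<le> r1" "r' \<le> r" "r' \<le> \<rho>" using r1 r \<rho> by (auto simp: r'_def)
  define a where "a j = C * (Q * r') ^ j" for j
  define d where "d j = c j * r' ^ j" for j
  have "Q * r' \<le> \<rho> * Q" using r' Q by (simp add: mult.commute mult_left_mono)
  then have "norm (Q * r') < 1" using \<rho>(2) Q r' by simp
  then have sa: "summable a" unfolding a_def by (intro summable_mult summable_geometric)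
  have sd: "summable d"
    unfolding d_def by (rule summable_comparison_test'[OF c(2)]) (use r' c in \<open>auto intro!: mult_left_mono power_mono\<close>)
  have a0: "0 \<le> a j" for j using C Q r' by (simp add: a_def)
  have d0: "0 \<le> d j" for j using c r' by (simp add: d_def)
  \<comment> \<open>The convolution of the two sequences of bounds; with the weight
    \<open>r'^n\<close> it becomes, up to the measure of \<open>K\<close>, the Cauchy product of
    \<open>a\<close> and \<open>d\<close>, and is therefore summable.\<close>
  define b where "b n = measure M K * (\<Sum>j\<le>n. C * Q ^ j * c (n - j))" for n
  have b0: "0 \<le> b n" for n unfolding b_def using C Q c by (intro mult_nonneg_nonneg sum_nonneg) auto
  have br: "b n * r' ^ n = measure M K * (\<Sum>j\<le>n. a j * d (n - j))" for n
  proof -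
    have "C * Q ^ j * c (n - j) * r' ^ n = a j * d (n - j)" if "j \<le> n" for j
    proof -
      have "r' ^ n = r' ^ j * r' ^ (n - j)" using that by (simp flip: power_add)
      then show ?thesis by (simp add: a_def d_def power_mult_distrib)
    qed
    then show ?thesis by (simp add: b_def sum_distrib_right mult.assoc)
  qed
  have sb: "summable (\<lambda>n. b n * r' ^ n)"
    unfolding br using sa sd a0 d0 by (intro summable_mult summable_Cauchy_product) simp_all
  \<comment> \<open>The norm of \<open>Ck_closure m W\<close> is a sum over this many lists of
    directions.\<close>
  define cc where "cc = real (card {is :: 'n list. length is \<le> m})"
  have pd: "norm (pderivs js (layer_form \<epsilon> A hs) x) \<le> b (length hs) * prod_list (map norm hs)"
    if "length js \<le> m" "x \<in> W" for js hs x
    unfolding b_def by (rule layer_form_pderivs_bound[OF A \<epsilon> that Ab kb C Q])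
  show "\<exists>A c r. 0 < r \<and> multilinear_family nspace_UNIV (Ck_closure m W) A \<and> (\<forall>j. 0 \<le> c j) \<and>
        summable (\<lambda>j. c j * r ^ j) \<and>
        (\<forall>hs. set hs \<subseteq> nset nspace_UNIV \<longrightarrow>
           nnorm (Ck_closure m W) (A hs) \<le> c (length hs) * prod_list (map (nnorm nspace_UNIV) hs)) \<and>
        (\<forall>x\<in>nset nspace_UNIV. nnorm nspace_UNIV (x - z0) < r \<longrightarrow> x \<in> D' \<and>
           (\<lambda>N. nnorm (Ck_closure m W) (layer \<Theta> x - (\<Sum>j<N. A (replicate j (x - z0))))) \<longlonglongrightarrow> 0)"
  proof (intro exI[of _ "layer_form \<epsilon> A"] exI[of _ "\<lambda>n. cc * b n"] exI[of _ r'] conjI allI impI ballI)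
    show "multilinear_family nspace_UNIV (Ck_closure m W) (layer_form \<epsilon> A)"
      by (rule multilinear_layer_form[OF A \<epsilon>])
    show "0 \<le> cc * b j" for j using b0 by (simp add: cc_def)
    show "summable (\<lambda>j. cc * b j * r' ^ j)" using summable_mult[OF sb, of cc] by (simp add: mult.assoc)
    show "nnorm (Ck_closure m W) (layer_form \<epsilon> A hs) \<le> cc * b (length hs) * prod_list (map (nnorm nspace_UNIV) hs)" for hs
    proof -
      have "0 \<le> prod_list (map norm hs)" by (induction hs) auto
      then have "nnorm (Ck_closure m W) (layer_form \<epsilon> A hs) \<le> cc * (b (length hs) * prod_list (map norm hs))"
        unfolding cc_def by (intro nnorm_Ck_closure_le(1) pd mult_nonneg_nonneg b0)
      then show ?thesis by (simp add: nspace_UNIV_def mult.assoc)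
    qed
    fix z :: "real \<times> real" assume "nnorm nspace_UNIV (z - z0) < r'"
    then have z: "norm (z - z0) < r'" by (simp add: nspace_UNIV_def)
    then show "z \<in> D'" using r1 r' by auto
    define \<delta> where "\<delta> = z - z0"
    define h where "h = fst \<delta>"
    have hn: "\<bar>h\<bar> \<le> norm \<delta>" using norm_fst_le[of "fst \<delta>" "snd \<delta>"] by (simp add: h_def)
    then have h: "\<bar>h\<bar> < r'" "\<bar>h\<bar> < \<rho>" using z r' by (auto simp: \<delta>_def)
    have zfst: "fst z = \<epsilon> + h" by (simp add: h_def \<delta>_def \<epsilon>_def)
    have zD: "z \<in> D" and lim: "(\<lambda>N. nnorm Y (\<Theta> z - (\<Sum>j<N. A (replicate j \<delta>)))) \<longlonglongrightarrow> 0"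
      using As[of z] z r' by (auto simp: \<delta>_def)
    have sums: "(\<lambda>n. layer_form \<epsilon> A (replicate n \<delta>) x) sums layer \<Theta> z x" if x: "x \<in> closure W" for x
    proof -
      have "(\<lambda>n. layer_form \<epsilon> A (replicate n \<delta>) x) sums (LINT s:K|M. G (x - p - (\<epsilon> + fst \<delta>) *\<^sub>R s) * \<Theta> z s)"
      proof (rule layer_form_sums[OF A \<epsilon> _ _ _ _ _ sa sd a0 d0 Y_cont[OF \<Theta>Y[OF zD]] x])
        show "\<bar>\<epsilon> + fst \<delta>\<bar> < e" using \<epsilon>h h by (simp add: h_def)
        show "norm (fst \<delta> ^ j *\<^sub>R kern [] j \<epsilon> x s) \<le> a j" if "x \<in> closure W" "s \<in> K" for j x s
        proof -
          have "norm (fst \<delta> ^ j *\<^sub>R kern [] j \<epsilon> x s) = \<bar>h\<bar> ^ j * norm (kern [] j \<epsilon> x s)"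
            by (simp add: h_def power_abs)
          also have "\<dots> \<le> r' ^ j * (C * Q ^ j)"
            using h kb[of "[]" x s j] that C Q r' by (intro mult_mono power_mono) auto
          finally show ?thesis by (simp add: a_def power_mult_distrib mult_ac)
        qed
        show "(\<lambda>j. fst \<delta> ^ j *\<^sub>R kern [] j \<epsilon> x s) sums G (x - p - (\<epsilon> + fst \<delta>) *\<^sub>R s)"
          if "x \<in> closure W" "s \<in> K" for x s
          using ks[OF that h(2)] by (simp add: h_def)
        show "norm (A (replicate j \<delta>) s) \<le> d j" if "s \<in> K" for j s
        proof -
          have "norm (A (replicate j \<delta>) s) \<le> c j * norm \<delta> ^ j"
            using order_trans[OF Y_norm[OF A_mem[OF A \<epsilon>] that] Ab, of "replicate j \<delta>"] by (simp add: prod_list_replicate)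
          also have "\<dots> \<le> d j"
            unfolding d_def using z c by (intro mult_left_mono power_mono) (auto simp: \<delta>_def)
          finally show ?thesis .
        qed
        show "(\<lambda>j. A (replicate j \<delta>) s) sums \<Theta> z s" if "s \<in> K" for s
        proof -
          have "norm (\<Theta> z s - (\<Sum>j<N. A (replicate j \<delta>) s)) \<le> nnorm Y (\<Theta> z - (\<Sum>j<N. A (replicate j \<delta>)))" for N
            using Y_norm[OF Y_diff_sum[where g = "\<lambda>j. A (replicate j \<delta>)" and N = N, OF \<Theta>Y[OF zD] A_mem[OF A \<epsilon>]] that]
            by (simp add: sum_fun_apply)
          then have "(\<lambda>N. \<Theta> z s - (\<Sum>j<N. A (replicate j \<delta>) s)) \<longlonglongrightarrow> 0"
            by (rule Lim_null_comparison[OF always_eventually, OF allI, OF _ lim])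
          from tendsto_diff[OF tendsto_const[of "\<Theta> z s"] this] show ?thesis by (simp add: sums_def)
        qed
      qed
      then show ?thesis using x by (simp add: layer_def restr_def zfst h_def)
    qed
    show "(\<lambda>N. nnorm (Ck_closure m W) (layer \<Theta> z - (\<Sum>j<N. layer_form \<epsilon> A (replicate j (z - z0))))) \<longlonglongrightarrow> 0"
      unfolding \<delta>_def[symmetric]
    proof (rule Ck_closure_series_tendsto[OF W(1) _ _ sb])
      show "layer_form \<epsilon> A (replicate j \<delta>) \<in> Ck_closure_set m W" for j
        by (rule layer_form_in_Ck_closure[OF A \<epsilon>])
      show "norm (pderivs is (layer_form \<epsilon> A (replicate j \<delta>)) x) \<le> b j * r' ^ j" if "length is \<le> m" "x \<in> W" for j "is" x
      proof -
        have "norm (pderivs is (layer_form \<epsilon> A (replicate j \<delta>)) x) \<le> b j * norm \<delta> ^ j"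
          using pd[OF that, of "replicate j \<delta>"] by (simp add: prod_list_replicate)
        also have "\<dots> \<le> b j * r' ^ j"
          using z b0 by (intro mult_left_mono power_mono) (auto simp: \<delta>_def)
        finally show ?thesis .
      qed
      show "0 \<le> b j * r' ^ j" for j using b0 r' by simp
      show "(\<lambda>j. layer_form \<epsilon> A (replicate j \<delta>) x) sums layer \<Theta> z x" if "x \<in> W" for x
        using sums that closure_subset by blast
    qed
  qed (rule r'(1))
qed

end

section \<open>The solution near a fixed set\<close>

lemma nopen_nspace_UNIV: "nopen nspace_UNIV D \<longleftrightarrow> open D"
  unfolding nopen_def nspace_UNIV_def by (auto simp: open_dist dist_norm)

lemma C0_boundary_hoelder:
  assumes "f \<in> nset (C0_boundary \<alpha> \<Omega>)"
  obtains C where "\<And>x y. x \<in> frontier \<Omega> \<Longrightarrow> y \<in> frontier \<Omega> \<Longrightarrow> norm (f x - f y) \<le> C * dist x y powr \<alpha>"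
  using assms by (auto simp: C0_boundary_def hoelder_on_def)

lemma C0_boundary_cont:
  assumes "0 < \<alpha>" "f \<in> nset (C0_boundary \<alpha> \<Omega>)"
  shows "continuous_on (frontier \<Omega>) f"
proof -
  obtain C where C: "\<And>x y. x \<in> frontier \<Omega> \<Longrightarrow> y \<in> frontier \<Omega> \<Longrightarrow> norm (f x - f y) \<le> C * dist x y powr \<alpha>"
    using C0_boundary_hoelder[OF assms(2)] by blast
  show ?thesis
    unfolding continuous_on_def
  proof
    fix x assume x: "x \<in> frontier \<Omega>"
    have "((\<lambda>y. C * dist y x powr \<alpha>) \<longlongrightarrow> C * dist x x powr \<alpha>) (at x within frontier \<Omega>)"
      using assms(1) by (intro tendsto_intros tendsto_powr') auto
    then have lim: "((\<lambda>y. C * dist y x powr \<alpha>) \<longlongrightarrow> 0) (at x within frontier \<Omega>)" by simp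
    have "\<forall>\<^sub>F y in at x within frontier \<Omega>. norm (f y - f x) \<le> C * dist y x powr \<alpha>"
      using C x by (auto simp: eventually_at_filter)
    from Lim_null_comparison[OF this lim] show "(f \<longlongrightarrow> f x) (at x within frontier \<Omega>)"
      by (rule LIM_zero_cancel)
  qed
qed

text \<open>Each \<open>Sup\<close> in the norm dominates its elements only if the set is bounded
  above, which is where boundedness of \<open>f\<close> and the Hoelder condition enter; the
  inserted 0 makes the seminorm nonnegative.\<close>

lemma C0_boundary_norm_le:
  assumes "f \<in> nset (C0_boundary \<alpha> \<Omega>)" "s \<in> frontier \<Omega>"
  shows "norm (f s) \<le> nnorm (C0_boundary \<alpha> \<Omega>) f"
proof -
  obtain C where C: "\<And>x y. x \<in> frontier \<Omega> \<Longrightarrow> y \<in> frontier \<Omega> \<Longrightarrow> norm (f x - f y) \<le> C * dist x y powr \<alpha>"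
    using C0_boundary_hoelder[OF assms(1)] by blast
  obtain b where b: "\<And>x. x \<in> frontier \<Omega> \<Longrightarrow> norm (f x) \<le> b"
    using assms by (auto simp: C0_boundary_def bounded_iff)
  have "norm (f s) \<le> sup_norm (frontier \<Omega>) f"
    unfolding sup_norm_def using assms(2) b by (intro cSup_upper bdd_aboveI[of _ "max 0 b"]) force+
  moreover have "0 \<le> hoelder_seminorm \<alpha> (frontier \<Omega>) f"
    unfolding hoelder_seminorm_def
    using C by (intro cSup_upper bdd_aboveI[of _ "max 0 C"]) (auto simp: divide_le_eq le_max_iff_disj)
  ultimately show ?thesis by (simp add: C0_boundary_def)
qed

lemma C0_boundary_add:
  assumes "f \<in> nset (C0_boundary \<alpha> \<Omega>)" "g \<in> nset (C0_boundary \<alpha> \<Omega>)"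
  shows "f + g \<in> nset (C0_boundary \<alpha> \<Omega>)"
proof -
  obtain C where C: "\<And>x y. x \<in> frontier \<Omega> \<Longrightarrow> y \<in> frontier \<Omega> \<Longrightarrow> norm (f x - f y) \<le> C * dist x y powr \<alpha>"
    using C0_boundary_hoelder[OF assms(1)] by blast
  obtain D where D: "\<And>x y. x \<in> frontier \<Omega> \<Longrightarrow> y \<in> frontier \<Omega> \<Longrightarrow> norm (g x - g y) \<le> D * dist x y powr \<alpha>"
    using C0_boundary_hoelder[OF assms(2)] by blast
  have "norm ((f + g) x - (f + g) y) \<le> (C + D) * dist x y powr \<alpha>" if "x \<in> frontier \<Omega>" "y \<in> frontier \<Omega>" for x y
  proof -
    have "norm ((f + g) x - (f + g) y) = norm ((f x - f y) + (g x - g y))" by (simp add: algebra_simps)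
    then show ?thesis
      using norm_triangle_ineq[of "f x - f y" "g x - g y"] C[OF that] D[OF that] by (simp add: distrib_right)
  qed
  then have "hoelder_on \<alpha> (frontier \<Omega>) (f + g)" unfolding hoelder_on_def by blast
  moreover have "bounded ((f + g) ` frontier \<Omega>)"
    using assms bounded_plus_comp[of f "frontier \<Omega>" g] by (auto simp: C0_boundary_def plus_fun_def)
  ultimately show ?thesis using assms by (auto simp: C0_boundary_def)
qed

lemma C0_boundary_scaleR:
  assumes "f \<in> nset (C0_boundary \<alpha> \<Omega>)"
  shows "r *\<^sub>R f \<in> nset (C0_boundary \<alpha> \<Omega>)"
proof -
  obtain C where C: "\<And>x y. x \<in> frontier \<Omega> \<Longrightarrow> y \<in> frontier \<Omega> \<Longrightarrow> norm (f x - f y) \<le> C * dist x y powr \<alpha>"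
    using C0_boundary_hoelder[OF assms] by blast
  have "norm ((r *\<^sub>R f) x - (r *\<^sub>R f) y) \<le> (\<bar>r\<bar> * C) * dist x y powr \<alpha>" if "x \<in> frontier \<Omega>" "y \<in> frontier \<Omega>" for x y
    using mult_left_mono[OF C[OF that], of "\<bar>r\<bar>"]
    by (simp add: scaleR_fun_def scaleR_diff_right[symmetric] mult.assoc del: scaleR_diff_right)
  then have "hoelder_on \<alpha> (frontier \<Omega>) (r *\<^sub>R f)" unfolding hoelder_on_def by blast
  moreover have "bounded ((r *\<^sub>R f) ` frontier \<Omega>)"
    using assms bounded_scaleR_comp[of f "frontier \<Omega>" r] by (auto simp: C0_boundary_def scaleR_fun_def)
  ultimately show ?thesis using assms by (auto simp: C0_boundary_def scaleR_fun_def)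
qed

text \<open>Half of \<open>d\<close> is spent on the passage to the closure, the other half on the
  size \<open>\<bar>\<epsilon>\<bar> R\<close> of the inclusion. The estimate also covers \<epsilon>
  negative or 0.\<close>

lemma subset_periodic_exterior:
  assumes d: "\<And>x z. x \<in> A \<Longrightarrow> z \<in> int_lattice \<Longrightarrow> d \<le> dist x (p + q *v z)"
    and R: "\<And>s. s \<in> \<Omega> \<Longrightarrow> norm s \<le> R" and "0 < d" and \<epsilon>: "\<bar>\<epsilon>\<bar> * R < d / 2"
  shows "A \<subseteq> periodic_exterior q (inclusion \<Omega> p \<epsilon>)"
proof
  fix x assume x: "x \<in> A"
  show "x \<in> periodic_exterior q (inclusion \<Omega> p \<epsilon>)"
    unfolding periodic_exterior_def
  proof
    assume "x \<in> closure (periodic_union q (inclusion \<Omega> p \<epsilon>))"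
    then obtain y where y: "y \<in> periodic_union q (inclusion \<Omega> p \<epsilon>)" "dist y x < d / 2"
      using \<open>0 < d\<close> unfolding closure_approachable by (meson half_gt_zero)
    then obtain z s where z: "z \<in> int_lattice" "s \<in> \<Omega>" "y = q *v z + (p + \<epsilon> *\<^sub>R s)"
      by (auto simp: periodic_union_def inclusion_def)
    have "dist y (p + q *v z) = \<bar>\<epsilon>\<bar> * norm s" by (simp add: z(3) dist_norm)
    also have "\<dots> \<le> \<bar>\<epsilon>\<bar> * R" using R[OF z(2)] by (intro mult_left_mono) auto
    finally have "dist x (p + q *v z) < d"
      using \<epsilon> y(2) dist_triangle[of x "p + q *v z" y] by (simp add: dist_commute)
    then show False using d[OF x z(1)] by simp
  qed
qed

lemma qp_single_layer_inclusion:
  fixes \<Omega> :: "(real^'n::finite) set"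
  assumes \<epsilon>: "0 < \<epsilon>" and G: "continuous_on S G" and \<theta>: "continuous_on (frontier \<Omega>) \<theta>"
    and S: "\<And>s. s \<in> frontier \<Omega> \<Longrightarrow> x - p - \<epsilon> *\<^sub>R s \<in> S"
  shows "qp_single_layer G (inclusion \<Omega> p \<epsilon>) (\<lambda>y. \<theta> ((y - p) /\<^sub>R \<epsilon>)) x =
    complex_of_real (\<epsilon> ^ (CARD('n) - 1)) * (LINT s:frontier \<Omega>|surface_measure. G (x - p - \<epsilon> *\<^sub>R s) * \<theta> s)"
proof -
  let ?f = "\<lambda>s. p + \<epsilon> *\<^sub>R s" and ?h = "\<lambda>y. G (x - y) * \<theta> ((y - p) /\<^sub>R \<epsilon>)"
  have "continuous_on (?f ` frontier \<Omega>) ?h"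
  proof (intro continuous_on_mult)
    show "continuous_on (?f ` frontier \<Omega>) (\<lambda>y. G (x - y))"
      by (rule continuous_on_compose2[OF G]) (auto intro!: continuous_intros simp: diff_diff_eq[symmetric] S)
    show "continuous_on (?f ` frontier \<Omega>) (\<lambda>y. \<theta> ((y - p) /\<^sub>R \<epsilon>))"
      by (rule continuous_on_compose2[OF \<theta>]) (use \<epsilon> in \<open>auto intro!: continuous_intros\<close>)
  qed
  \<comment> \<open>The boundary carries the measure of dimension \<open>n - 1\<close>, which is the
    origin of the power of \<epsilon> in the theorem.\<close>
  from set_integral_hausdorff_affine[OF \<epsilon> frontier_closed this, of "CARD('n) - 1"]
  have "set_lebesgue_integral surface_measure (?f ` frontier \<Omega>) ?h =
    \<epsilon> ^ (CARD('n) - 1) *\<^sub>R (LINT s:frontier \<Omega>|surface_measure. ?h (?f s))"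
    by (simp only: surface_measure_def)
  also have "(\<lambda>s. ?h (?f s)) = (\<lambda>s. G (x - p - \<epsilon> *\<^sub>R s) * \<theta> s)"
    using \<epsilon> by (auto simp: diff_diff_eq)
  finally show ?thesis
    using frontier_affine_image[of \<epsilon> p \<Omega>] \<epsilon>
    by (simp add: qp_single_layer_def boundary_integral_def inclusion_def scaleR_conv_of_real)
qed

text \<open>For \<open>n = 2\<close> the power \<open>e ^ (n - 2)\<close> is 1 even at
  \<open>e = 0\<close>; the terms with it vanish because of the factor \<open>r\<close>. The other
  correction terms carry a positive power of \<epsilon>, as \<open>n - 1 > 0\<close>.\<close>

lemma Lambda_op_0_0:
  fixes \<Omega> :: "(real^'n::finite) set"
  assumes "2 \<le> CARD('n)"
  shows "Lambda_op G k \<Omega> M1 N1 B 0 0 \<theta> t = \<theta> t / 2 + op_K_star \<Omega> \<theta> t - B 0 t"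
proof -
  have zero: "(0::complex) ^ (CARD('n) - Suc 0) = 0" using assms by (intro zero_power) simp
  show ?thesis by (simp add: zero Lambda_op_def Let_def zero_fun_def)
qed

theorem theorem6p5:
  fixes \<alpha> :: real and q :: "real^'n^'n::finite" and \<eta> p :: "real^'n" and k :: complex
    and \<Omega> V :: "(real^'n) set"
    and G :: "real^'n \<Rightarrow> complex"
    and \<epsilon>0 \<epsilon>M \<epsilon>N \<epsilon>sh \<epsilon>1 r1 :: real
    and M1 N1 :: "real \<Rightarrow> (real^'n \<Rightarrow> complex) \<Rightarrow> real^'n \<Rightarrow> complex"
    and B :: "(real^'n \<Rightarrow> complex) \<Rightarrow> real^'n \<Rightarrow> complex"
    and \<theta>0 :: "real^'n \<Rightarrow> complex"
    and Nb :: "(real^'n \<Rightarrow> complex) set"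
    and \<Theta> :: "real \<times> real \<Rightarrow> real^'n \<Rightarrow> complex"
  assumes "2 \<le> CARD('n)"
    and "0 < \<alpha>" and "\<alpha> < 1"
    and "pos_diagonal q"
    and "k\<^sup>2 \<notin> spectrum_qp q \<eta>"
    and "is_qp_green q \<eta> k G"
    and "bounded \<Omega>" and "open \<Omega>" and "connected \<Omega>" and "of_class_C1 \<alpha> \<Omega>"
    and "connected (- closure \<Omega>)"
    and "p \<in> cell q"
    and "0 < \<epsilon>0" and "\<forall>\<epsilon>. \<bar>\<epsilon>\<bar> < \<epsilon>0 \<longrightarrow> inclusion (closure \<Omega>) p \<epsilon> \<subseteq> cell q"
    \<comment> \<open>the operators M1 and N1\<close>
    and "0 < \<epsilon>M" and "\<epsilon>M < \<epsilon>0" and "0 < \<epsilon>N" and "\<epsilon>N < \<epsilon>0"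
    and "real_analytic_map nspace_UNIV (bounded_linear_ops (C0_boundary \<alpha> \<Omega>) (C1_boundary \<alpha> \<Omega>))
           {-\<epsilon>M<..<\<epsilon>M} M1"
    and "real_analytic_map nspace_UNIV (bounded_linear_ops (C0_boundary \<alpha> \<Omega>) (C0_boundary \<alpha> \<Omega>))
           {-\<epsilon>N<..<\<epsilon>N} N1"
    and "\<forall>\<theta>\<in>nset (C0_boundary \<alpha> \<Omega>). \<forall>\<epsilon>\<in>{0<..<\<epsilon>M}. \<forall>t\<in>frontier \<Omega>.
           qp_single_layer G (inclusion \<Omega> p \<epsilon>) (\<lambda>y. \<theta> ((y - p) /\<^sub>R \<epsilon>)) (p + \<epsilon> *\<^sub>R t) =
             complex_of_real \<epsilon> * op_V \<Omega> \<theta> t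
             + complex_of_real (\<epsilon>\<^sup>2) * M1 \<epsilon> \<theta> t
             + complex_of_real (\<epsilon> ^ (CARD('n) - 1)) * op_M2 G k \<Omega> \<epsilon> \<theta> t
             + complex_of_real (\<epsilon> ^ (CARD('n) - 1) * ln \<epsilon>) * k ^ (CARD('n) - 2) * op_M3 k \<Omega> \<epsilon> \<theta> t"
    and "\<forall>\<theta>\<in>nset (C0_boundary \<alpha> \<Omega>). \<forall>\<epsilon>\<in>{0<..<\<epsilon>N}. \<forall>t\<in>frontier \<Omega>.
           qp_K_star G (inclusion \<Omega> p \<epsilon>) (\<lambda>y. \<theta> ((y - p) /\<^sub>R \<epsilon>)) (p + \<epsilon> *\<^sub>R t) =
             op_K_star \<Omega> \<theta> t
             + complex_of_real \<epsilon> * N1 \<epsilon> \<theta> t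
             + complex_of_real (\<epsilon> ^ (CARD('n) - 1)) * op_N2 G k \<Omega> \<epsilon> \<theta> t
             + complex_of_real (\<epsilon> ^ (CARD('n) - 1) * ln \<epsilon>) * k ^ (CARD('n) - 2) * op_N3 k \<Omega> \<epsilon> \<theta> t"
    \<comment> \<open>the admissible threshold\<close>
    and "0 < \<epsilon>sh" and "\<epsilon>sh < \<epsilon>0" and "\<epsilon>sh < min \<epsilon>M \<epsilon>N"
    and "\<forall>\<epsilon>\<in>{0<..<\<epsilon>sh}. k\<^sup>2 \<notin> spectrum_neumann \<alpha> q \<eta> (inclusion \<Omega> p \<epsilon>) \<and>
           k\<^sup>2 \<notin> spectrum_dirichlet \<alpha> (inclusion \<Omega> p \<epsilon>)"
    and "real_analytic_map (C0_boundary \<alpha> \<Omega>) (C0_boundary \<alpha> \<Omega>) (nset (C0_boundary \<alpha> \<Omega>)) B"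
    \<comment> \<open>the unique solution of the limiting boundary equation\<close>
    and "\<theta>0 \<in> nset (C0_boundary \<alpha> \<Omega>)" and "\<forall>t\<in>frontier \<Omega>. \<theta>0 t / 2 + op_K_star \<Omega> \<theta>0 t = B 0 t"
    and "\<forall>\<theta>\<in>nset (C0_boundary \<alpha> \<Omega>).
           (\<forall>t\<in>frontier \<Omega>. \<theta> t / 2 + op_K_star \<Omega> \<theta> t = B 0 t) \<longrightarrow> \<theta> = \<theta>0"
    \<comment> \<open>the map whose graph is the zero set of Lambda\<close>
    and "0 < \<epsilon>1" and "\<epsilon>1 < \<epsilon>sh" and "0 < r1"
    and "nopen (C0_boundary \<alpha> \<Omega>) Nb" and "\<theta>0 \<in> Nb"
    and "real_analytic_map nspace_UNIV (C0_boundary \<alpha> \<Omega>) ({-\<epsilon>1<..<\<epsilon>1} \<times> {-r1<..<r1}) \<Theta>"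
    and "\<Theta> ` ({-\<epsilon>1<..<\<epsilon>1} \<times> {-r1<..<r1}) \<subseteq> Nb"
    and "\<forall>\<epsilon>\<in>{0<..<\<epsilon>1}. \<epsilon> * ln \<epsilon> \<in> {-r1<..<r1}"
    and "{(\<epsilon>, r, \<theta>). \<epsilon> \<in> {-\<epsilon>1<..<\<epsilon>1} \<and> r \<in> {-r1<..<r1} \<and> \<theta> \<in> Nb \<and>
            (\<forall>t\<in>frontier \<Omega>. Lambda_op G k \<Omega> M1 N1 B \<epsilon> r \<theta> t = 0)}
         = {(\<epsilon>, r, \<theta>). \<epsilon> \<in> {-\<epsilon>1<..<\<epsilon>1} \<and> r \<in> {-r1<..<r1} \<and> \<theta> = \<Theta> (\<epsilon>, r)}"
    and "bounded V" and "open V"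
    and "closure V \<inter> {p + q *v z | z. z \<in> int_lattice} = {}"
  shows "\<exists>\<epsilon>2. 0 < \<epsilon>2 \<and> \<epsilon>2 \<le> \<epsilon>1 \<and>
           (\<forall>\<epsilon>\<in>{-\<epsilon>2<..<\<epsilon>2}. closure V \<subseteq> periodic_exterior q (inclusion \<Omega> p \<epsilon>)) \<and>
           (\<exists>U. real_analytic_map nspace_UNIV (Ck_closure 2 V) ({-\<epsilon>2<..<\<epsilon>2} \<times> {-r1<..<r1}) U \<and>
              (\<forall>\<epsilon>\<in>{0<..<\<epsilon>2}. \<forall>x\<in>closure V.
                 solution_family q G \<Omega> p \<Theta> \<epsilon> x =
                   complex_of_real (\<epsilon> ^ (CARD('n) - 1)) * U (\<epsilon>, tau CARD('n) * (\<epsilon> * ln \<epsilon>)) x) \<and>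
              (\<forall>x\<in>closure V. U (0, 0) x = G (x - p) * boundary_integral \<Omega> \<theta>0))"
proof -
  define K where "K = frontier \<Omega>"
  define S where "S = - ((*v) q ` int_lattice)"
  define Y where "Y = C0_boundary \<alpha> \<Omega>"
  have green: "real_analytic_map nspace_UNIV nspace_UNIV S G"
    using \<open>is_qp_green q \<eta> k G\<close> by (simp add: is_qp_green_def S_def)
  have G: "expandable_on S G" by (rule expandable_onI[OF green])
  have openS: "open S" using green by (simp add: real_analytic_map_def nopen_nspace_UNIV)
  \<comment> \<open>That the lattice is closed is contained in the analyticity of \<open>G\<close>,
    whose domain \<open>S\<close> is open by the definition of an analytic map.\<close>
  have lattice: "closed {p + q *v z |z. z \<in> int_lattice}"
  proof -
    have "closed ((+) p ` (- S))" using openS by (intro closed_translation) auto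
    moreover have "(+) p ` (- S) = {p + q *v z |z. z \<in> int_lattice}" by (auto simp: S_def)
    ultimately show ?thesis by simp
  qed
  have "compact (closure V)" using \<open>bounded V\<close> by simp
  from separate_compact_closed[OF this lattice \<open>closure V \<inter> _ = {}\<close>]
  obtain d where d0: "0 < d" and "\<forall>x\<in>closure V. \<forall>y\<in>{p + q *v z |z. z \<in> int_lattice}. d \<le> dist x y"
    by blast
  then have d: "d \<le> dist x (p + q *v z)" if "x \<in> closure V" "z \<in> int_lattice" for x z
    using that by blast
  obtain R where R: "0 < R" "\<And>s. s \<in> closure \<Omega> \<Longrightarrow> norm s \<le> R"
    using bounded_closure[OF \<open>bounded \<Omega>\<close>] by (auto simp: bounded_pos)
  \<comment> \<open>\<open>d / (2 * R)\<close> is the value at which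
    \<open>\<bar>\<epsilon>\<bar> R\<close> reaches \<open>d / 2\<close>; the same threshold serves
    for the exterior and for the domain of \<open>G\<close>.\<close>
  define \<epsilon>2 where "\<epsilon>2 = min \<epsilon>1 (d / (2 * R))"
  have \<epsilon>2: "0 < \<epsilon>2" "\<epsilon>2 \<le> \<epsilon>1" using \<open>0 < \<epsilon>1\<close> d0 R by (auto simp: \<epsilon>2_def)
  have small: "\<bar>\<epsilon>\<bar> * R < d / 2" if "\<bar>\<epsilon>\<bar> < \<epsilon>2" for \<epsilon>
  proof -
    have "\<bar>\<epsilon>\<bar> < d / (2 * R)" using that by (simp add: \<epsilon>2_def)
    then show ?thesis using R(1) by (simp add: field_simps)
  qed
  have ext: "closure V \<subseteq> periodic_exterior q (inclusion \<Omega> p \<epsilon>)" if "\<bar>\<epsilon>\<bar> < \<epsilon>2" for \<epsilon>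
    by (rule subset_periodic_exterior[OF d R(2) d0 small[OF that]]) (use closure_subset in auto)
  have dom: "x - p - \<epsilon> *\<^sub>R s \<in> S" if x: "x \<in> closure V" and s: "s \<in> K" and \<epsilon>: "\<bar>\<epsilon>\<bar> < \<epsilon>2" for x s \<epsilon>
  proof (rule ccontr)
    assume "x - p - \<epsilon> *\<^sub>R s \<notin> S"
    then obtain z where z: "z \<in> int_lattice" "x - p - \<epsilon> *\<^sub>R s = q *v z" by (auto simp: S_def)
    then have "x - (p + q *v z) = \<epsilon> *\<^sub>R s" by (simp add: algebra_simps)
    then have "dist x (p + q *v z) = \<bar>\<epsilon>\<bar> * norm s" by (simp add: dist_norm)
    also have "\<dots> \<le> \<bar>\<epsilon>\<bar> * R"
      using R(2)[of s] s by (intro mult_left_mono) (auto simp: K_def frontier_def)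
    finally show False using small[OF \<epsilon>] d[OF x z(1)] d0 by linarith
  qed
  interpret analytic_layer surface_measure K G S V p \<epsilon>2 R Y
  proof unfold_locales
    show "sets (surface_measure :: (real^'n) measure) = sets borel"
      by (simp add: surface_measure_def sets_hausdorff_measure)
    show "compact K" unfolding K_def using \<open>bounded \<Omega>\<close> by (rule compact_frontier_bounded)
    show "emeasure surface_measure K < \<infinity>"
      unfolding K_def by (rule of_class_C1_surface_finite) fact+
    show "norm s \<le> R" if "s \<in> K" for s using R(2)[of s] that by (auto simp: K_def frontier_def)
    show "continuous_on K f" if "f \<in> nset Y" for f
      unfolding K_def by (rule C0_boundary_cont[OF \<open>0 < \<alpha>\<close> that[unfolded Y_def]])
    show "norm (f s) \<le> nnorm Y f" if "f \<in> nset Y" "s \<in> K" for f s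
      using C0_boundary_norm_le that unfolding K_def Y_def by blast
    show "f + g \<in> nset Y" if "f \<in> nset Y" "g \<in> nset Y" for f g
      using C0_boundary_add that unfolding Y_def by blast
    show "r *\<^sub>R f \<in> nset Y" if "f \<in> nset Y" for f r
      using C0_boundary_scaleR that unfolding Y_def by blast
  qed (use G dom R \<open>bounded V\<close> \<open>open V\<close> in auto)
  have \<Theta>: "real_analytic_map nspace_UNIV Y ({-\<epsilon>1<..<\<epsilon>1} \<times> {-r1<..<r1}) \<Theta>"
    unfolding Y_def by fact
  have an: "real_analytic_map nspace_UNIV (Ck_closure 2 V) ({-\<epsilon>2<..<\<epsilon>2} \<times> {-r1<..<r1}) (layer \<Theta>)"
    by (rule real_analytic_layer[OF \<Theta>])
      (use \<epsilon>2 in \<open>auto simp: nopen_nspace_UNIV intro!: open_Times\<close>)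
  have lay: "layer \<Theta> z x = (LINT s:frontier \<Omega>|surface_measure. G (x - p - fst z *\<^sub>R s) * \<Theta> z s)"
    if "x \<in> closure V" for x z
    using that unfolding layer_def by (simp add: restr_def K_def)
  have sol: "solution_family q G \<Omega> p \<Theta> \<epsilon> x =
      complex_of_real (\<epsilon> ^ (CARD('n) - 1)) * layer \<Theta> (\<epsilon>, tau CARD('n) * (\<epsilon> * ln \<epsilon>)) x"
    if \<epsilon>: "\<epsilon> \<in> {0<..<\<epsilon>2}" and x: "x \<in> closure V" for \<epsilon> x
  proof -
    define z where "z = (\<epsilon>, tau CARD('n) * (\<epsilon> * ln \<epsilon>))"
    have "\<epsilon> * ln \<epsilon> \<in> {-r1<..<r1}"
      using \<open>\<forall>\<epsilon>\<in>{0<..<\<epsilon>1}. \<epsilon> * ln \<epsilon> \<in> {-r1<..<r1}\<close> \<epsilon> \<epsilon>2 by auto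
    \<comment> \<open>\<open>tau\<close> is 0 or 1, and 0 lies in the interval as well, so the
      second component is admissible in both parities.\<close>
    then have "z \<in> {-\<epsilon>1<..<\<epsilon>1} \<times> {-r1<..<r1}"
      using \<epsilon> \<epsilon>2 \<open>0 < r1\<close> by (auto simp: z_def tau_def)
    then have "\<Theta> z \<in> nset Y" using \<Theta> by (auto simp: real_analytic_map_def)
    then have cont: "continuous_on (frontier \<Omega>) (\<Theta> z)" unfolding K_def[symmetric] by (rule Y_cont)
    \<comment> \<open>This puts \<open>x\<close> where the restriction in
      \<open>qp_single_layer_ext\<close> keeps the value of the potential.\<close>
    have "x \<in> closure (periodic_exterior q (inclusion \<Omega> p \<epsilon>))"
      using ext[of \<epsilon>] \<epsilon> x closure_subset by auto
    then have "solution_family q G \<Omega> p \<Theta> \<epsilon> x = qp_single_layer G (inclusion \<Omega> p \<epsilon>) (\<lambda>y. \<Theta> z ((y - p) /\<^sub>R \<epsilon>)) x"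
      by (simp add: solution_family_def qp_single_layer_ext_def restr_def z_def)
    also have "\<dots> = complex_of_real (\<epsilon> ^ (CARD('n) - 1)) *
        (LINT s:frontier \<Omega>|surface_measure. G (x - p - \<epsilon> *\<^sub>R s) * \<Theta> z s)"
      by (rule qp_single_layer_inclusion[OF _ expandable_on_continuous_on[OF G] cont dom[OF x]])
        (use \<epsilon> in \<open>auto simp: K_def\<close>)
    finally show ?thesis by (simp only: lay[OF x] z_def fst_conv)
  qed
  have "(0, 0, \<theta>0) \<in> {(\<epsilon>, r, \<theta>). \<epsilon> \<in> {-\<epsilon>1<..<\<epsilon>1} \<and> r \<in> {-r1<..<r1} \<and> \<theta> = \<Theta> (\<epsilon>, r)}"
    unfolding \<open>_ = {(\<epsilon>, r, \<theta>). \<epsilon> \<in> {-\<epsilon>1<..<\<epsilon>1} \<and> r \<in> {-r1<..<r1} \<and> \<theta> = \<Theta> (\<epsilon>, r)}\<close>[symmetric]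
    using \<open>0 < \<epsilon>1\<close> \<open>0 < r1\<close> \<open>\<theta>0 \<in> Nb\<close> \<open>\<forall>t\<in>frontier \<Omega>. \<theta>0 t / 2 + op_K_star \<Omega> \<theta>0 t = B 0 t\<close>
    by (simp add: Lambda_op_0_0[OF \<open>2 \<le> CARD('n)\<close>])
  then have \<Theta>0: "\<Theta> (0, 0) = \<theta>0" by simp
  have "layer \<Theta> (0, 0) x = G (x - p) * boundary_integral \<Omega> \<theta>0" if "x \<in> closure V" for x
    by (simp add: lay[OF that] \<Theta>0 boundary_integral_def)
  with an sol \<epsilon>2 ext show ?thesis
    by (intro exI[of _ \<epsilon>2] conjI exI[of _ "layer \<Theta>"]) (auto simp: abs_less_iff)
qed

end
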